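(* For every topological space $X$ there is an isomorphism of topological groups $$h_X:F_M(\pi_0^{qtop}(X))\to \pi_1^{\tau}(\Sigma(X_+)),$$ natural in $X$, which sends the generator corresponding to the path component of a point $x\in X$ to the homotopy class of the loop $u_x(t)=x\wedge t$.
   Context: All spaces of maps carry the compact-open topology. For a based space $(Y,y_0)$, $\Omega(Y,y_0)$ is the space of loops $I=[0,1]\to Y$ based at $y_0$. The quasitopological fundamental group $\pi_1^{qtop}(Y,y_0)$ is the fundamental group $\pi_1(Y,y_0)$ with the quotient topology with respect to the map $\pi:\Omega(Y,y_0)\to\pi_1(Y,y_0)$, $\alpha\mapsto[\alpha]$. For a space $Y$, the free (Markov) topological group $F_M(Y)$ is the free group on the underlying set of $Y$ with the unique group topology such that the inclusion of generators $\sigma:Y\to F_M(Y)$ is continuous and every continuous map $Y\to H$ to a topological group extends uniquely to a continuous homomorphism $F_M(Y)\to H$. A group with topology is a group with an arbitrary topology. For such a $G$, $\tau(G)$ is the group $G$ with the quotient topology with respect to the multiplication epimorphism $m_G:F_M(G)\to G$, i.e. the homomorphism sending each generator $g$ to $g$. Define $\pi_1^{\tau}(Y,y_0)=\tau(\pi_1^{qtop}(Y,y_0))$; this is a topological group. The path component space $\pi_0^{qtop}(X)$ is the set of path components of $X$ with the quotient topology from $X$. The generalized wedge of circles on a space $X$ is $\Sigma(X_+)=X\times I/(X\times\{0,1\})$, based at the image of $X\times\{0,1\}$; the image of $(x,t)$ is written $x\wedge t$. *)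

theory Defs
  imports "HOL-Analysis.Analysis" "HOL-Algebra.Group"
begin

definition quotient_top :: "'a topology \<Rightarrow> ('a \<Rightarrow> 'b) \<Rightarrow> 'b topology" where
  "quotient_top X f = topology (\<lambda>U. U \<subseteq> f ` topspace X \<and> openin X {x \<in> topspace X. f x \<in> U})"

definition group_topology :: "('g, 'm) monoid_scheme \<Rightarrow> 'g topology \<Rightarrow> bool" where
  "group_topology G T \<longleftrightarrow> topspace T = carrier G \<and>
     continuous_map (prod_topology T T) T (\<lambda>(a, b). a \<otimes>\<^bsub>G\<^esub> b) \<and>
     continuous_map T T (\<lambda>a. inv\<^bsub>G\<^esub> a)"

definition top_group_iso ::
  "('g, 'm) monoid_scheme \<Rightarrow> 'g topology \<Rightarrow> ('h, 'n) monoid_scheme \<Rightarrow> 'h topology \<Rightarrow> ('g \<Rightarrow> 'h) \<Rightarrow> bool" where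
  "top_group_iso G T H S h \<longleftrightarrow> h \<in> iso G H \<and> homeomorphic_map T S h"

text \<open>Words are lists of letters (x, True) = x and (x, False) = x^{-1}.\<close>
definition reduced_word :: "('b \<times> bool) list \<Rightarrow> bool" where
  "reduced_word w \<longleftrightarrow> (\<forall>i. Suc i < length w \<longrightarrow>
      \<not> (fst (w ! i) = fst (w ! Suc i) \<and> snd (w ! i) \<noteq> snd (w ! Suc i)))"

definition reduce_word :: "('b \<times> bool) list \<Rightarrow> ('b \<times> bool) list" where
  "reduce_word w = foldr (\<lambda>a acc. case acc of [] \<Rightarrow> [a]
      | b # rest \<Rightarrow> (if fst a = fst b \<and> snd a \<noteq> snd b then rest else a # acc)) w []"

definition free_grp :: "'b set \<Rightarrow> ('b \<times> bool) list monoid" where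
  "free_grp S = \<lparr> carrier = {w. reduced_word w \<and> fst ` set w \<subseteq> S},
                 mult = (\<lambda>v w. reduce_word (v @ w)),
                 one = [] \<rparr>"

definition free_gen :: "'b \<Rightarrow> ('b \<times> bool) list" where
  "free_gen x = [(x, True)]"

definition free_map :: "('b \<Rightarrow> 'c) \<Rightarrow> ('b \<times> bool) list \<Rightarrow> ('c \<times> bool) list" where
  "free_map g w = reduce_word (map (\<lambda>(x, e). (g x, e)) w)"

text \<open>The free (Markov) topological group F_M(Y): the free group on topspace Y with the
  finest group topology making the inclusion of generators continuous (the supremum of all
  such group topologies).\<close>
definition markov_top :: "'b topology \<Rightarrow> ('b \<times> bool) list topology" where
  "markov_top Y = topology_generated_by
     (\<Union>{ {U. openin T U} | T. group_topology (free_grp (topspace Y)) T \<and>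
                               continuous_map Y T free_gen })"

definition mult_epi :: "('g, 'm) monoid_scheme \<Rightarrow> ('g \<times> bool) list \<Rightarrow> 'g" where
  "mult_epi G w = foldr (\<lambda>(g, e) acc. (if e then g else inv\<^bsub>G\<^esub> g) \<otimes>\<^bsub>G\<^esub> acc) w \<one>\<^bsub>G\<^esub>"

definition tau_top :: "('g, 'm) monoid_scheme \<Rightarrow> 'g topology \<Rightarrow> 'g topology" where
  "tau_top G T = quotient_top (markov_top T) (mult_epi G)"

definition pi0_top :: "'a topology \<Rightarrow> 'a set topology" where
  "pi0_top X = quotient_top X (path_component_of_set X)"

definition pi0_map :: "'a topology \<Rightarrow> 'b topology \<Rightarrow> ('a \<Rightarrow> 'b) \<Rightarrow> 'a set \<Rightarrow> 'b set" where
  "pi0_map X Y f C = path_component_of_set Y (f (SOME x. x \<in> C))"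

definition loops :: "'a topology \<Rightarrow> 'a \<Rightarrow> (real \<Rightarrow> 'a) set" where
  "loops Y y0 = {g. pathin Y g \<and> g 0 = y0 \<and> g 1 = y0 \<and> g \<in> extensional {0..1}}"

definition loop_space_top :: "'a topology \<Rightarrow> 'a \<Rightarrow> (real \<Rightarrow> 'a) topology" where
  "loop_space_top Y y0 = subtopology
     (topology_generated_by {{g. g ` K \<subseteq> U} | K U. compactin (top_of_set {0..1}) K \<and> openin Y U})
     (loops Y y0)"

definition loop_homotopic :: "'a topology \<Rightarrow> 'a \<Rightarrow> (real \<Rightarrow> 'a) \<Rightarrow> (real \<Rightarrow> 'a) \<Rightarrow> bool" where
  "loop_homotopic Y y0 p q \<longleftrightarrow>
     homotopic_with (\<lambda>h. h 0 = y0 \<and> h 1 = y0) (top_of_set {0..1}) Y p q"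

definition loop_class :: "'a topology \<Rightarrow> 'a \<Rightarrow> (real \<Rightarrow> 'a) \<Rightarrow> (real \<Rightarrow> 'a) set" where
  "loop_class Y y0 p = {q \<in> loops Y y0. loop_homotopic Y y0 p q}"

definition loop_join :: "(real \<Rightarrow> 'a) \<Rightarrow> (real \<Rightarrow> 'a) \<Rightarrow> real \<Rightarrow> 'a" where
  "loop_join p q = restrict (\<lambda>t. if t \<le> 1/2 then p (2 * t) else q (2 * t - 1)) {0..1}"

definition fundamental_group :: "'a topology \<Rightarrow> 'a \<Rightarrow> (real \<Rightarrow> 'a) set monoid" where
  "fundamental_group Y y0 = \<lparr> carrier = loop_class Y y0 ` loops Y y0,
       mult = (\<lambda>A B. loop_class Y y0 (loop_join (SOME p. p \<in> A) (SOME q. q \<in> B))),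
       one = loop_class Y y0 (restrict (\<lambda>t. y0) {0..1}) \<rparr>"

definition pi1_qtop :: "'a topology \<Rightarrow> 'a \<Rightarrow> (real \<Rightarrow> 'a) set topology" where
  "pi1_qtop Y y0 = quotient_top (loop_space_top Y y0) (loop_class Y y0)"

definition pi1_tau_top :: "'a topology \<Rightarrow> 'a \<Rightarrow> (real \<Rightarrow> 'a) set topology" where
  "pi1_tau_top Y y0 = tau_top (fundamental_group Y y0) (pi1_qtop Y y0)"

definition pi1_map :: "'a topology \<Rightarrow> 'a \<Rightarrow> 'b topology \<Rightarrow> 'b \<Rightarrow> ('a \<Rightarrow> 'b)
    \<Rightarrow> (real \<Rightarrow> 'a) set \<Rightarrow> (real \<Rightarrow> 'b) set" where
  "pi1_map Y y0 Z z0 \<phi> A = loop_class Z z0 (restrict (\<phi> \<circ> (SOME p. p \<in> A)) {0..1})"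

text \<open>Points of X x I / (X x {0,1}): None is the base point (image of X x {0,1}),
  Some (x,t) with 0 < t < 1 is the image of (x,t).\<close>
definition wedge_pt :: "'a \<Rightarrow> real \<Rightarrow> ('a \<times> real) option" where
  "wedge_pt x t = (if 0 < t \<and> t < 1 then Some (x, t) else None)"

definition gwedge_top :: "'a topology \<Rightarrow> ('a \<times> real) option topology" where
  "gwedge_top X = topology (\<lambda>U. U \<subseteq> insert None ((\<lambda>(x, t). wedge_pt x t) ` (topspace X \<times> {0..1}))
      \<and> openin (prod_topology X (top_of_set {0..1}))
               {(x, t) \<in> topspace X \<times> {0..1}. wedge_pt x t \<in> U})"

definition gwedge_base :: "('a \<times> real) option" where
  "gwedge_base = None"

definition wedge_loop :: "'a \<Rightarrow> real \<Rightarrow> ('a \<times> real) option" where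
  "wedge_loop x = restrict (wedge_pt x) {0..1}"

definition gwedge_map :: "('a \<Rightarrow> 'b) \<Rightarrow> ('a \<times> real) option \<Rightarrow> ('b \<times> real) option" where
  "gwedge_map f = map_option (\<lambda>(x, t). (f x, t))"

definition is_hX :: "'a topology \<Rightarrow> (('a set \<times> bool) list \<Rightarrow> (real \<Rightarrow> ('a \<times> real) option) set) \<Rightarrow> bool" where
  "is_hX X h \<longleftrightarrow>
     top_group_iso (free_grp (topspace (pi0_top X))) (markov_top (pi0_top X))
                   (fundamental_group (gwedge_top X) gwedge_base) (pi1_tau_top (gwedge_top X) gwedge_base) h
   \<and> (\<forall>x \<in> topspace X. h (free_gen (path_component_of_set X x))
                         = loop_class (gwedge_top X) gwedge_base (wedge_loop x))"

end

theory Submission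
  imports Defs
begin

text \<open>The wedge is covered by the complement of the base point and the complement of the circle
  midpoints \<open>x \<and> 1/2\<close>. Labelling the circle of \<open>x\<close> by an element \<open>g x\<close> of a group, depending only on the
  path component of \<open>x\<close>, gives a Cech cocycle for this cover, and hence a transport of paths that is
  multiplicative and homotopy invariant. With labels in the free group on \<open>\<pi>\<^sub>0\<close>, transport of loops is a
  homomorphism \<open>\<Phi>\<close> that sends \<open>u\<^sub>x\<close> to the generator of \<open>x\<close>; with labels \<open>[u\<^sub>x]\<close> in the
  fundamental group itself, uniqueness of transport shows that a loop is transported to its own class.
  So \<open>\<Phi>\<close> is inverse to \<open>h\<close>. Near a given loop, the transport is a finite product of labels of
  points of the loop and of their inverses, so \<open>\<Phi>\<close> is continuous from the loop space into the Markov
  group, and the universal properties of \<open>\<tau>\<close> and of the Markov topology do the rest.\<close>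

subsection \<open>Free groups\<close>

text \<open>Nothing is assumed about \<open>X\<close>, so its path components need not be open, and
  a label that is constant on each of them need not be locally constant. In general the cocycle
  therefore gives no covering space of the wedge. Lifts are instead built along one path at a time,
  as functions into a bare group without topology; the topology of \<open>X\<close> enters only in
  the continuity statements, where the label is a continuous map from \<open>X\<close> into a
  topological group.

  A second obstacle is that multiplication on \<open>pi1_qtop\<close> need not be jointly
  continuous, since products of quotient maps need not be quotient maps. Continuity of the two
  homomorphisms is therefore checked only before group structure is imposed, on generators for
  \<open>h\<close> and on the loop space for \<Phi>, and passes to the group topologies by universal
  properties.

  Transport replaces a van Kampen argument: that every loop is a product of circles is never proved
  by subdividing the loop, but results from comparing two lifts of it. The level 1/2 is an arbitrary
  choice of an interior point of each circle.\<close>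

text \<open>Left multiplication by one letter on reduced words. Naming this step of
  \<open>reduce_word\<close> permits van der Waerden's argument: words act on reduced words, and
  associativity comes from composition of actions.\<close>

definition push_letter :: "'b \<times> bool \<Rightarrow> ('b \<times> bool) list \<Rightarrow> ('b \<times> bool) list" where
  "push_letter a w = (case w of [] \<Rightarrow> [a]
      | b # rest \<Rightarrow> (if fst a = fst b \<and> snd a \<noteq> snd b then rest else a # w))"

lemma reduce_word_eq: "reduce_word w = foldr push_letter w []"
  by (simp add: reduce_word_def push_letter_def[abs_def])

lemma reduced_word_Nil [simp]: "reduced_word []"
  by (simp add: reduced_word_def)

lemma reduced_word_single [simp]: "reduced_word [a]"
  by (simp add: reduced_word_def)

lemma reduced_word_Cons2:
  "reduced_word (a # b # w) \<longleftrightarrow> \<not> (fst a = fst b \<and> snd a \<noteq> snd b) \<and> reduced_word (b # w)"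
proof -
  have "(\<forall>i. Suc i < length (a # b # w) \<longrightarrow> P i) \<longleftrightarrow>
        P 0 \<and> (\<forall>i. Suc i < length (b # w) \<longrightarrow> P (Suc i))" for P
    by (metis Suc_less_eq Suc_mono length_Cons not0_implies_Suc zero_less_Suc)
  then show ?thesis
    by (simp add: reduced_word_def)
qed

lemma reduced_word_tl: "reduced_word (a # w) \<Longrightarrow> reduced_word w"
  by (cases w) (auto simp: reduced_word_Cons2)

lemma push_letter_Cons_reduced: "reduced_word (a # w) \<Longrightarrow> push_letter a w = a # w"
  by (cases w) (auto simp: reduced_word_Cons2 push_letter_def)

lemma reduced_push_letter: "reduced_word w \<Longrightarrow> reduced_word (push_letter a w)"
  by (cases w) (auto simp: push_letter_def reduced_word_Cons2 dest: reduced_word_tl)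

text \<open>Opposite letters act as inverse permutations of the reduced words. Reducedness matters
  when \<open>b\<close> cancels the head: then \<open>a\<close> is that head, and pushing it back
  must not cancel again.\<close>

lemma push_letter_cancel:
  assumes "reduced_word w" "fst a = fst b" "snd a \<noteq> snd b"
  shows "push_letter a (push_letter b w) = w"
proof (cases w)
  case Nil
  then show ?thesis using assms by (simp add: push_letter_def)
next
  case (Cons c r)
  show ?thesis
  proof (cases "fst b = fst c \<and> snd b \<noteq> snd c")
    case True
    then have "a = c"
      using assms by (auto simp: prod_eq_iff)
    then show ?thesis
      using Cons True assms push_letter_Cons_reduced[of c r] by (simp add: push_letter_def)
  next
    case False
    then show ?thesis
      using Cons assms by (auto simp: push_letter_def)
  qed
qed

lemma reduced_foldr_push: "reduced_word acc \<Longrightarrow> reduced_word (foldr push_letter w acc)"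
  by (induction w) (auto intro: reduced_push_letter)

lemma reduced_reduce_word [simp]: "reduced_word (reduce_word w)"
  by (simp add: reduce_word_eq reduced_foldr_push)

lemma reduce_word_reduced: "reduced_word w \<Longrightarrow> reduce_word w = w"
proof (induction w)
  case (Cons a w)
  then show ?case
    using push_letter_Cons_reduced[of a w] reduced_word_tl[of a w] by (simp add: reduce_word_eq)
qed (simp add: reduce_word_eq)

text \<open>If \<open>a\<close> cancels the head of \<open>u\<close>, the missing pair of opposite
  letters would have acted trivially anyway. By induction, a word and its reduction act
  alike.\<close>

lemma foldr_push_push:
  assumes "reduced_word acc"
  shows "foldr push_letter (push_letter a u) acc = push_letter a (foldr push_letter u acc)"
proof (cases u)
  case (Cons b r)
  then show ?thesis
    using push_letter_cancel[of "foldr push_letter r acc" a b] reduced_foldr_push[OF assms, of r]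
    by (auto simp: push_letter_def[of a u] push_letter_def[of a "b # r"])
qed (simp add: push_letter_def)

lemma foldr_push_reduce_word:
  "reduced_word acc \<Longrightarrow> foldr push_letter (reduce_word w) acc = foldr push_letter w acc"
  by (induction w) (auto simp: reduce_word_eq foldr_push_push)

lemma reduce_word_append: "reduce_word (v @ w) = foldr push_letter v (reduce_word w)"
  by (simp add: reduce_word_eq)

lemma reduce_word_append_left: "reduce_word (reduce_word v @ w) = reduce_word (v @ w)"
  by (simp add: reduce_word_append foldr_push_reduce_word)

lemma reduce_word_append_right: "reduce_word (v @ reduce_word w) = reduce_word (v @ w)"
  by (simp add: reduce_word_append reduce_word_reduced)

lemma set_push_letter: "set (push_letter a w) \<subseteq> insert a (set w)"
  by (cases w) (auto simp: push_letter_def)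

lemma set_reduce_word: "set (reduce_word w) \<subseteq> set w"
proof (induction w)
  case (Cons a w)
  then show ?case
    using set_push_letter[of a "reduce_word w"] by (auto simp: reduce_word_eq)
qed (simp add: reduce_word_eq)

lemma group_free_grp: "group (free_grp S)"
proof (rule groupI)
  fix u v assume "u \<in> carrier (free_grp S)" "v \<in> carrier (free_grp S)"
  then show "u \<otimes>\<^bsub>free_grp S\<^esub> v \<in> carrier (free_grp S)"
    using set_reduce_word[of "u @ v"] by (force simp: free_grp_def)
next
  show "\<one>\<^bsub>free_grp S\<^esub> \<in> carrier (free_grp S)"
    by (simp add: free_grp_def)
next
  fix u v w
  show "u \<otimes>\<^bsub>free_grp S\<^esub> v \<otimes>\<^bsub>free_grp S\<^esub> w = u \<otimes>\<^bsub>free_grp S\<^esub> (v \<otimes>\<^bsub>free_grp S\<^esub> w)"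
    by (simp add: free_grp_def reduce_word_append_left reduce_word_append_right)
next
  fix u assume "u \<in> carrier (free_grp S)"
  then show "\<one>\<^bsub>free_grp S\<^esub> \<otimes>\<^bsub>free_grp S\<^esub> u = u"
    by (simp add: free_grp_def reduce_word_reduced)
next
  fix u assume u: "u \<in> carrier (free_grp S)"
  \<comment> \<open>The formal inverse: reversed, with flipped signs. The witness below is its
    reduction, which makes membership in the carrier immediate.\<close>
  define v where "v = map (\<lambda>(x, e). (x, \<not> e)) (rev u)"
  have "reduced_word u"
    using u by (simp add: free_grp_def)
  then have "reduce_word (v @ u) = []"
    unfolding v_def
  proof (induction u)
    case (Cons a u)
    have "reduce_word (a # u) = a # u" "reduce_word u = u"
      using Cons reduced_word_tl[of a u] by (auto intro: reduce_word_reduced)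
    then have "reduce_word ((fst a, \<not> snd a) # a # u) = u"
      by (simp add: reduce_word_eq) (simp add: push_letter_def)
    moreover note \<open>reduce_word u = u\<close>
    ultimately show ?case
      using Cons reduced_word_tl[of a u] by (simp add: case_prod_unfold reduce_word_append)
  qed (simp add: reduce_word_eq)
  moreover have "fst ` set v \<subseteq> S"
    using u by (force simp: v_def free_grp_def)
  then have "reduce_word v \<in> carrier (free_grp S)"
    using set_reduce_word[of v] by (auto simp: free_grp_def)
  ultimately show "\<exists>v \<in> carrier (free_grp S). v \<otimes>\<^bsub>free_grp S\<^esub> u = \<one>\<^bsub>free_grp S\<^esub>"
    by (intro bexI[of _ "reduce_word v"]) (auto simp: free_grp_def reduce_word_append_left)
qed

lemma free_gen_closed: "x \<in> S \<Longrightarrow> free_gen x \<in> carrier (free_grp S)"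
  by (simp add: free_grp_def free_gen_def)

lemma free_gen_inverse:
  assumes "x \<in> S"
  shows "inv\<^bsub>free_grp S\<^esub> (free_gen x) = [(x, False)]"
proof (rule group.inv_equality[OF group_free_grp])
  show "[(x, False)] \<otimes>\<^bsub>free_grp S\<^esub> free_gen x = \<one>\<^bsub>free_grp S\<^esub>"
    by (simp add: free_grp_def free_gen_def reduce_word_def)
qed (use assms in \<open>auto simp: free_grp_def free_gen_def\<close>)

section \<open>The universal property of the free group\<close>

definition free_lift :: "('g, 'm) monoid_scheme \<Rightarrow> ('b \<Rightarrow> 'g) \<Rightarrow> ('b \<times> bool) list \<Rightarrow> 'g" where
  "free_lift G g w = foldr (\<lambda>(x, e) acc. (if e then g x else inv\<^bsub>G\<^esub> g x) \<otimes>\<^bsub>G\<^esub> acc) w \<one>\<^bsub>G\<^esub>"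

lemma mult_epi_free_lift: "mult_epi G = free_lift G (\<lambda>x. x)"
  by (simp add: fun_eq_iff mult_epi_def free_lift_def)

lemma free_lift_Nil [simp]: "free_lift G g [] = \<one>\<^bsub>G\<^esub>"
  by (simp add: free_lift_def)

lemma free_lift_Cons [simp]:
  "free_lift G g (a # w) = (if snd a then g (fst a) else inv\<^bsub>G\<^esub> g (fst a)) \<otimes>\<^bsub>G\<^esub> free_lift G g w"
  by (simp add: free_lift_def case_prod_unfold)

context group
begin

lemma free_lift_closed:
  assumes "g \<in> S \<rightarrow> carrier G" "fst ` set w \<subseteq> S"
  shows "free_lift G g w \<in> carrier G"
  using assms by (induction w) (auto simp: Pi_iff)

lemma free_lift_append:
  assumes "g \<in> S \<rightarrow> carrier G" "fst ` set v \<subseteq> S" "fst ` set w \<subseteq> S"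
  shows "free_lift G g (v @ w) = free_lift G g v \<otimes> free_lift G g w"
  using assms
proof (induction v)
  case (Cons a v)
  then show ?case
    using free_lift_closed[OF Cons.prems(1), of v] free_lift_closed[OF Cons.prems(1), of w]
    by (auto simp: Pi_iff m_assoc)
next
  case Nil
  then show ?case
    using free_lift_closed[OF Nil(1), of w] by simp
qed

lemma free_lift_push_letter:
  assumes "g \<in> S \<rightarrow> carrier G" "fst ` set w \<subseteq> S" "fst a \<in> S"
  shows "free_lift G g (push_letter a w) = free_lift G g (a # w)"
proof (cases w)
  case (Cons b r)
  have "g (fst b) \<in> carrier G" "free_lift G g r \<in> carrier G"
    using assms Cons free_lift_closed[OF assms(1), of r] by auto
  then show ?thesis
    using Cons by (auto simp: push_letter_def m_assoc[symmetric])
qed (simp add: push_letter_def)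

lemma free_lift_reduce_word:
  assumes "g \<in> S \<rightarrow> carrier G" "fst ` set w \<subseteq> S"
  shows "free_lift G g (reduce_word w) = free_lift G g w"
  using assms(2)
proof (induction w)
  case (Cons a w)
  have "fst ` set (reduce_word w) \<subseteq> S"
    using Cons set_reduce_word[of w] by auto
  then show ?case
    using free_lift_push_letter[OF assms(1), of "reduce_word w" a] Cons by (simp add: reduce_word_eq)
qed (simp add: reduce_word_eq)

lemma free_lift_hom:
  assumes "g \<in> S \<rightarrow> carrier G"
  shows "free_lift G g \<in> hom (free_grp S) G"
proof (rule homI)
  fix v w assume "v \<in> carrier (free_grp S)" "w \<in> carrier (free_grp S)"
  then have "fst ` set v \<subseteq> S" "fst ` set w \<subseteq> S"
    by (auto simp: free_grp_def)
  then show "free_lift G g (v \<otimes>\<^bsub>free_grp S\<^esub> w) = free_lift G g v \<otimes> free_lift G g w"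
    using free_lift_reduce_word[OF assms, of "v @ w"] free_lift_append[OF assms, of v w]
    by (auto simp: free_grp_def)
qed (use free_lift_closed[OF assms] in \<open>auto simp: free_grp_def\<close>)

lemma free_lift_gen:
  assumes "g x \<in> carrier G"
  shows "free_lift G g (free_gen x) = g x"
  using assms by (simp add: free_gen_def)

text \<open>Used twice: to see that \<Phi> after \<open>h\<close> is the identity, and for
  naturality.\<close>

lemma hom_free_grp_unique:
  assumes "\<phi> \<in> hom (free_grp S) G" "\<psi> \<in> hom (free_grp S) G"
    and "\<And>x. x \<in> S \<Longrightarrow> \<phi> (free_gen x) = \<psi> (free_gen x)"
    and "w \<in> carrier (free_grp S)"
  shows "\<phi> w = \<psi> w"
  using assms(4)
proof (induction w)
  case Nil
  have "\<phi> \<one>\<^bsub>free_grp S\<^esub> = \<psi> \<one>\<^bsub>free_grp S\<^esub>"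
    using hom_one[OF assms(1) group_free_grp is_group] hom_one[OF assms(2) group_free_grp is_group]
    by simp
  then show ?case by (simp add: free_grp_def)
next
  case (Cons a w)
  interpret F: group "free_grp S" by (rule group_free_grp)
  have x: "fst a \<in> S" and w: "w \<in> carrier (free_grp S)"
    using Cons.prems reduced_word_tl[of a w] by (auto simp: free_grp_def)
  have a: "[a] \<in> carrier (free_grp S)"
    using x by (simp add: free_grp_def)
  have "a # w = [a] \<otimes>\<^bsub>free_grp S\<^esub> w"
    using Cons.prems reduce_word_reduced[of "a # w"] by (simp add: free_grp_def)
  moreover have "\<phi> [a] = \<psi> [a]"
  proof (cases "snd a")
    case True
    then have "[a] = free_gen (fst a)" by (simp add: free_gen_def prod_eq_iff)
    then show ?thesis using assms(3) x by simp
  next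
    case False
    then have "[a] = inv\<^bsub>free_grp S\<^esub> free_gen (fst a)"
      using free_gen_inverse[OF x] by (simp add: prod_eq_iff)
    moreover have "\<theta> (inv\<^bsub>free_grp S\<^esub> free_gen (fst a)) = inv \<theta> (free_gen (fst a))"
      if "\<theta> \<in> hom (free_grp S) G" for \<theta>
      using that group_hom.hom_inv[of "free_grp S" G \<theta>] free_gen_closed[OF x]
        is_group F.is_group
      by (simp add: group_hom_def group_hom_axioms_def)
    ultimately show ?thesis
      using assms x by metis
  qed
  ultimately show ?case
    using Cons.IH[OF w] hom_mult[OF assms(1) a w] hom_mult[OF assms(2) a w] by simp
qed

end

text \<open>Makes \<open>free_map\<close> an instance of the universal property, so that
  multiplicativity is inherited from \<open>free_lift_hom\<close>.\<close>

lemma free_map_eq_free_lift: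
  assumes "g \<in> S \<rightarrow> T" "w \<in> carrier (free_grp S)"
  shows "free_map g w = free_lift (free_grp T) (free_gen \<circ> g) w"
proof -
  have "fst ` set w \<subseteq> S" using assms by (simp add: free_grp_def)
  then show ?thesis
  proof (induction w)
    case (Cons a w)
    then have "g (fst a) \<in> T" using assms by auto
    then have "free_lift (free_grp T) (free_gen \<circ> g) (a # w) =
        [(g (fst a), snd a)] \<otimes>\<^bsub>free_grp T\<^esub> free_map g w"
      using Cons free_gen_inverse[of "g (fst a)" T] by (auto simp: free_gen_def comp_def)
    also have "\<dots> = free_map g (a # w)"
      using reduce_word_append_right[of "[(g (fst a), snd a)]"]
      by (simp add: free_map_def case_prod_unfold free_grp_def)
    finally show ?case ..
  qed (simp add: free_map_def free_grp_def reduce_word_def)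
qed

lemma free_map_hom:
  assumes "g \<in> S \<rightarrow> T"
  shows "free_map g \<in> hom (free_grp S) (free_grp T)"
proof -
  interpret T: group "free_grp T" by (rule group_free_grp)
  interpret S: group "free_grp S" by (rule group_free_grp)
  have "free_lift (free_grp T) (free_gen \<circ> g) \<in> hom (free_grp S) (free_grp T)"
    by (rule T.free_lift_hom) (use assms in \<open>auto intro!: free_gen_closed\<close>)
  then show ?thesis
    using free_map_eq_free_lift[OF assms] by (auto simp: hom_def Pi_iff)
qed

subsection \<open>Topological groups\<close>

lemma openin_quotient_top:
  "openin (quotient_top X f) U \<longleftrightarrow> U \<subseteq> f ` topspace X \<and> openin X {x \<in> topspace X. f x \<in> U}"
proof -
  have "istopology (\<lambda>U. U \<subseteq> f ` topspace X \<and> openin X {x \<in> topspace X. f x \<in> U})"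
    unfolding istopology_def
  proof (intro conjI allI impI; (elim conjE)?)
    fix S T assume "openin X {x \<in> topspace X. f x \<in> S}" "openin X {x \<in> topspace X. f x \<in> T}"
    then show "openin X {x \<in> topspace X. f x \<in> S \<inter> T}"
      using openin_Int[of X "{x \<in> topspace X. f x \<in> S}" "{x \<in> topspace X. f x \<in> T}"]
      by (simp add: Collect_conj_eq Int_assoc Int_left_commute)
  next
    fix \<K> assume K: "\<forall>K\<in>\<K>. K \<subseteq> f ` topspace X \<and> openin X {x \<in> topspace X. f x \<in> K}"
    have "{x \<in> topspace X. f x \<in> \<Union>\<K>} = (\<Union>K\<in>\<K>. {x \<in> topspace X. f x \<in> K})"
      by auto
    then show "openin X {x \<in> topspace X. f x \<in> \<Union>\<K>}"
      using K by auto
  qed blast+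
  then show ?thesis
    by (simp add: quotient_top_def topology_inverse')
qed

lemma topspace_quotient_top [simp]: "topspace (quotient_top X f) = f ` topspace X"
proof
  show "topspace (quotient_top X f) \<subseteq> f ` topspace X"
    using openin_quotient_top openin_topspace by metis
  have "{x \<in> topspace X. f x \<in> f ` topspace X} = topspace X"
    by auto
  then show "f ` topspace X \<subseteq> topspace (quotient_top X f)"
    by (intro openin_subset) (simp add: openin_quotient_top)
qed

lemma quotient_map_quotient_top: "quotient_map X (quotient_top X f) f"
  by (auto simp: quotient_map_def openin_quotient_top)

lemma group_topology_topspace: "group_topology G T \<Longrightarrow> topspace T = carrier G"
  by (simp add: group_topology_def)

text \<open>Continuity of transport is verified at one loop at a time, by multiplying finitely many
  limits.\<close>

lemma limitin_group_mult:
  assumes "group_topology G T" "limitin T f a F" "limitin T g b F"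
  shows "limitin T (\<lambda>x. f x \<otimes>\<^bsub>G\<^esub> g x) (a \<otimes>\<^bsub>G\<^esub> b) F"
proof -
  have "limitin (prod_topology T T) (\<lambda>x. (f x, g x)) (a, b) F"
    using assms by (simp add: limitin_pairwise comp_def)
  from continuous_map_limit[OF _ this, of T "\<lambda>(a, b). a \<otimes>\<^bsub>G\<^esub> b"] show ?thesis
    using assms(1) by (simp add: group_topology_def comp_def)
qed

lemma limitin_group_inv:
  assumes "group_topology G T" "limitin T f a F"
  shows "limitin T (\<lambda>x. inv\<^bsub>G\<^esub> f x) (inv\<^bsub>G\<^esub> a) F"
  using continuous_map_limit[of T T "\<lambda>a. inv\<^bsub>G\<^esub> a" f a F] assms
  by (simp add: group_topology_def comp_def)

text \<open>The initial topology for \<phi>: the operations of \<open>F\<close> become continuous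
  because \<phi> carries them to those of \<open>H\<close>.\<close>

lemma group_topology_pullback:
  assumes "group F" "group H" "\<phi> \<in> hom F H" "group_topology H S"
  shows "group_topology F (pullback_topology (carrier F) \<phi> S)"
    (is "group_topology F ?T")
proof -
  interpret group_hom F H \<phi>
    using assms by (simp add: group_hom_def group_hom_axioms_def)
  note H = assms(4)[unfolded group_topology_def]
  have top: "topspace ?T = carrier F"
    using H by (auto simp: topspace_pullback_topology)
  have \<phi>: "continuous_map ?T S \<phi>"
    using continuous_map_pullback[OF continuous_map_id[of S], of "carrier F" \<phi>] by simp
  have "continuous_map (prod_topology ?T ?T) S (\<lambda>p. \<phi> (fst p) \<otimes>\<^bsub>H\<^esub> \<phi> (snd p))"
  proof -
    have "continuous_map (prod_topology ?T ?T) (prod_topology S S) (\<lambda>p. (\<phi> (fst p), \<phi> (snd p)))"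
      using \<phi> by (auto simp: continuous_map_pairwise comp_def
          intro: continuous_map_compose[OF continuous_map_fst, unfolded comp_def]
                 continuous_map_compose[OF continuous_map_snd, unfolded comp_def])
    from continuous_map_compose[OF this conjunct1[OF conjunct2[OF H]]]
    show ?thesis by (simp add: comp_def)
  qed
  then have "continuous_map (prod_topology ?T ?T) S (\<phi> \<circ> (\<lambda>(a, b). a \<otimes>\<^bsub>F\<^esub> b))"
    by (rule continuous_map_eq) (auto simp: top)
  then have "continuous_map (prod_topology ?T ?T) ?T (\<lambda>(a, b). a \<otimes>\<^bsub>F\<^esub> b)"
    by (rule continuous_map_pullback') (auto simp: top)
  moreover have "continuous_map ?T ?T (\<lambda>a. inv\<^bsub>F\<^esub> a)"
  proof (rule continuous_map_pullback')
    have "continuous_map ?T S (\<lambda>a. inv\<^bsub>H\<^esub> \<phi> a)"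
      using continuous_map_compose[OF \<phi> conjunct2[OF conjunct2[OF H]]] by (simp add: comp_def)
    then show "continuous_map ?T S (\<phi> \<circ> (\<lambda>a. inv\<^bsub>F\<^esub> a))"
      by (rule continuous_map_eq) (auto simp: top)
  qed (auto simp: top)
  ultimately show ?thesis
    using top by (simp add: group_topology_def)
qed

section \<open>The Markov topology\<close>

lemma markov_finer:
  assumes "group_topology (free_grp (topspace Y)) T" "continuous_map Y T free_gen" "openin T U"
  shows "openin (markov_top Y) U"
  unfolding markov_top_def by (rule topology_generated_by_Basis) (use assms in auto)

text \<open>Enters every continuous map from \<open>Y\<close> to a topological group into the
  supremum defining \<open>markov_top\<close>. Topologies with these two properties are called
  admissible below.\<close>

lemma markov_admissible:
  assumes "group H" "group_topology H S" "\<phi> \<in> hom (free_grp (topspace Y)) H"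
    and "continuous_map Y S (\<phi> \<circ> free_gen)"
  shows "group_topology (free_grp (topspace Y))
           (pullback_topology (carrier (free_grp (topspace Y))) \<phi> S)"
    and "continuous_map Y (pullback_topology (carrier (free_grp (topspace Y))) \<phi> S) free_gen"
  using group_topology_pullback[OF group_free_grp assms(1,3,2)]
    continuous_map_pullback'[OF assms(4), of "carrier (free_grp (topspace Y))"]
  by (auto intro: free_gen_closed)

lemma topspace_markov: "topspace (markov_top Y) = carrier (free_grp (topspace Y))"
proof
  let ?F = "free_grp (topspace Y)"
  show "topspace (markov_top Y) \<subseteq> carrier ?F"
    by (force simp: markov_top_def group_topology_def dest: openin_subset)
  \<comment> \<open>\<open>markov_top\<close> covers the carrier only if some topology is
    admissible. Pulling back from the trivial group supplies the indiscrete one.\<close>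
  define H :: "('b \<times> bool) list monoid" where "H = free_grp {}"
  have carr: "carrier H = {\<one>\<^bsub>H\<^esub>}"
    by (auto simp: H_def free_grp_def)
  interpret H: group H
    unfolding H_def by (rule group_free_grp)
  have H1: "group_topology H (discrete_topology {\<one>\<^bsub>H\<^esub>})"
    by (auto simp: group_topology_def carr prod_topology_discrete_topology[symmetric])
  have hom: "(\<lambda>_. \<one>\<^bsub>H\<^esub>) \<in> hom ?F H"
    by (auto simp: hom_def)
  have "continuous_map Y (discrete_topology {\<one>\<^bsub>H\<^esub>}) ((\<lambda>_. \<one>\<^bsub>H\<^esub>) \<circ> free_gen)"
    by (simp add: comp_def)
  note T = markov_admissible[OF H.is_group H1 hom this]
  show "carrier ?F \<subseteq> topspace (markov_top Y)"
    using markov_finer[OF T openin_topspace] group_topology_topspace[OF T(1)] openin_subset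
    by metis
qed

text \<open>The topology pulled back from \<open>S\<close> along \<phi> is admissible, hence coarser
  than the supremum, and it already makes \<phi> continuous.\<close>

lemma markov_universal:
  assumes "group H" "group_topology H S" "\<phi> \<in> hom (free_grp (topspace Y)) H"
    and "continuous_map Y S (\<phi> \<circ> free_gen)"
  shows "continuous_map (markov_top Y) S \<phi>"
proof -
  let ?F = "free_grp (topspace Y)"
  note T = markov_admissible[OF assms]
  have "openin (markov_top Y) {x \<in> topspace (markov_top Y). \<phi> x \<in> U}" if "openin S U" for U
  proof (rule markov_finer[OF T])
    show "openin (pullback_topology (carrier ?F) \<phi> S) {x \<in> topspace (markov_top Y). \<phi> x \<in> U}"
      unfolding openin_pullback_topology topspace_markov using that by auto
  qed
  then show ?thesis
    using hom_in_carrier[OF assms(3)] group_topology_topspace[OF assms(2)]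
    by (auto simp: continuous_map_def topspace_markov)
qed

lemma continuous_map_into_markov:
  assumes "f \<in> topspace Z \<rightarrow> carrier (free_grp (topspace Y))"
    and "\<And>T. group_topology (free_grp (topspace Y)) T \<Longrightarrow> continuous_map Y T free_gen \<Longrightarrow>
               continuous_map Z T f"
  shows "continuous_map Z (markov_top Y) f"
  unfolding markov_top_def
proof (rule continuous_on_generated_topo)
  fix U assume "U \<in> \<Union> {{U. openin T U} |T. group_topology (free_grp (topspace Y)) T \<and>
                               continuous_map Y T free_gen}"
  then obtain T where "group_topology (free_grp (topspace Y)) T" "continuous_map Y T free_gen"
      "openin T U"
    by auto
  then show "openin Z (f -` U \<inter> topspace Z)"
    using assms(2) by (auto simp: continuous_map_alt)
next
  show "f ` topspace Z \<subseteq> \<Union> (\<Union> {{U. openin T U} |T. group_topology (free_grp (topspace Y)) T \<and>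
                               continuous_map Y T free_gen})"
    using assms(1) topspace_markov[of Y, unfolded markov_top_def topology_generated_by_topspace]
    by blast
qed

lemma continuous_map_free_gen: "continuous_map Y (markov_top Y) free_gen"
  by (rule continuous_map_into_markov) (auto intro: free_gen_closed)

text \<open>A supremum of group topologies is one: continuity into it is tested on each admissible
  \<open>T\<close>, and there the operations factor through the continuous identity from
  \<open>markov_top Y\<close> to \<open>T\<close>.\<close>

lemma group_topology_markov: "group_topology (free_grp (topspace Y)) (markov_top Y)"
proof -
  let ?F = "free_grp (topspace Y)" and ?M = "markov_top Y"
  interpret F: group ?F by (rule group_free_grp)
  have "continuous_map (prod_topology ?M ?M) ?M (\<lambda>(a, b). a \<otimes>\<^bsub>?F\<^esub> b)"
  proof (rule continuous_map_into_markov)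
    fix T assume T: "group_topology ?F T" "continuous_map Y T free_gen"
    have id: "continuous_map ?M T (\<lambda>x. x)"
      by (rule markov_universal[OF F.is_group T(1)]) (use T(2) in \<open>auto simp: hom_def comp_def\<close>)
    have "continuous_map (prod_topology ?M ?M) (prod_topology T T) (\<lambda>p. (fst p, snd p))"
      unfolding continuous_map_pairwise comp_def
      using continuous_map_compose[OF continuous_map_fst id, unfolded comp_def]
        continuous_map_compose[OF continuous_map_snd id, unfolded comp_def] by auto
    from continuous_map_compose[OF this, of T "\<lambda>(a, b). a \<otimes>\<^bsub>?F\<^esub> b"]
    show "continuous_map (prod_topology ?M ?M) T (\<lambda>(a, b). a \<otimes>\<^bsub>?F\<^esub> b)"
      using T(1) by (simp add: group_topology_def comp_def)
  qed (auto simp: topspace_markov)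
  moreover have "continuous_map ?M ?M (\<lambda>a. inv\<^bsub>?F\<^esub> a)"
  proof (rule continuous_map_into_markov)
    fix T assume T: "group_topology ?F T" "continuous_map Y T free_gen"
    have id: "continuous_map ?M T (\<lambda>x. x)"
      by (rule markov_universal[OF F.is_group T(1)]) (use T(2) in \<open>auto simp: hom_def comp_def\<close>)
    from continuous_map_compose[OF this, of T "\<lambda>a. inv\<^bsub>?F\<^esub> a"]
    show "continuous_map ?M T (\<lambda>a. inv\<^bsub>?F\<^esub> a)"
      using T(1) by (simp add: group_topology_def comp_def)
  qed (auto simp: topspace_markov)
  ultimately show ?thesis
    by (simp add: group_topology_def topspace_markov)
qed

text \<open>Openness survives products, while being a quotient map in general does not. This is why
  the next lemma passes through open maps.\<close>

lemma open_map_prod: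
  assumes "open_map X X' f" "open_map Y Y' g"
  shows "open_map (prod_topology X Y) (prod_topology X' Y') (\<lambda>(x, y). (f x, g y))"
  unfolding open_map_def openin_prod_topology_alt
proof (intro allI impI)
  fix W x' y'
  assume W: "\<forall>x y. (x, y) \<in> W \<longrightarrow> (\<exists>U V. openin X U \<and> openin Y V \<and> x \<in> U \<and> y \<in> V \<and> U \<times> V \<subseteq> W)"
    and "(x', y') \<in> (\<lambda>(x, y). (f x, g y)) ` W"
  then obtain x y where xy: "(x, y) \<in> W" "x' = f x" "y' = g y"
    by auto
  with W obtain U V where UV: "openin X U" "openin Y V" "x \<in> U" "y \<in> V" "U \<times> V \<subseteq> W"
    by metis
  have "f ` U \<times> g ` V \<subseteq> (\<lambda>(x, y). (f x, g y)) ` (U \<times> V)"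
    by auto
  then have "f ` U \<times> g ` V \<subseteq> (\<lambda>(x, y). (f x, g y)) ` W"
    using UV(5) by (meson image_mono order_trans)
  moreover have "openin X' (f ` U)" "openin Y' (g ` V)" "x' \<in> f ` U" "y' \<in> g ` V"
    using assms xy UV by (auto simp: open_map_def)
  ultimately show "\<exists>U V. openin X' U \<and> openin Y' V \<and> x' \<in> U \<and> y' \<in> V \<and>
      U \<times> V \<subseteq> (\<lambda>(x, y). (f x, g y)) ` W"
    by meson
qed

text \<open>A homomorphism from a topological group onto a quotient is open, because the saturation of
  an open set is a union of translates; so its square is again a quotient map.\<close>
lemma group_topology_quotient_top:
  assumes "group F" "group H" "group_topology F M" "m \<in> hom F H" "m ` carrier F = carrier H"
  shows "group_topology H (quotient_top M m)" (is "group_topology H ?Q")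
proof -
  interpret group_hom F H m
    using assms by (simp add: group_hom_def group_hom_axioms_def)
  note M = assms(3)[unfolded group_topology_def]
  have topQ: "topspace ?Q = carrier H"
    using M assms(5) by simp
  have q: "quotient_map M ?Q m"
    by (rule quotient_map_quotient_top)
  then have mQ: "continuous_map M ?Q m"
    by (rule quotient_imp_continuous_map)
  have translate: "openin M {x \<in> carrier F. x \<otimes>\<^bsub>F\<^esub> k \<in> U}" if "k \<in> carrier F" "openin M U" for k U
  proof -
    have "continuous_map M (prod_topology M M) (\<lambda>x. (x, k))"
      using that M by (simp add: continuous_map_pairwise comp_def)
    from continuous_map_compose[OF this conjunct1[OF conjunct2[OF M]]]
    have "continuous_map M M (\<lambda>x. x \<otimes>\<^bsub>F\<^esub> k)"
      by (simp add: comp_def)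
    from openin_continuous_map_preimage[OF this that(2)] show ?thesis
      using M by simp
  qed
  have "open_map M ?Q m"
    unfolding open_map_def openin_quotient_top
  proof (intro allI impI conjI)
    fix U assume U: "openin M U"
    then have UF: "U \<subseteq> carrier F"
      using M openin_subset by metis
    then show "m ` U \<subseteq> m ` topspace M"
      using M by auto
    have "{x \<in> topspace M. m x \<in> m ` U} =
        (\<Union>k \<in> {k \<in> carrier F. m k = \<one>\<^bsub>H\<^esub>}. {x \<in> carrier F. x \<otimes>\<^bsub>F\<^esub> k \<in> U})"
    proof (intro equalityI subsetI)
      fix x assume "x \<in> {x \<in> topspace M. m x \<in> m ` U}"
      then obtain u where u: "u \<in> U" "m x = m u" "x \<in> carrier F"
        using M by auto
      then have "m (inv\<^bsub>F\<^esub> x \<otimes>\<^bsub>F\<^esub> u) = \<one>\<^bsub>H\<^esub>" "x \<otimes>\<^bsub>F\<^esub> (inv\<^bsub>F\<^esub> x \<otimes>\<^bsub>F\<^esub> u) = u"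
        using UF by (auto simp: G.m_assoc[symmetric] subset_iff)
      then show "x \<in> (\<Union>k \<in> {k \<in> carrier F. m k = \<one>\<^bsub>H\<^esub>}. {x \<in> carrier F. x \<otimes>\<^bsub>F\<^esub> k \<in> U})"
        using u UF by (intro UN_I[of "inv\<^bsub>F\<^esub> x \<otimes>\<^bsub>F\<^esub> u"]) auto
    next
      fix x assume "x \<in> (\<Union>k \<in> {k \<in> carrier F. m k = \<one>\<^bsub>H\<^esub>}. {x \<in> carrier F. x \<otimes>\<^bsub>F\<^esub> k \<in> U})"
      then obtain k where k: "k \<in> carrier F" "m k = \<one>\<^bsub>H\<^esub>" "x \<in> carrier F" "x \<otimes>\<^bsub>F\<^esub> k \<in> U"
        by auto
      then have "m x = m (x \<otimes>\<^bsub>F\<^esub> k)"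
        by simp
      then have "m x \<in> m ` U"
        using k(4) by (rule image_eqI)
      then show "x \<in> {x \<in> topspace M. m x \<in> m ` U}"
        using M k(3) by simp
    qed
    then show "openin M {x \<in> topspace M. m x \<in> m ` U}"
      using translate[OF _ U] by auto
  qed
  then have om: "open_map (prod_topology M M) (prod_topology ?Q ?Q) (\<lambda>(x, y). (m x, m y))"
    by (intro open_map_prod)
  have "quotient_map (prod_topology M M) (prod_topology ?Q ?Q) (\<lambda>(x, y). (m x, m y))"
  proof (rule continuous_open_imp_quotient_map[OF _ om])
    show "continuous_map (prod_topology M M) (prod_topology ?Q ?Q) (\<lambda>(x, y). (m x, m y))"
      using mQ by (auto simp: continuous_map_prod_top)
    show "(\<lambda>(x, y). (m x, m y)) ` topspace (prod_topology M M) = topspace (prod_topology ?Q ?Q)"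
      by force
  qed
  moreover have "continuous_map (prod_topology M M) ?Q
      ((\<lambda>(a, b). a \<otimes>\<^bsub>H\<^esub> b) \<circ> (\<lambda>(x, y). (m x, m y)))"
  proof (rule continuous_map_eq)
    show "continuous_map (prod_topology M M) ?Q (m \<circ> (\<lambda>(a, b). a \<otimes>\<^bsub>F\<^esub> b))"
      using continuous_map_compose[OF conjunct1[OF conjunct2[OF M]] mQ] .
  qed (use M in auto)
  ultimately have "continuous_map (prod_topology ?Q ?Q) ?Q (\<lambda>(a, b). a \<otimes>\<^bsub>H\<^esub> b)"
    by (rule continuous_compose_quotient_map)
  moreover have "continuous_map M ?Q ((\<lambda>a. inv\<^bsub>H\<^esub> a) \<circ> m)"
  proof (rule continuous_map_eq)
    show "continuous_map M ?Q (m \<circ> (\<lambda>a. inv\<^bsub>F\<^esub> a))"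
      using continuous_map_compose[OF conjunct2[OF conjunct2[OF M]] mQ] .
  qed (use M in auto)
  then have "continuous_map ?Q ?Q (\<lambda>a. inv\<^bsub>H\<^esub> a)"
    by (rule continuous_compose_quotient_map[OF q])
  ultimately show ?thesis
    using topQ by (simp add: group_topology_def)
qed

section \<open>The functor tau\<close>

lemma mult_epi_hom: "group G \<Longrightarrow> mult_epi G \<in> hom (free_grp (carrier G)) G"
  by (simp add: mult_epi_free_lift group.free_lift_hom)

lemma mult_epi_gen: "group G \<Longrightarrow> x \<in> carrier G \<Longrightarrow> mult_epi G (free_gen x) = x"
  by (simp add: mult_epi_free_lift group.free_lift_gen)

lemma mult_epi_surj:
  assumes "group G"
  shows "mult_epi G ` carrier (free_grp (carrier G)) = carrier G"
proof
  show "mult_epi G ` carrier (free_grp (carrier G)) \<subseteq> carrier G"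
    using mult_epi_hom[OF assms] by (auto simp: hom_def)
  show "carrier G \<subseteq> mult_epi G ` carrier (free_grp (carrier G))"
    using mult_epi_gen[OF assms] free_gen_closed by (metis image_eqI subsetI)
qed

lemma topspace_tau:
  assumes "group G" "topspace T = carrier G"
  shows "topspace (tau_top G T) = carrier G"
  using mult_epi_surj[OF assms(1)] assms(2) by (simp add: tau_top_def topspace_markov)

lemma group_topology_tau:
  assumes "group G" "topspace T = carrier G"
  shows "group_topology G (tau_top G T)"
  unfolding tau_top_def
  using group_topology_quotient_top[OF group_free_grp assms(1) group_topology_markov, of "mult_epi G" T]
    mult_epi_hom[OF assms(1)] mult_epi_surj[OF assms(1)] assms(2)
  by simp

text \<open>The identity is the inclusion of generators followed by the multiplication epimorphism,
  and both are continuous.\<close>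

lemma tau_coarser:
  assumes "group G" "topspace T = carrier G"
  shows "continuous_map T (tau_top G T) (\<lambda>x. x)"
proof (rule continuous_map_eq)
  show "continuous_map T (tau_top G T) (mult_epi G \<circ> free_gen)"
    unfolding tau_top_def
    by (rule continuous_map_compose[OF continuous_map_free_gen])
      (rule quotient_imp_continuous_map[OF quotient_map_quotient_top])
qed (use mult_epi_gen assms in auto)

text \<open>On generators, \<phi> after \<open>mult_epi G\<close> is just \<phi>, so the Markov
  property makes this composite continuous; it then descends along the quotient map.\<close>

lemma tau_universal:
  assumes "group G" "topspace T = carrier G" "group H" "group_topology H S" "\<phi> \<in> hom G H"
    and "continuous_map T S \<phi>"
  shows "continuous_map (tau_top G T) S \<phi>"
  unfolding tau_top_def
proof (rule continuous_compose_quotient_map[OF quotient_map_quotient_top])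
  show "continuous_map (markov_top T) S (\<phi> \<circ> mult_epi G)"
  proof (rule markov_universal[OF assms(3,4)])
    show "\<phi> \<circ> mult_epi G \<in> hom (free_grp (topspace T)) H"
      using hom_compose[OF mult_epi_hom assms(5)] assms by simp
    show "continuous_map T S (\<phi> \<circ> mult_epi G \<circ> free_gen)"
      by (rule continuous_map_eq[OF assms(6)]) (simp add: mult_epi_gen assms)
  qed
qed

subsection \<open>Path homotopy\<close>

abbreviation unit_itv :: "real topology" where
  "unit_itv \<equiv> top_of_set {0..1}"

lemma prod_unit_itv: "prod_topology unit_itv unit_itv = top_of_set ({0..1} \<times> {0..1})"
  by (simp add: subtopology_Times euclidean_product_topology)

text \<open>The fixed ends are those of \<open>p\<close>, so that open paths such as segments of
  loops are covered too; for loops this is \<open>loop_homotopic\<close>.\<close>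

definition path_hom :: "'a topology \<Rightarrow> (real \<Rightarrow> 'a) \<Rightarrow> (real \<Rightarrow> 'a) \<Rightarrow> bool" where
  "path_hom Y p q \<longleftrightarrow> homotopic_with (\<lambda>h. h 0 = p 0 \<and> h 1 = p 1) unit_itv Y p q"

text \<open>Restricted, like \<open>loop_join\<close>, because \<open>loops\<close> admits only
  extensional functions.\<close>

definition rev_path :: "(real \<Rightarrow> 'a) \<Rightarrow> real \<Rightarrow> 'a" where
  "rev_path p = restrict (\<lambda>t. p (1 - t)) {0..1}"

definition const_path :: "'a \<Rightarrow> real \<Rightarrow> 'a" where
  "const_path y = restrict (\<lambda>t. y) {0..1}"

lemma pathin_cong: "pathin Y p \<Longrightarrow> (\<And>t. t \<in> {0..1} \<Longrightarrow> p t = q t) \<Longrightarrow> pathin Y q"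
  unfolding pathin_def by (erule continuous_map_eq) simp

lemma pathin_top_of_set: "pathin (top_of_set S) p \<longleftrightarrow> continuous_on {0..1} p \<and> p \<in> {0..1} \<rightarrow> S"
  by (simp add: pathin_def)

lemma loop_join_0 [simp]: "loop_join p q 0 = p 0"
  and loop_join_1 [simp]: "loop_join p q 1 = q 1"
  and rev_path_0 [simp]: "rev_path p 0 = p 1"
  and rev_path_1 [simp]: "rev_path p 1 = p 0"
  and const_path_01 [simp]: "const_path y 0 = y" "const_path y 1 = y"
  by (auto simp: loop_join_def rev_path_def const_path_def)

lemma pathin_const_path [simp]: "pathin Y (const_path y) \<longleftrightarrow> y \<in> topspace Y"
proof -
  have "pathin Y (const_path y) \<longleftrightarrow> pathin Y (\<lambda>t. y)"
    by (intro iffI) (erule pathin_cong, simp add: const_path_def)+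
  then show ?thesis by simp
qed

lemma pathin_compose_unit:
  assumes "pathin Y p" "continuous_on {0..1} \<phi>" "\<phi> \<in> {0..1} \<rightarrow> {0..1}"
  shows "pathin Y (\<lambda>t. p (\<phi> t))"
  using continuous_map_compose[of unit_itv unit_itv \<phi> Y p] assms
  by (simp add: pathin_def comp_def)

lemma pathin_rev_path: "pathin Y p \<Longrightarrow> pathin Y (rev_path p)"
  by (rule pathin_cong[OF pathin_compose_unit[of Y p "\<lambda>t. 1 - t"]])
    (auto simp: rev_path_def intro!: continuous_intros)

lemma pathin_loop_join:
  assumes "pathin Y p" "pathin Y q" "p 1 = q 0"
  shows "pathin Y (loop_join p q)"
proof -
  have "continuous_map unit_itv Y (\<lambda>t. if t \<le> 1/2 then p (2 * t) else q (2 * t - 1))"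
  proof (rule continuous_map_cases_le)
    have "continuous_map (subtopology unit_itv {t \<in> topspace unit_itv. t \<le> 1/2}) unit_itv (\<lambda>t. 2 * t)"
      by (auto simp: subtopology_subtopology intro!: continuous_intros)
    from continuous_map_compose[OF this assms(1)[unfolded pathin_def]]
    show "continuous_map (subtopology unit_itv {t \<in> topspace unit_itv. t \<le> 1/2}) Y (\<lambda>t. p (2 * t))"
      by (simp add: comp_def)
    have "continuous_map (subtopology unit_itv {t \<in> topspace unit_itv. 1/2 \<le> t}) unit_itv
        (\<lambda>t. 2 * t - 1)"
      by (auto simp: subtopology_subtopology intro!: continuous_intros)
    from continuous_map_compose[OF this assms(2)[unfolded pathin_def]]
    show "continuous_map (subtopology unit_itv {t \<in> topspace unit_itv. 1/2 \<le> t}) Y (\<lambda>t. q (2 * t - 1))"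
      by (simp add: comp_def)
    show "p (2 * t) = q (2 * t - 1)" if "t = 1/2" for t
      unfolding that using assms(3) by simp
  qed auto
  then show ?thesis
    unfolding pathin_def by (rule continuous_map_eq) (auto simp: loop_join_def)
qed

lemma path_homI:
  assumes "continuous_map (prod_topology unit_itv unit_itv) Y H"
    and "\<And>t. t \<in> {0..1} \<Longrightarrow> H (0, t) = p t" "\<And>t. t \<in> {0..1} \<Longrightarrow> H (1, t) = q t"
    and "\<And>s. s \<in> {0..1} \<Longrightarrow> H (s, 0) = p 0" "\<And>s. s \<in> {0..1} \<Longrightarrow> H (s, 1) = p 1"
  shows "path_hom Y p q"
  unfolding path_hom_def
  by (subst homotopic_with) (use assms in auto)

lemma path_homE:
  assumes "path_hom Y p q"
  obtains H where "continuous_map (prod_topology unit_itv unit_itv) Y H"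
    "\<And>t. t \<in> {0..1} \<Longrightarrow> H (0, t) = p t" "\<And>t. t \<in> {0..1} \<Longrightarrow> H (1, t) = q t"
    "\<And>s. s \<in> {0..1} \<Longrightarrow> H (s, 0) = p 0" "\<And>s. s \<in> {0..1} \<Longrightarrow> H (s, 1) = p 1"
  using assms unfolding path_hom_def homotopic_with_def by auto

lemma path_hom_refl: "pathin Y p \<Longrightarrow> path_hom Y p p"
  by (simp add: path_hom_def pathin_def)

lemma path_hom_ends: "path_hom Y p q \<Longrightarrow> q 0 = p 0 \<and> q 1 = p 1"
  using homotopic_with_imp_property unfolding path_hom_def by blast

lemma path_hom_sym: "path_hom Y p q \<Longrightarrow> path_hom Y q p"
  using path_hom_ends[of Y p q] by (simp add: path_hom_def homotopic_with_sym)

lemma path_hom_trans [trans]: "path_hom Y p q \<Longrightarrow> path_hom Y q r \<Longrightarrow> path_hom Y p r"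
  using path_hom_ends[of Y p q] by (auto simp: path_hom_def intro: homotopic_with_trans)

lemma path_hom_pathin: "path_hom Y p q \<Longrightarrow> pathin Y p" "path_hom Y p q \<Longrightarrow> pathin Y q"
  using homotopic_with_imp_continuous_maps unfolding path_hom_def pathin_def by blast+

lemma path_hom_eq: "pathin Y p \<Longrightarrow> (\<And>t. t \<in> {0..1} \<Longrightarrow> p t = q t) \<Longrightarrow> path_hom Y p q"
  unfolding path_hom_def by (rule homotopic_with_equal) (auto simp: pathin_def)

lemma path_hom_image:
  assumes "path_hom Y p q" "continuous_map Y Z f"
  shows "path_hom Z (f \<circ> p) (f \<circ> q)"
proof -
  obtain H where "continuous_map (prod_topology unit_itv unit_itv) Y H"
    "\<And>t. t \<in> {0..1} \<Longrightarrow> H (0, t) = p t" "\<And>t. t \<in> {0..1} \<Longrightarrow> H (1, t) = q t"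
    "\<And>s. s \<in> {0..1} \<Longrightarrow> H (s, 0) = p 0" "\<And>s. s \<in> {0..1} \<Longrightarrow> H (s, 1) = p 1"
    by (rule path_homE[OF assms(1)]) blast
  then show ?thesis
    using continuous_map_compose[OF _ assms(2)] by (intro path_homI[of Z "f \<circ> H"]) auto
qed

text \<open>The straight-line homotopy in \<open>C\<close>, followed by \<open>S\<close>. It yields
  the groupoid laws, with \<open>C\<close> the unit interval and two parametrisations of one path,
  and also \<open>path_hom_square\<close>, with \<open>C\<close> the unit square.\<close>

lemma path_hom_convex:
  fixes C :: "'v::real_normed_vector set"
  assumes S: "continuous_map (top_of_set C) Y S" and "convex C"
    and "pathin (top_of_set C) \<phi>" "pathin (top_of_set C) \<psi>" "\<phi> 0 = \<psi> 0" "\<phi> 1 = \<psi> 1"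
    and "\<And>t. t \<in> {0..1} \<Longrightarrow> p t = S (\<phi> t)" "\<And>t. t \<in> {0..1} \<Longrightarrow> q t = S (\<psi> t)"
  shows "path_hom Y p q"
proof (rule path_homI)
  let ?h = "\<lambda>z. (1 - fst z) *\<^sub>R \<phi> (snd z) + fst z *\<^sub>R \<psi> (snd z)"
  have "continuous_on ({0..1} \<times> {0..1}) ?h"
  proof -
    have "continuous_on ({0..1} \<times> {0..1}) (\<lambda>z. \<theta> (snd z))"
      if "pathin (top_of_set C) \<theta>" for \<theta> :: "real \<Rightarrow> 'v"
      by (rule continuous_on_compose2[of "{0..1}" \<theta>])
        (use that in \<open>auto simp: pathin_top_of_set intro!: continuous_intros\<close>)
    from this[OF assms(3)] this[OF assms(4)] show ?thesis
      by (intro continuous_intros)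
  qed
  moreover have "?h \<in> {0..1} \<times> {0..1} \<rightarrow> C"
  proof
    fix z :: "real \<times> real" assume z: "z \<in> {0..1} \<times> {0..1}"
    then have "\<phi> (snd z) \<in> C" "\<psi> (snd z) \<in> C"
      using assms(3,4) by (auto simp: pathin_top_of_set)
    then show "?h z \<in> C"
      using z by (intro convexD[OF assms(2)]) auto
  qed
  ultimately have "continuous_map (prod_topology unit_itv unit_itv) (top_of_set C) ?h"
    by (simp add: prod_unit_itv)
  from continuous_map_compose[OF this S]
  show "continuous_map (prod_topology unit_itv unit_itv) Y (\<lambda>z. S (?h z))"
    by (simp add: comp_def)
  show "S (?h (s, 0)) = p 0" "S (?h (s, 1)) = p 1" if "s \<in> {0..1}" for s
  proof -
    have "(1 - s) *\<^sub>R v + s *\<^sub>R v = v" for v :: 'v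
      by (simp flip: scaleR_add_left)
    then show "S (?h (s, 0)) = p 0" "S (?h (s, 1)) = p 1"
      using assms(5-8) by simp_all
  qed
  show "S (?h (0, t)) = p t" "S (?h (1, t)) = q t" if "t \<in> {0..1}" for t
    using assms(7,8)[OF that] by simp_all
qed

lemma path_hom_loop_join:
  assumes "path_hom Y p p'" "path_hom Y q q'" "p 1 = q 0"
  shows "path_hom Y (loop_join p q) (loop_join p' q')"
proof -
  obtain H where H: "continuous_map (prod_topology unit_itv unit_itv) Y H"
    "\<And>t. t \<in> {0..1} \<Longrightarrow> H (0, t) = p t" "\<And>t. t \<in> {0..1} \<Longrightarrow> H (1, t) = p' t"
    "\<And>s. s \<in> {0..1} \<Longrightarrow> H (s, 0) = p 0" "\<And>s. s \<in> {0..1} \<Longrightarrow> H (s, 1) = p 1"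
    by (rule path_homE[OF assms(1)]) blast
  obtain K where K: "continuous_map (prod_topology unit_itv unit_itv) Y K"
    "\<And>t. t \<in> {0..1} \<Longrightarrow> K (0, t) = q t" "\<And>t. t \<in> {0..1} \<Longrightarrow> K (1, t) = q' t"
    "\<And>s. s \<in> {0..1} \<Longrightarrow> K (s, 0) = q 0" "\<And>s. s \<in> {0..1} \<Longrightarrow> K (s, 1) = q 1"
    by (rule path_homE[OF assms(2)]) blast
  show ?thesis
  proof (rule path_homI)
    let ?Q = "prod_topology unit_itv unit_itv"
    show "continuous_map ?Q Y
        (\<lambda>z. if snd z \<le> 1/2 then H (fst z, 2 * snd z) else K (fst z, 2 * snd z - 1))"
    proof (rule continuous_map_cases_le)
      have "continuous_map (subtopology ?Q {z \<in> topspace ?Q. snd z \<le> 1/2}) ?Q (\<lambda>z. (fst z, 2 * snd z))"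
        by (auto simp: prod_unit_itv subtopology_subtopology intro!: continuous_intros)
      from continuous_map_compose[OF this H(1)]
      show "continuous_map (subtopology ?Q {z \<in> topspace ?Q. snd z \<le> 1/2}) Y (\<lambda>z. H (fst z, 2 * snd z))"
        by (simp add: comp_def)
      have "continuous_map (subtopology ?Q {z \<in> topspace ?Q. 1/2 \<le> snd z}) ?Q (\<lambda>z. (fst z, 2 * snd z - 1))"
        by (auto simp: prod_unit_itv subtopology_subtopology intro!: continuous_intros)
      from continuous_map_compose[OF this K(1)]
      show "continuous_map (subtopology ?Q {z \<in> topspace ?Q. 1/2 \<le> snd z}) Y (\<lambda>z. K (fst z, 2 * snd z - 1))"
        by (simp add: comp_def)
      show "continuous_map ?Q euclideanreal snd"
        by (auto simp: prod_unit_itv intro!: continuous_intros)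
      show "H (fst z, 2 * snd z) = K (fst z, 2 * snd z - 1)" if "z \<in> topspace ?Q" "snd z = 1/2" for z
        unfolding that(2) using that(1) assms(3) H(5)[of "fst z"] K(4)[of "fst z"] by auto
    qed auto
  qed (use H K in \<open>auto simp: loop_join_def\<close>)
qed

lemma path_hom_assoc:
  assumes "pathin Y p" "pathin Y q" "pathin Y r" "p 1 = q 0" "q 1 = r 0"
  shows "path_hom Y (loop_join (loop_join p q) r) (loop_join p (loop_join q r))"
proof (rule path_hom_convex)
  let ?S = "loop_join p (loop_join q r)"
  \<comment> \<open>Maps [0,1/4], [1/4,1/2], [1/2,1] affinely onto [0,1/2], [1/2,3/4], [3/4,1], the
    times allotted to \<open>p\<close>, \<open>q\<close>, \<open>r\<close> on the two sides.\<close>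
  let ?\<phi> = "loop_join (loop_join (\<lambda>t. t/2) (\<lambda>t. 1/2 + t/4)) (\<lambda>t::real. 3/4 + t/4)"
  show "continuous_map unit_itv Y ?S"
    using pathin_loop_join[OF assms(1) pathin_loop_join[OF assms(2,3,5)]] assms(4)
    by (simp add: pathin_def)
  show "pathin unit_itv ?\<phi>"
    by (intro pathin_loop_join) (auto simp: pathin_top_of_set intro!: continuous_intros)
  show "loop_join (loop_join p q) r t = ?S (?\<phi> t)" if "t \<in> {0..1}" for t
    using that assms(4,5)
    by (auto simp: loop_join_def algebra_simps add_divide_distrib diff_divide_distrib)
  show "pathin unit_itv (\<lambda>t::real. t)"
    by (auto simp: pathin_top_of_set)
qed auto

lemma path_hom_const_left:
  assumes "pathin Y p" "p 0 = y"
  shows "path_hom Y (loop_join (const_path y) p) p"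
proof (rule path_hom_convex)
  show "continuous_map unit_itv Y p"
    using assms by (simp add: pathin_def)
  show "pathin unit_itv (loop_join (\<lambda>t. 0) (\<lambda>t::real. t))"
    by (intro pathin_loop_join) (auto simp: pathin_top_of_set)
  show "pathin unit_itv (\<lambda>t::real. t)"
    by (auto simp: pathin_top_of_set)
qed (use assms in \<open>auto simp: loop_join_def const_path_def\<close>)

lemma path_hom_const_right:
  assumes "pathin Y p" "p 1 = y"
  shows "path_hom Y (loop_join p (const_path y)) p"
proof (rule path_hom_convex)
  show "continuous_map unit_itv Y p"
    using assms by (simp add: pathin_def)
  show "pathin unit_itv (loop_join (\<lambda>t::real. t) (\<lambda>t. 1))"
    by (intro pathin_loop_join) (auto simp: pathin_top_of_set)
  show "pathin unit_itv (\<lambda>t::real. t)"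
    by (auto simp: pathin_top_of_set)
qed (use assms in \<open>auto simp: loop_join_def const_path_def\<close>)

lemma path_hom_rev_right:
  assumes "pathin Y p" "p 0 = y"
  shows "path_hom Y (loop_join p (rev_path p)) (const_path y)"
proof (rule path_hom_convex)
  show "continuous_map unit_itv Y p"
    using assms by (simp add: pathin_def)
  show "pathin unit_itv (loop_join (\<lambda>t::real. t) (\<lambda>t. 1 - t))"
    by (intro pathin_loop_join) (auto simp: pathin_top_of_set intro!: continuous_intros)
  show "pathin unit_itv (\<lambda>t. 0)"
    by (simp add: pathin_top_of_set)
qed (use assms in \<open>auto simp: loop_join_def const_path_def rev_path_def\<close>)

lemma path_hom_rev_left:
  assumes "pathin Y p" "p 1 = y"
  shows "path_hom Y (loop_join (rev_path p) p) (const_path y)"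
proof (rule path_hom_convex)
  show "continuous_map unit_itv Y p"
    using assms by (simp add: pathin_def)
  show "pathin unit_itv (loop_join (\<lambda>t. 1 - t) (\<lambda>t::real. t))"
    by (intro pathin_loop_join) (auto simp: pathin_top_of_set intro!: continuous_intros)
  show "pathin unit_itv (\<lambda>t. 1)"
    by (simp add: pathin_top_of_set)
qed (use assms in \<open>auto simp: loop_join_def const_path_def rev_path_def\<close>)

text \<open>The two edge paths from (0,0) to (1,1) are homotopic in the convex square. Applied to a
  path contracted along spokes or rays, where one edge rests at the base point.\<close>

lemma path_hom_square:
  assumes "continuous_map (prod_topology unit_itv unit_itv) Y S"
  shows "path_hom Y (loop_join (\<lambda>t. S (0, t)) (\<lambda>r. S (r, 1))) (loop_join (\<lambda>r. S (r, 0)) (\<lambda>t. S (1, t)))"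
proof (rule path_hom_convex)
  let ?\<phi> = "loop_join (\<lambda>t. (0, t)) (\<lambda>t. (t, 1)) :: real \<Rightarrow> real \<times> real"
  let ?\<psi> = "loop_join (\<lambda>t. (t, 0)) (\<lambda>t. (1, t)) :: real \<Rightarrow> real \<times> real"
  show "continuous_map (top_of_set ({0..1} \<times> {0..1})) Y S"
    using assms by (simp add: prod_unit_itv)
  show "convex ({0..1::real} \<times> {0..1::real})"
    by (intro convex_Times) auto
  show "pathin (top_of_set ({0..1} \<times> {0..1})) ?\<phi>" "pathin (top_of_set ({0..1} \<times> {0..1})) ?\<psi>"
    by (intro pathin_loop_join; auto simp: pathin_top_of_set intro!: continuous_intros)+
qed (auto simp: loop_join_def)

definition sub_path :: "(real \<Rightarrow> 'a) \<Rightarrow> real \<Rightarrow> real \<Rightarrow> real \<Rightarrow> 'a" where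
  "sub_path p a b t = p (a + t * (b - a))"

lemma sub_path_01 [simp]: "sub_path p a b 0 = p a" "sub_path p a b 1 = p b"
  by (simp_all add: sub_path_def)

lemma sub_path_itv:
  fixes a b :: real
  assumes "a \<in> {0..1}" "b \<in> {0..1}" "t \<in> {0..1}"
  shows "a + t * (b - a) \<in> {0..1}"
proof -
  have "(1 - t) * a \<le> 1 - t" "t * b \<le> t" "0 \<le> (1 - t) * a" "0 \<le> t * b"
    using assms by (simp_all add: mult_left_le)
  moreover have "a + t * (b - a) = (1 - t) * a + t * b"
    by (simp add: algebra_simps)
  ultimately show ?thesis
    by simp
qed

lemma pathin_affine:
  assumes "a \<in> {0..1}" "b \<in> {0..1}"
  shows "pathin unit_itv (\<lambda>t. a + t * (b - a))"
  using sub_path_itv[OF assms] by (auto simp: pathin_top_of_set intro!: continuous_intros)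

lemma pathin_sub_path:
  assumes "pathin Y p" "a \<in> {0..1}" "b \<in> {0..1}"
  shows "pathin Y (sub_path p a b)"
  using pathin_compose_unit[OF assms(1), of "\<lambda>t. a + t * (b - a)"] pathin_affine[OF assms(2,3)]
  by (simp add: sub_path_def[abs_def] pathin_top_of_set)

lemma path_hom_sub_path:
  assumes "pathin Y p" "a \<in> {0..1}" "b \<in> {0..1}" "c \<in> {0..1}"
  shows "path_hom Y (loop_join (sub_path p a b) (sub_path p b c)) (sub_path p a c)"
proof (rule path_hom_convex)
  show "continuous_map unit_itv Y p"
    using assms by (simp add: pathin_def)
  show "pathin unit_itv (loop_join (\<lambda>t. a + t * (b - a)) (\<lambda>t. b + t * (c - b)))"
    "pathin unit_itv (\<lambda>t. a + t * (c - a))"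
    using assms by (auto intro!: pathin_loop_join pathin_affine)
qed (auto simp: sub_path_def loop_join_def)

subsection \<open>The fundamental group\<close>

lemma const_path_eq: "restrict (\<lambda>t. y) {0..1} = const_path y"
  by (simp add: const_path_def)

lemma loopsD:
  assumes "p \<in> loops Y y"
  shows "pathin Y p" "p 0 = y" "p 1 = y" "p \<in> extensional {0..1}"
  using assms by (auto simp: loops_def)

lemma loops_loop_join: "p \<in> loops Y y \<Longrightarrow> q \<in> loops Y y \<Longrightarrow> loop_join p q \<in> loops Y y"
  by (auto simp: loops_def pathin_loop_join) (simp add: loop_join_def)

lemma loops_rev_path: "p \<in> loops Y y \<Longrightarrow> rev_path p \<in> loops Y y"
  by (auto simp: loops_def pathin_rev_path) (simp add: rev_path_def)

lemma loops_const_path: "y \<in> topspace Y \<Longrightarrow> const_path y \<in> loops Y y"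
  by (auto simp: loops_def) (simp add: const_path_def)

lemma loop_class_path_hom: "p \<in> loops Y y \<Longrightarrow> loop_class Y y p = {q \<in> loops Y y. path_hom Y p q}"
  by (simp add: loop_class_def loop_homotopic_def path_hom_def loops_def)

lemma loop_class_self: "p \<in> loops Y y \<Longrightarrow> p \<in> loop_class Y y p"
  by (simp add: loop_class_path_hom path_hom_refl loops_def)

lemma loop_class_eq_iff:
  assumes "p \<in> loops Y y" "q \<in> loops Y y"
  shows "loop_class Y y p = loop_class Y y q \<longleftrightarrow> path_hom Y p q"
  using assms loop_class_self[OF assms(2)]
  by (auto simp: loop_class_path_hom intro: path_hom_trans path_hom_sym)

text \<open>Multiplication and \<open>pi1_map\<close> are defined through chosen representatives;
  this controls the choice.\<close>

lemma loop_class_some: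
  assumes "p \<in> loops Y y"
  defines "q \<equiv> SOME q. q \<in> loop_class Y y p"
  shows "q \<in> loops Y y" "path_hom Y p q"
proof -
  have "q \<in> loop_class Y y p"
    using loop_class_self[OF assms(1)] unfolding q_def
    by (rule someI[where P = "\<lambda>q. q \<in> loop_class Y y p"])
  then show "q \<in> loops Y y" "path_hom Y p q"
    using assms(1) by (auto simp: loop_class_path_hom)
qed

lemma carrier_fundamental_group [simp]:
  "carrier (fundamental_group Y y) = loop_class Y y ` loops Y y"
  by (simp add: fundamental_group_def)

lemma one_fundamental_group: "\<one>\<^bsub>fundamental_group Y y\<^esub> = loop_class Y y (const_path y)"
  by (simp add: fundamental_group_def const_path_eq)

lemma mult_fundamental_group:
  assumes "p \<in> loops Y y" "q \<in> loops Y y"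
  shows "loop_class Y y p \<otimes>\<^bsub>fundamental_group Y y\<^esub> loop_class Y y q = loop_class Y y (loop_join p q)"
proof -
  let ?p = "SOME p'. p' \<in> loop_class Y y p" and ?q = "SOME q'. q' \<in> loop_class Y y q"
  have "path_hom Y (loop_join p q) (loop_join ?p ?q)"
    using loop_class_some[OF assms(1)] loop_class_some[OF assms(2)] assms
    by (intro path_hom_loop_join) (auto simp: loops_def)
  then have "loop_class Y y (loop_join ?p ?q) = loop_class Y y (loop_join p q)"
    using loop_class_some[OF assms(1)] loop_class_some[OF assms(2)] assms
    by (subst loop_class_eq_iff) (auto intro: loops_loop_join path_hom_sym)
  then show ?thesis
    by (simp add: fundamental_group_def)
qed

lemma group_fundamental_group:
  assumes "y \<in> topspace Y"
  shows "group (fundamental_group Y y)"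
proof (rule groupI)
  let ?G = "fundamental_group Y y"
  note c = loops_const_path[OF assms]
  show "\<one>\<^bsub>?G\<^esub> \<in> carrier ?G"
    using c by (simp add: one_fundamental_group)
  fix A assume "A \<in> carrier ?G"
  then obtain p where p: "p \<in> loops Y y" "A = loop_class Y y p"
    by auto
  show "\<one>\<^bsub>?G\<^esub> \<otimes>\<^bsub>?G\<^esub> A = A"
    using p c path_hom_const_left[of Y p y]
    by (simp add: one_fundamental_group mult_fundamental_group loop_class_eq_iff loops_loop_join loopsD)
  show "\<exists>B \<in> carrier ?G. B \<otimes>\<^bsub>?G\<^esub> A = \<one>\<^bsub>?G\<^esub>"
    using p c path_hom_rev_left[of Y p y] loops_rev_path[OF p(1)]
    by (intro bexI[of _ "loop_class Y y (rev_path p)"])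
      (simp_all add: one_fundamental_group mult_fundamental_group loop_class_eq_iff loops_loop_join loopsD)
  fix B assume "B \<in> carrier ?G"
  then obtain q where q: "q \<in> loops Y y" "B = loop_class Y y q"
    by auto
  show "A \<otimes>\<^bsub>?G\<^esub> B \<in> carrier ?G"
    using p q by (simp add: mult_fundamental_group loops_loop_join)
  fix C assume "C \<in> carrier ?G"
  then obtain r where r: "r \<in> loops Y y" "C = loop_class Y y r"
    by auto
  show "A \<otimes>\<^bsub>?G\<^esub> B \<otimes>\<^bsub>?G\<^esub> C = A \<otimes>\<^bsub>?G\<^esub> (B \<otimes>\<^bsub>?G\<^esub> C)"
    using p q r path_hom_assoc[of Y p q r]
    by (simp add: mult_fundamental_group loop_class_eq_iff loops_loop_join loopsD)
qed

lemma restrict_compose_loop: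
  assumes "continuous_map Y Z f" "f y = z" "p \<in> loops Y y"
  shows "restrict (f \<circ> p) {0..1} \<in> loops Z z"
proof -
  have "pathin Z (restrict (f \<circ> p) {0..1})"
    by (rule pathin_cong[OF pathin_compose[OF loopsD(1)[OF assms(3)] assms(1)]]) simp
  then show ?thesis
    using assms by (auto simp: loops_def)
qed

lemma pi1_map_loop_class:
  assumes "continuous_map Y Z f" "f y = z" "p \<in> loops Y y"
  shows "pi1_map Y y Z z f (loop_class Y y p) = loop_class Z z (restrict (f \<circ> p) {0..1})"
proof -
  define q where "q = (SOME q. q \<in> loop_class Y y p)"
  have q: "q \<in> loops Y y" "path_hom Y p q"
    using loop_class_some[OF assms(3)] by (simp_all add: q_def)
  note fp = restrict_compose_loop[OF assms] and fq = restrict_compose_loop[OF assms(1,2) q(1)]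
  have "path_hom Z (restrict (f \<circ> q) {0..1}) (f \<circ> q)"
    by (rule path_hom_eq) (use fq in \<open>auto simp: loops_def\<close>)
  also have "path_hom Z (f \<circ> q) (f \<circ> p)"
    by (rule path_hom_image[OF path_hom_sym[OF q(2)] assms(1)])
  also have "path_hom Z (f \<circ> p) (restrict (f \<circ> p) {0..1})"
    by (rule path_hom_sym, rule path_hom_eq) (use fp in \<open>auto simp: loops_def\<close>)
  finally show ?thesis
    using fp fq by (simp add: pi1_map_def q_def loop_class_eq_iff)
qed

lemma pi1_map_hom:
  assumes "continuous_map Y Z f" "f y = z"
  shows "pi1_map Y y Z z f \<in> hom (fundamental_group Y y) (fundamental_group Z z)"
proof (rule homI)
  fix A assume "A \<in> carrier (fundamental_group Y y)"
  then obtain p where p: "p \<in> loops Y y" "A = loop_class Y y p"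
    by auto
  then show "pi1_map Y y Z z f A \<in> carrier (fundamental_group Z z)"
    using restrict_compose_loop[OF assms p(1)] by (simp add: pi1_map_loop_class[OF assms])
  fix B assume "B \<in> carrier (fundamental_group Y y)"
  then obtain q where q: "q \<in> loops Y y" "B = loop_class Y y q"
    by auto
  have "restrict (f \<circ> loop_join p q) {0..1} =
      loop_join (restrict (f \<circ> p) {0..1}) (restrict (f \<circ> q) {0..1})"
    by (auto simp: fun_eq_iff loop_join_def)
  then show "pi1_map Y y Z z f (A \<otimes>\<^bsub>fundamental_group Y y\<^esub> B) =
      pi1_map Y y Z z f A \<otimes>\<^bsub>fundamental_group Z z\<^esub> pi1_map Y y Z z f B"
    using p q
    by (simp add: mult_fundamental_group pi1_map_loop_class[OF assms] loops_loop_join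
        restrict_compose_loop[OF assms])
qed

subsection \<open>The generalized wedge of circles\<close>

lemma wedge_pt_01 [simp]: "wedge_pt x 0 = None" "wedge_pt x 1 = None"
  by (simp_all add: wedge_pt_def)

lemma openin_gwedge:
  "openin (gwedge_top X) U \<longleftrightarrow>
     U \<subseteq> insert None ((\<lambda>(x, t). wedge_pt x t) ` (topspace X \<times> {0..1})) \<and>
     openin (prod_topology X unit_itv) {z \<in> topspace X \<times> {0..1}. (\<lambda>(x, t). wedge_pt x t) z \<in> U}"
proof -
  let ?q = "\<lambda>(x, t). wedge_pt x t" and ?P = "prod_topology X unit_itv"
  let ?D = "topspace X \<times> {0..1::real}"
  have eq: "{(x, t) \<in> ?D. wedge_pt x t \<in> U} = {z \<in> ?D. ?q z \<in> U}" for U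
    by auto
  have "istopology (\<lambda>U. U \<subseteq> insert None (?q ` ?D) \<and> openin ?P {z \<in> ?D. ?q z \<in> U})"
    unfolding istopology_def
  proof (intro conjI allI impI; (elim conjE)?)
    fix S T assume "openin ?P {z \<in> ?D. ?q z \<in> S}" "openin ?P {z \<in> ?D. ?q z \<in> T}"
    from openin_Int[OF this] show "openin ?P {z \<in> ?D. ?q z \<in> S \<inter> T}"
      by (rule back_subst[of "openin ?P"]) auto
  next
    fix \<K> assume K: "\<forall>K\<in>\<K>. K \<subseteq> insert None (?q ` ?D) \<and> openin ?P {z \<in> ?D. ?q z \<in> K}"
    have "{z \<in> ?D. ?q z \<in> \<Union>\<K>} = (\<Union>K\<in>\<K>. {z \<in> ?D. ?q z \<in> K})"
      by auto
    then show "openin ?P {z \<in> ?D. ?q z \<in> \<Union>\<K>}"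
      using K by auto
  qed blast+
  then show ?thesis
    unfolding gwedge_top_def eq by (simp only: topology_inverse')
qed

lemma wedge_pt_image:
  "insert None ((\<lambda>(x, t). wedge_pt x t) ` (topspace X \<times> {0..1})) = insert None (Some ` (topspace X \<times> {0<..<1}))"
  by (force simp: wedge_pt_def image_iff split: if_splits)

lemma topspace_gwedge: "topspace (gwedge_top X) = insert None (Some ` (topspace X \<times> {0<..<1}))"
proof
  show "topspace (gwedge_top X) \<subseteq> insert None (Some ` (topspace X \<times> {0<..<1}))"
    using openin_gwedge[of X "topspace (gwedge_top X)"] unfolding wedge_pt_image by simp
  have "{z \<in> topspace X \<times> {0..1}. (\<lambda>(x, t). wedge_pt x t) z \<in> insert None (Some ` (topspace X \<times> {0<..<1}))}
      = topspace (prod_topology X unit_itv)"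
    by (auto simp: wedge_pt_def)
  then show "insert None (Some ` (topspace X \<times> {0<..<1})) \<subseteq> topspace (gwedge_top X)"
    by (intro openin_subset) (simp only: openin_gwedge wedge_pt_image openin_topspace order_refl simp_thms)
qed

lemma None_in_gwedge [simp]: "None \<in> topspace (gwedge_top X)"
  by (simp add: topspace_gwedge)

lemma Some_in_gwedge: "Some (x, s) \<in> topspace (gwedge_top X) \<longleftrightarrow> x \<in> topspace X \<and> 0 < s \<and> s < 1"
  by (auto simp: topspace_gwedge)

lemma continuous_map_wedge_pt:
  "continuous_map (prod_topology X unit_itv) (gwedge_top X) (\<lambda>(x, t). wedge_pt x t)"
  unfolding continuous_map_def
proof (intro conjI allI impI)
  show "(\<lambda>(x, t). wedge_pt x t) \<in> topspace (prod_topology X unit_itv) \<rightarrow> topspace (gwedge_top X)"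
    by (auto simp: topspace_gwedge wedge_pt_def)
qed (simp add: openin_gwedge)

lemma continuous_map_comp_fst:
  "continuous_map X Z f \<Longrightarrow> continuous_map (prod_topology X Y) Z (\<lambda>z. f (fst z))"
  by (rule continuous_map_compose[OF continuous_map_fst, unfolded comp_def])

lemma continuous_map_comp_snd:
  "continuous_map Y Z f \<Longrightarrow> continuous_map (prod_topology X Y) Z (\<lambda>z. f (snd z))"
  by (rule continuous_map_compose[OF continuous_map_snd, unfolded comp_def])

lemma continuous_map_wedge_pt_comp:
  assumes "continuous_map Z X f" "continuous_map Z unit_itv g"
  shows "continuous_map Z (gwedge_top X) (\<lambda>z. wedge_pt (f z) (g z))"
  using continuous_map_compose[OF continuous_map_pairedI[OF assms] continuous_map_wedge_pt]
  by (simp add: comp_def)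

text \<open>Over empty \<open>X\<close> the wedge still has its base point, which the projection
  from the empty product misses.\<close>

lemma quotient_map_wedge_pt:
  assumes "topspace X \<noteq> {}"
  shows "quotient_map (prod_topology X unit_itv) (gwedge_top X) (\<lambda>(x, t). wedge_pt x t)"
proof -
  obtain x where "x \<in> topspace X"
    using assms by blast
  then have "None \<in> (\<lambda>(x, t). wedge_pt x t) ` (topspace X \<times> {0..1})"
    by (intro image_eqI[of _ _ "(x, 0)"]) auto
  then have "(\<lambda>(x, t). wedge_pt x t) ` (topspace X \<times> {0..1}) = topspace (gwedge_top X)"
    using wedge_pt_image[of X] by (simp add: topspace_gwedge insert_absorb)
  then show ?thesis
    by (auto simp: quotient_map_def openin_gwedge)
qed

lemma continuous_map_from_gwedge:
  assumes "continuous_map (prod_topology X unit_itv) Z (\<lambda>(x, t). f (wedge_pt x t))"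
    and "f None \<in> topspace Z"
  shows "continuous_map (gwedge_top X) Z f"
proof (cases "topspace X = {}")
  case True
  then have "topspace (gwedge_top X) = {None}"
    by (simp add: topspace_gwedge)
  then show ?thesis
    using assms(2) by (intro continuous_map_eq[of _ _ "\<lambda>_. f None" f]) simp_all
next
  case False
  then show ?thesis
    using continuous_compose_quotient_map[OF quotient_map_wedge_pt] assms(1)
    by (simp add: comp_def case_prod_unfold)
qed

text \<open>The base point sits at the coordinates 0 and 1 at once, so a condition on the coordinate
  makes sense on the wedge when both ends give the same verdict \<open>b\<close>.\<close>

lemma openin_gwedge_level:
  assumes "open T" "b \<longleftrightarrow> 0 \<in> T" "b \<longleftrightarrow> 1 \<in> T"
  shows "openin (gwedge_top X) {p \<in> topspace (gwedge_top X). case p of None \<Rightarrow> b | Some z \<Rightarrow> snd z \<in> T}"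
proof -
  define U where "U = {p \<in> topspace (gwedge_top X). case p of None \<Rightarrow> b | Some z \<Rightarrow> snd z \<in> T}"
  have "wedge_pt x t \<in> U \<longleftrightarrow> t \<in> T" if "x \<in> topspace X" "t \<in> {0..1}" for x t
  proof (cases "t = 0 \<or> t = 1")
    case True
    then show ?thesis using assms(2,3) by (auto simp: U_def)
  next
    case False
    then show ?thesis using that by (simp add: U_def wedge_pt_def Some_in_gwedge)
  qed
  then have "{z \<in> topspace X \<times> {0..1}. (\<lambda>(x, t). wedge_pt x t) z \<in> U} = topspace X \<times> ({0..1} \<inter> T)"
    by auto
  moreover have "openin (prod_topology X unit_itv) (topspace X \<times> ({0..1} \<inter> T))"
    using assms(1) by (simp add: openin_prod_Times_iff openin_open_Int)
  moreover have "U \<subseteq> topspace (gwedge_top X)"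
    by (auto simp: U_def)
  ultimately have "openin (gwedge_top X) U"
    by (simp only: openin_gwedge wedge_pt_image topspace_gwedge)
  then show ?thesis
    by (simp only: U_def)
qed

section \<open>The two open sets that cover the wedge\<close>

definition off_mid :: "('a \<times> real) option \<Rightarrow> bool" where
  "off_mid p \<longleftrightarrow> (\<forall>x. p \<noteq> Some (x, 1/2))"

lemma openin_off_base: "openin (gwedge_top X) {p \<in> topspace (gwedge_top X). p \<noteq> None}"
proof -
  have "{p \<in> topspace (gwedge_top X). case p of None \<Rightarrow> False | Some z \<Rightarrow> snd z \<in> {0<..<1}} =
      {p \<in> topspace (gwedge_top X). p \<noteq> None}"
    by (auto simp: topspace_gwedge)
  then show ?thesis
    using openin_gwedge_level[of "{0<..<1}" False X] by simp
qed

lemma openin_off_mid: "openin (gwedge_top X) {p \<in> topspace (gwedge_top X). off_mid p}"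
proof -
  have "{p \<in> topspace (gwedge_top X). case p of None \<Rightarrow> True | Some z \<Rightarrow> snd z \<in> - {1/2}} =
      {p \<in> topspace (gwedge_top X). off_mid p}"
    by (auto simp: topspace_gwedge off_mid_def)
  then show ?thesis
    using openin_gwedge_level[of "- {1/2}" True X] by (simp add: open_Compl)
qed

lemma off_base_or_mid: "p \<noteq> None \<or> off_mid p"
  by (auto simp: off_mid_def)

text \<open>Away from the base point the projection is injective, so open subsets of
  \<open>X\<close> times the open interval are saturated and have open images.\<close>

lemma continuous_map_the:
  "continuous_map (subtopology (gwedge_top X) {p \<in> topspace (gwedge_top X). p \<noteq> None})
     (prod_topology X unit_itv) the"
  unfolding continuous_map_def
proof (intro conjI allI impI)
  let ?U = "{p \<in> topspace (gwedge_top X). p \<noteq> None}"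
  let ?S = "subtopology (gwedge_top X) ?U"
  show "the \<in> topspace ?S \<rightarrow> topspace (prod_topology X unit_itv)"
    by (auto simp: topspace_gwedge)
  fix W assume W: "openin (prod_topology X unit_itv) W"
  let ?W = "W \<inter> topspace X \<times> {0<..<1}"
  have "openin (prod_topology X unit_itv) (topspace X \<times> {0<..<1})"
    by (auto simp: openin_prod_Times_iff openin_open)
  then have "openin (prod_topology X unit_itv) ?W"
    using W by (rule openin_Int[rotated])
  moreover have "{z \<in> topspace X \<times> {0..1}. (\<lambda>(x, t). wedge_pt x t) z \<in> Some ` ?W} = ?W"
    by (auto simp: wedge_pt_def split: if_splits)
  ultimately have "openin (gwedge_top X) (Some ` ?W)"
    by (auto simp: openin_gwedge wedge_pt_image)
  then have "openin ?S (Some ` ?W)"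
    by (rule openin_subtopology_Int2[of _ _ ?U, THEN back_subst[of "openin ?S"]])
      (auto simp: topspace_gwedge)
  then show "openin ?S {p \<in> topspace ?S. the p \<in> W}"
    by (rule back_subst[of "openin ?S"]) (force simp: topspace_gwedge)
qed

lemma pathin_coordinates:
  assumes "pathin (gwedge_top X) \<gamma>" "\<And>t. t \<in> {0..1} \<Longrightarrow> \<gamma> t \<noteq> None"
  shows "pathin X (\<lambda>t. fst (the (\<gamma> t)))" "pathin unit_itv (\<lambda>t. snd (the (\<gamma> t)))"
proof -
  have "pathin (subtopology (gwedge_top X) {p \<in> topspace (gwedge_top X). p \<noteq> None}) \<gamma>"
    unfolding pathin_subtopology using assms by (auto simp: pathin_def continuous_map_def)
  from continuous_map_compose[OF this[unfolded pathin_def] continuous_map_the]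
  have "continuous_map unit_itv (prod_topology X unit_itv) (the \<circ> \<gamma>)" .
  from continuous_map_compose[OF this continuous_map_fst] continuous_map_compose[OF this continuous_map_snd]
  show "pathin X (\<lambda>t. fst (the (\<gamma> t)))" "pathin unit_itv (\<lambda>t. snd (the (\<gamma> t)))"
    by (simp_all add: pathin_def comp_def)
qed

lemma continuous_map_gwedge_map:
  assumes "continuous_map X Y f"
  shows "continuous_map (gwedge_top X) (gwedge_top Y) (gwedge_map f)"
proof (rule continuous_map_from_gwedge)
  have "continuous_map (prod_topology X unit_itv) (gwedge_top Y) (\<lambda>z. wedge_pt (f (fst z)) (snd z))"
    by (intro continuous_map_wedge_pt_comp continuous_map_snd continuous_map_comp_fst assms)
  then show "continuous_map (prod_topology X unit_itv) (gwedge_top Y)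
      (\<lambda>(x, t). gwedge_map f (wedge_pt x t))"
    by (rule continuous_map_eq) (auto simp: gwedge_map_def wedge_pt_def)
qed (simp add: gwedge_map_def)

section \<open>Spokes and rays\<close>

text \<open>\<open>spoke p\<close> runs from the base point to \<open>p\<close> along the shorter half of its circle, so it stays off
  the midpoints if \<open>p\<close> does; \<open>ray p\<close> runs in the positive direction.\<close>
definition spoke :: "('a \<times> real) option \<Rightarrow> real \<Rightarrow> ('a \<times> real) option" where
  "spoke p r = (case p of None \<Rightarrow> None
     | Some (x, s) \<Rightarrow> wedge_pt x (if s < 1/2 then r * s else 1 - r * (1 - s)))"

definition ray :: "('a \<times> real) option \<Rightarrow> real \<Rightarrow> ('a \<times> real) option" where
  "ray p r = (case p of None \<Rightarrow> None | Some (x, s) \<Rightarrow> wedge_pt x (r * s))"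

lemma spoke_0 [simp]: "spoke p 0 = None"
  by (simp add: spoke_def split: option.splits)

lemma ray_0 [simp]: "ray p 0 = None"
  by (simp add: ray_def split: option.splits)

lemma spoke_1: "p \<in> topspace (gwedge_top X) \<Longrightarrow> spoke p 1 = p"
  by (auto simp: spoke_def topspace_gwedge wedge_pt_def)

lemma ray_1: "p \<in> topspace (gwedge_top X) \<Longrightarrow> ray p 1 = p"
  by (auto simp: ray_def topspace_gwedge wedge_pt_def)

lemma circle_path:
  assumes "x \<in> topspace X"
  shows "continuous_map unit_itv (gwedge_top X) (wedge_pt x)"
  using continuous_map_wedge_pt_comp[of unit_itv X "\<lambda>_. x" "\<lambda>t. t"] assms by simp

lemma pathin_itv_mult:
  assumes "s \<in> {0..1}"
  shows "pathin unit_itv (\<lambda>r. r * s)" "pathin unit_itv (\<lambda>r. 1 - r * (1 - s))"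
  using pathin_affine[of 0 s] pathin_affine[of 1 s] assms by (simp_all add: algebra_simps)

lemma pathin_ray:
  assumes "p \<in> topspace (gwedge_top X)"
  shows "pathin (gwedge_top X) (ray p)"
proof (cases p)
  case None
  then have "ray p = (\<lambda>r. None)"
    by (simp add: ray_def fun_eq_iff)
  then show ?thesis by simp
next
  case (Some z)
  then have "ray p = (\<lambda>r. wedge_pt (fst z) (r * snd z))"
    by (simp add: ray_def fun_eq_iff case_prod_unfold)
  then show ?thesis
    using assms Some pathin_itv_mult(1)[of "snd z"]
      continuous_map_wedge_pt_comp[of unit_itv X "\<lambda>_. fst z" "\<lambda>r. r * snd z"]
    by (auto simp: topspace_gwedge pathin_def)
qed

lemma pathin_spoke:
  assumes "p \<in> topspace (gwedge_top X)"
  shows "pathin (gwedge_top X) (spoke p)"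
proof (cases p)
  case None
  then have "spoke p = (\<lambda>r. None)"
    by (simp add: spoke_def fun_eq_iff)
  then show ?thesis by simp
next
  case (Some z)
  let ?e = "\<lambda>r. if snd z < 1/2 then r * snd z else 1 - r * (1 - snd z)"
  have z: "fst z \<in> topspace X" "snd z \<in> {0..1}"
    using assms Some by (auto simp: topspace_gwedge)
  have "pathin unit_itv ?e"
    using pathin_itv_mult[OF z(2)] by (cases "snd z < 1/2") simp_all
  then have "pathin (gwedge_top X) (\<lambda>r. wedge_pt (fst z) (?e r))"
    using z unfolding pathin_def by (intro continuous_map_wedge_pt_comp) simp_all
  moreover have "spoke p = (\<lambda>r. wedge_pt (fst z) (?e r))"
    using Some by (simp add: spoke_def fun_eq_iff case_prod_unfold)
  ultimately show ?thesis
    by simp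
qed

text \<open>The unit interval is locally compact, so its product with the quotient map onto the open set off
  the midpoints is again a quotient map.\<close>
lemma continuous_map_spoke:
  "continuous_map (prod_topology unit_itv (subtopology (gwedge_top X) {p \<in> topspace (gwedge_top X). off_mid p}))
     (gwedge_top X) (\<lambda>(r, p). spoke p r)"
proof (cases "topspace X = {}")
  case True
  show ?thesis
    by (rule continuous_map_eq[of _ _ "\<lambda>_. None"]) (auto simp: True topspace_gwedge spoke_def)
next
  case False
  let ?V = "{p \<in> topspace (gwedge_top X). off_mid p}"
  let ?q = "\<lambda>(x, t). wedge_pt x t" and ?P = "prod_topology X unit_itv"
  let ?Q = "{z \<in> topspace ?P. ?q z \<in> ?V}"
  have "quotient_map (subtopology ?P ?Q) (subtopology (gwedge_top X) ?V) ?q"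
    by (rule quotient_map_restriction[OF quotient_map_wedge_pt[OF False]]) (auto intro: openin_off_mid)
  then have "quotient_map (prod_topology unit_itv (subtopology ?P ?Q))
      (prod_topology unit_itv (subtopology (gwedge_top X) ?V)) (\<lambda>(r, z). (r, ?q z))"
    by (intro quotient_map_prod_right)
      (auto intro: compact_imp_locally_compact_space Hausdorff_space_subtopology
        simp: compact_space_subtopology)
  moreover have "continuous_map (prod_topology unit_itv (subtopology ?P ?Q)) (gwedge_top X)
      ((\<lambda>(r, p). spoke p r) \<circ> (\<lambda>(r, z). (r, ?q z)))"
  proof (rule continuous_map_eq)
    \<comment> \<open>\<open>spoke\<close> switches branches at \<open>s < 1/2\<close>; the closed
      form with \<open>s \<le> 1/2\<close> suits \<open>continuous_on_cases_le\<close> and agrees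
      with it because 1/2 is removed from \<open>?D\<close>.\<close>
    let ?e = "\<lambda>(r::real, s). if s \<le> 1/2 then r * s else 1 - r * (1 - s)"
    let ?D = "{0..1} \<times> ({0..1} - {1/2}) :: (real \<times> real) set"
    let ?Z = "prod_topology unit_itv (subtopology ?P ?Q)"
    have Q: "?Q \<subseteq> topspace X \<times> ({0..1} - {1/2})"
      by (auto simp: off_mid_def wedge_pt_def)
    have "continuous_on ?D (\<lambda>z. if snd z \<le> 1/2 then fst z * snd z else 1 - fst z * (1 - snd z))"
      by (rule continuous_on_cases_le) (auto intro!: continuous_intros)
    moreover have "?e z \<in> {0..1}" if "z \<in> ?D" for z
      using that by (auto simp: mult_le_one)
    ultimately have e: "continuous_map (top_of_set ?D) unit_itv ?e"
      by (auto simp: case_prod_unfold)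
    have c: "continuous_map ?Z unit_itv (\<lambda>z. snd (snd z))" "continuous_map ?Z X (\<lambda>z. fst (snd z))"
      by (intro continuous_map_comp_snd continuous_map_from_subtopology continuous_map_snd continuous_map_fst)+
    have "(\<lambda>z. (fst z, snd (snd z))) \<in> topspace ?Z \<rightarrow> ?D"
      using Q by auto
    then have "continuous_map ?Z (subtopology (prod_topology unit_itv unit_itv) ?D)
        (\<lambda>z. (fst z, snd (snd z)))"
      by (intro continuous_map_into_subtopology continuous_map_pairedI continuous_map_fst c)
    moreover have "subtopology (prod_topology unit_itv unit_itv) ?D = top_of_set ?D"
      by (simp add: prod_unit_itv subtopology_subtopology Int_absorb1 Sigma_mono)
    ultimately have "continuous_map ?Z (top_of_set ?D) (\<lambda>z. (fst z, snd (snd z)))"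
      by (simp only:)
    then have "continuous_map ?Z unit_itv (?e \<circ> (\<lambda>z. (fst z, snd (snd z))))"
      using e by (rule continuous_map_compose)
    from continuous_map_wedge_pt_comp[OF c(2) this]
    show "continuous_map ?Z (gwedge_top X) (\<lambda>z. wedge_pt (fst (snd z)) ((?e \<circ> (\<lambda>z. (fst z, snd (snd z)))) z))" .
    fix z assume "z \<in> topspace ?Z"
    moreover obtain r x s where z: "z = (r, x, s)"
      by (cases z)
    ultimately have "r \<in> {0..1}" "(x, s) \<in> ?Q"
      by auto
    then have rs: "r \<in> {0..1}" "s \<in> {0..1}" "s \<noteq> 1/2"
      using subsetD[OF Q] by blast+
    show "wedge_pt (fst (snd z)) ((?e \<circ> (\<lambda>z. (fst z, snd (snd z)))) z) =
        ((\<lambda>(r, p). spoke p r) \<circ> (\<lambda>(r, z). (r, ?q z))) z"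
      \<comment> \<open>For \<open>s = 0\<close> and \<open>s = 1\<close> the projected point is the
        base point, and for every \<open>r\<close> the formula gives the coordinate 0 or 1, again
        the base point.\<close>
      using rs by (cases "s = 0 \<or> s = 1") (auto simp: z spoke_def wedge_pt_def[of x s])
  qed
  ultimately show ?thesis
    by (rule continuous_compose_quotient_map)
qed

lemma pathin_gwedge_in: "pathin (gwedge_top X) \<gamma> \<Longrightarrow> t \<in> {0..1} \<Longrightarrow> \<gamma> t \<in> topspace (gwedge_top X)"
  by (auto simp: pathin_def continuous_map_def)

text \<open>The spokes to the points of \<gamma> sweep out a square: its edge at
  \<open>r = 0\<close> rests at the base point, its edge at \<open>r = 1\<close> is \<gamma>, and
  its other two edges are the spokes to the ends.\<close>

lemma path_hom_spoke:
  assumes "pathin (gwedge_top X) \<gamma>" "\<And>t. t \<in> {0..1} \<Longrightarrow> off_mid (\<gamma> t)"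
  shows "path_hom (gwedge_top X) (loop_join (spoke (\<gamma> 0)) \<gamma>) (spoke (\<gamma> 1))"
proof -
  let ?W = "gwedge_top X" and ?V = "{p \<in> topspace (gwedge_top X). off_mid p}"
  note in_W = pathin_gwedge_in[OF assms(1)]
  have "continuous_map unit_itv (subtopology ?W ?V) \<gamma>"
    using assms in_W by (auto simp: pathin_def continuous_map_in_subtopology)
  then have "continuous_map (prod_topology unit_itv unit_itv) (prod_topology unit_itv (subtopology ?W ?V))
      (\<lambda>z. (fst z, \<gamma> (snd z)))"
    by (intro continuous_map_pairedI continuous_map_fst continuous_map_comp_snd)
  from continuous_map_compose[OF this continuous_map_spoke]
  have "continuous_map (prod_topology unit_itv unit_itv) ?W (\<lambda>(r, t). spoke (\<gamma> t) r)"
    by (simp add: comp_def case_prod_unfold)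
  from path_hom_sym[OF path_hom_square[OF this]]
  have sq: "path_hom ?W (loop_join (spoke (\<gamma> 0)) (\<lambda>t. spoke (\<gamma> t) 1)) (loop_join (\<lambda>t. None) (spoke (\<gamma> 1)))"
    by (simp flip: eta_contract_eq)
  have "path_hom ?W (loop_join (spoke (\<gamma> 0)) \<gamma>) (loop_join (spoke (\<gamma> 0)) (\<lambda>t. spoke (\<gamma> t) 1))"
    using in_W by (intro path_hom_eq pathin_loop_join pathin_spoke assms(1))
      (auto simp: loop_join_def spoke_1[of _ X])
  also note sq
  also have "path_hom ?W (loop_join (\<lambda>t. None) (spoke (\<gamma> 1))) (loop_join (const_path None) (spoke (\<gamma> 1)))"
    using in_W by (intro path_hom_eq pathin_loop_join pathin_spoke)
      (auto simp: loop_join_def const_path_def)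
  also have "path_hom ?W (loop_join (const_path None) (spoke (\<gamma> 1))) (spoke (\<gamma> 1))"
    using in_W by (intro path_hom_const_left pathin_spoke) auto
  finally show ?thesis .
qed

text \<open>The same square for rays. Away from the base point the coordinates of \<gamma> are
  continuous, so the square can be written down in coordinates.\<close>

lemma path_hom_ray:
  assumes "pathin (gwedge_top X) \<gamma>" "\<And>t. t \<in> {0..1} \<Longrightarrow> \<gamma> t \<noteq> None"
  shows "path_hom (gwedge_top X) (loop_join (ray (\<gamma> 0)) \<gamma>) (ray (\<gamma> 1))"
proof -
  let ?W = "gwedge_top X" and ?I2 = "prod_topology unit_itv unit_itv"
  note in_W = pathin_gwedge_in[OF assms(1)]
  note coord = pathin_coordinates[OF assms, unfolded pathin_def]
  have "continuous_map ?I2 ?I2 (\<lambda>z. (fst z, snd (the (\<gamma> (snd z)))))"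
    by (intro continuous_map_pairedI continuous_map_fst continuous_map_comp_snd coord(2))
  moreover have "continuous_map ?I2 unit_itv (\<lambda>z. fst z * snd z)"
    by (auto simp: prod_unit_itv mult_le_one intro!: continuous_intros)
  ultimately have "continuous_map ?I2 unit_itv (\<lambda>z. fst z * snd (the (\<gamma> (snd z))))"
    using continuous_map_compose[of ?I2 ?I2 "\<lambda>z. (fst z, snd (the (\<gamma> (snd z))))" unit_itv
        "\<lambda>z. fst z * snd z"]
    by (simp only: comp_def fst_conv snd_conv)
  then have "continuous_map ?I2 ?W
      (\<lambda>z. wedge_pt (fst (the (\<gamma> (snd z)))) (fst z * snd (the (\<gamma> (snd z)))))"
    by (intro continuous_map_wedge_pt_comp continuous_map_comp_snd[OF coord(1)])
  from path_hom_sym[OF path_hom_square[OF this]]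
  have sq: "path_hom ?W
      (loop_join (\<lambda>r. wedge_pt (fst (the (\<gamma> 0))) (r * snd (the (\<gamma> 0))))
        (\<lambda>t. wedge_pt (fst (the (\<gamma> t))) (snd (the (\<gamma> t)))))
      (loop_join (\<lambda>t. None) (\<lambda>r. wedge_pt (fst (the (\<gamma> 1))) (r * snd (the (\<gamma> 1)))))"
    by simp
  have ray: "ray (\<gamma> t) = (\<lambda>r. wedge_pt (fst (the (\<gamma> t))) (r * snd (the (\<gamma> t))))" if "t \<in> {0..1}" for t
    using assms(2)[OF that] by (auto simp: ray_def fun_eq_iff)
  have "wedge_pt (fst (the (\<gamma> t))) (snd (the (\<gamma> t))) = \<gamma> t" if "t \<in> {0..1}" for t
    using fun_cong[OF ray[OF that], of 1] ray_1[OF in_W[OF that]] by simp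
  then have "path_hom ?W (loop_join (ray (\<gamma> 0)) \<gamma>) (loop_join (ray (\<gamma> 0))
      (\<lambda>t. wedge_pt (fst (the (\<gamma> t))) (snd (the (\<gamma> t)))))"
    using in_W by (intro path_hom_eq pathin_loop_join pathin_ray assms(1))
      (auto simp: loop_join_def ray_1[of _ X])
  also note sq[folded ray[of 0, simplified] ray[of 1, simplified]]
  also have "path_hom ?W (loop_join (\<lambda>t. None) (ray (\<gamma> 1))) (loop_join (const_path None) (ray (\<gamma> 1)))"
    using in_W by (intro path_hom_eq pathin_loop_join pathin_ray)
      (auto simp: loop_join_def const_path_def)
  also have "path_hom ?W (loop_join (const_path None) (ray (\<gamma> 1))) (ray (\<gamma> 1))"
    using in_W by (intro path_hom_const_left pathin_ray) auto
  finally show ?thesis .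
qed

lemma wedge_loop_in_loops: "x \<in> topspace X \<Longrightarrow> wedge_loop x \<in> loops (gwedge_top X) None"
  using pathin_cong[of "gwedge_top X" "wedge_pt x" "wedge_loop x"] circle_path[of x X]
  by (auto simp: loops_def wedge_loop_def pathin_def)

text \<open>From the midpoint on, the spoke comes from the far end of the circle, so out by the ray
  and back by the spoke is one full turn. This is the geometric counterpart of \<open>phase\<close>;
  before the midpoint ray and spoke coincide.\<close>

lemma path_hom_ray_spoke:
  assumes "Some (x, s) \<in> topspace (gwedge_top X)" "1/2 \<le> s"
  shows "path_hom (gwedge_top X) (loop_join (ray (Some (x, s))) (rev_path (spoke (Some (x, s))))) (wedge_loop x)"
proof (rule path_hom_convex)
  have x: "x \<in> topspace X" "s \<in> {0..1}"
    using assms by (auto simp: Some_in_gwedge)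
  show "continuous_map unit_itv (gwedge_top X) (wedge_pt x)"
    by (rule circle_path[OF x(1)])
  show "pathin unit_itv (loop_join (\<lambda>r. r * s) (rev_path (\<lambda>r. 1 - r * (1 - s))))"
    by (intro pathin_loop_join pathin_rev_path pathin_itv_mult x) simp
  show "pathin unit_itv (\<lambda>t::real. t)"
    by (auto simp: pathin_top_of_set)
qed (use assms in \<open>auto simp: loop_join_def rev_path_def ray_def spoke_def wedge_loop_def\<close>)

lemma path_hom_wedge_loop:
  assumes "path_component_of X x y"
  shows "path_hom (gwedge_top X) (wedge_loop x) (wedge_loop y)"
proof -
  obtain g where g: "pathin X g" "g 0 = x" "g 1 = y"
    using assms by (auto simp: path_component_of_def)
  have "continuous_map (prod_topology unit_itv unit_itv) (gwedge_top X) (\<lambda>z. wedge_pt (g (fst z)) (snd z))"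
    by (intro continuous_map_wedge_pt_comp continuous_map_snd
        continuous_map_comp_fst g(1)[unfolded pathin_def])
  then show ?thesis
    by (rule path_homI) (auto simp: wedge_loop_def g)
qed

subsection \<open>Transport along paths in the wedge\<close>

text \<open>Bolzano's bisection principle, used in place of subdivisions with a Lebesgue
  number.\<close>

lemma itv_induct [consumes 3, case_names trans local]:
  fixes P :: "real \<Rightarrow> real \<Rightarrow> bool"
  assumes "0 \<le> a" "a \<le> b" "b \<le> 1"
    and trans: "\<And>a b c. \<lbrakk>0 \<le> a; a \<le> b; b \<le> c; c \<le> 1; P a b; P b c\<rbrakk> \<Longrightarrow> P a c"
    and loc: "\<And>x. x \<in> {0..1} \<Longrightarrow>
      \<exists>\<delta>>0. \<forall>a b. 0 \<le> a \<and> a \<le> x \<and> x \<le> b \<and> b \<le> 1 \<and> b - a < \<delta> \<longrightarrow> P a b"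
  shows "P a b"
proof -
  have "0 \<le> a \<longrightarrow> b \<le> 1 \<longrightarrow> P a b"
    using \<open>a \<le> b\<close>
  proof (induction rule: Bolzano)
    case (trans a b c)
    then show ?case using assms(4) by auto
  next
    case (local x)
    then have "x \<in> {0..1}"
      using assms(1,3) by auto
    from loc[OF this] show ?case
      by blast
  qed
  then show ?thesis
    using assms by blast
qed

lemma pathin_stays:
  assumes "pathin Y p" "openin Y U" "t \<in> {0..1}" "p t \<in> U"
  shows "\<exists>\<delta>>0. \<forall>t'\<in>{0..1}. \<bar>t' - t\<bar> < \<delta> \<longrightarrow> p t' \<in> U"
proof -
  have "openin unit_itv {t \<in> {0..1}. p t \<in> U}"
    using openin_continuous_map_preimage[OF assms(1)[unfolded pathin_def] assms(2)] by simp
  then have "\<exists>\<delta>>0. \<forall>t'\<in>{0..1}. dist t' t < \<delta> \<longrightarrow> t' \<in> {t \<in> {0..1}. p t \<in> U}"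
    using assms(3,4) unfolding openin_euclidean_subtopology_iff by blast
  then show ?thesis
    by (auto simp: dist_real_def)
qed

lemma square_stays:
  assumes "continuous_map (prod_topology unit_itv unit_itv) Y H" "openin Y U"
    and "s \<in> {0..1}" "t \<in> {0..1}" "H (s, t) \<in> U"
  shows "\<exists>\<delta>>0. \<forall>s'\<in>{0..1}. \<forall>t'\<in>{0..1}. \<bar>s' - s\<bar> < \<delta> \<longrightarrow> \<bar>t' - t\<bar> < \<delta> \<longrightarrow> H (s', t') \<in> U"
proof -
  let ?Q = "{z \<in> topspace (prod_topology unit_itv unit_itv). H z \<in> U}"
  have "openin (prod_topology unit_itv unit_itv) ?Q"
    using openin_continuous_map_preimage[OF assms(1,2)] .
  moreover have "(s, t) \<in> ?Q"
    using assms by simp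
  ultimately obtain A B where AB: "openin unit_itv A" "openin unit_itv B" "s \<in> A" "t \<in> B" "A \<times> B \<subseteq> ?Q"
    unfolding openin_prod_topology_alt by meson
  obtain \<delta>1 where 1: "\<delta>1 > 0" "\<And>s'. s' \<in> {0..1} \<Longrightarrow> dist s' s < \<delta>1 \<Longrightarrow> s' \<in> A"
    using AB(1,3) unfolding openin_euclidean_subtopology_iff by meson
  obtain \<delta>2 where 2: "\<delta>2 > 0" "\<And>t'. t' \<in> {0..1} \<Longrightarrow> dist t' t < \<delta>2 \<Longrightarrow> t' \<in> B"
    using AB(2,4) unfolding openin_euclidean_subtopology_iff by meson
  have "H (s', t') \<in> U" if "s' \<in> {0..1}" "t' \<in> {0..1}" "\<bar>s' - s\<bar> < min \<delta>1 \<delta>2" "\<bar>t' - t\<bar> < min \<delta>1 \<delta>2" for s' t'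
    using AB(5) 1(2)[of s'] 2(2)[of t'] that by (auto simp: dist_real_def)
  then show ?thesis
    using 1(1) 2(1) by (intro exI[of _ "min \<delta>1 \<delta>2"]) auto
qed

lemma off_base_open_cases:
  assumes "p \<in> topspace (gwedge_top X)"
  obtains "p \<in> {p \<in> topspace (gwedge_top X). p \<noteq> None}" | "p \<in> {p \<in> topspace (gwedge_top X). off_mid p}"
  using assms off_base_or_mid[of p] by blast

text \<open>Near each time the path stays in one of the two open sets, so by bisection a relation
  that can be chained needs checking only on intervals inside one of them.\<close>

lemma gwedge_path_induct [consumes 4, case_names trans off_base off_mid]:
  assumes "pathin (gwedge_top X) \<alpha>" "0 \<le> a" "a \<le> b" "b \<le> 1"
    and trans: "\<And>a b c. \<lbrakk>0 \<le> a; a \<le> b; b \<le> c; c \<le> 1; P a b; P b c\<rbrakk> \<Longrightarrow> P a c"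
    and off_base: "\<And>a b. \<lbrakk>0 \<le> a; a \<le> b; b \<le> 1; \<And>t. t \<in> {a..b} \<Longrightarrow> \<alpha> t \<noteq> None\<rbrakk> \<Longrightarrow> P a b"
    and off_mid: "\<And>a b. \<lbrakk>0 \<le> a; a \<le> b; b \<le> 1; \<And>t. t \<in> {a..b} \<Longrightarrow> off_mid (\<alpha> t)\<rbrakk> \<Longrightarrow> P a b"
  shows "P a b"
  using assms(2-4)
proof (induction rule: itv_induct)
  case (trans a b c)
  then show ?case by (rule assms(5))
next
  case (local x)
  have near: "\<bar>t - x\<bar> < \<delta>" "t \<in> {0..1}"
    if "0 \<le> a \<and> a \<le> x \<and> x \<le> b \<and> b \<le> 1 \<and> b - a < \<delta>" "t \<in> {a..b}" for a b t \<delta>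
    using that by auto
  from pathin_gwedge_in[OF assms(1) local] show ?case
  proof (cases rule: off_base_open_cases)
    case 1
    from pathin_stays[OF assms(1) openin_off_base local this] obtain \<delta> where
      \<delta>: "\<delta> > 0" "\<And>t. t \<in> {0..1} \<Longrightarrow> \<bar>t - x\<bar> < \<delta> \<Longrightarrow> \<alpha> t \<noteq> None"
      by auto
    have "P a b" if "0 \<le> a \<and> a \<le> x \<and> x \<le> b \<and> b \<le> 1 \<and> b - a < \<delta>" for a b
      by (rule off_base) (use that \<delta>(2) near[OF that] in auto)
    then show ?thesis
      using \<delta>(1) by blast
  next
    case 2
    from pathin_stays[OF assms(1) openin_off_mid local this] obtain \<delta> where
      \<delta>: "\<delta> > 0" "\<And>t. t \<in> {0..1} \<Longrightarrow> \<bar>t - x\<bar> < \<delta> \<Longrightarrow> off_mid (\<alpha> t)"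
      by auto
    have "P a b" if "0 \<le> a \<and> a \<le> x \<and> x \<le> b \<and> b \<le> 1 \<and> b - a < \<delta>" for a b
      by (rule off_mid) (use that \<delta>(2) near[OF that] in auto)
    then show ?thesis
      using \<delta>(1) by blast
  qed
qed

text \<open>\<open>phase\<close> and the constant \<open>\<one>\<close> trivialise, over the two open sets \<open>p \<noteq> None\<close> and \<open>off_mid p\<close>, the
  \<open>G\<close>-covering of the wedge whose monodromy along the circle of \<open>x\<close> is \<open>g x\<close>.\<close>
locale circle_labelling = group G for G (structure) +
  fixes X :: "'x topology" and g :: "'x \<Rightarrow> 'a"
  assumes label_closed: "x \<in> topspace X \<Longrightarrow> g x \<in> carrier G"
    and label_component: "path_component_of X x y \<Longrightarrow> g x = g y"

definition (in circle_labelling) phase :: "('x \<times> real) option \<Rightarrow> 'a" where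
  "phase p = (case p of None \<Rightarrow> \<one> | Some (x, s) \<Rightarrow> if s < 1/2 then \<one> else g x)"

text \<open>\<open>w\<close> is the coordinate of a lifted path in the trivialisation over
  \<open>off_mid\<close>, and multiplying by the inverse of \<open>phase\<close> changes to the
  other trivialisation. No continuity is asked of \<open>w\<close>: it jumps where the path crosses
  a midpoint. Quantifying over all subintervals makes restriction immediate.\<close>

definition (in circle_labelling) lift :: "(real \<Rightarrow> ('x \<times> real) option) \<Rightarrow> real \<Rightarrow> real \<Rightarrow> (real \<Rightarrow> 'a) \<Rightarrow> bool" where
  "lift \<alpha> a b w \<longleftrightarrow> (\<forall>t\<in>{a..b}. w t \<in> carrier G) \<and>
     (\<forall>c d. a \<le> c \<longrightarrow> c \<le> d \<longrightarrow> d \<le> b \<longrightarrow>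
        ((\<forall>t\<in>{c..d}. off_mid (\<alpha> t)) \<longrightarrow> w c = w d) \<and>
        ((\<forall>t\<in>{c..d}. \<alpha> t \<noteq> None) \<longrightarrow> w c \<otimes> inv phase (\<alpha> c) = w d \<otimes> inv phase (\<alpha> d)))"

lemma (in circle_labelling) phase_closed: "p \<in> topspace (gwedge_top X) \<Longrightarrow> phase p \<in> carrier G"
  by (auto simp: phase_def topspace_gwedge label_closed)

lemma (in circle_labelling) phase_path_closed:
  "pathin (gwedge_top X) \<alpha> \<Longrightarrow> t \<in> {0..1} \<Longrightarrow> phase (\<alpha> t) \<in> carrier G"
  by (intro phase_closed pathin_gwedge_in)

text \<open>Compatibility on the overlap: the point of \<open>X\<close> moves within one path
  component, and by the intermediate value theorem the circle coordinate cannot cross 1/2.\<close>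

lemma (in circle_labelling) phase_const:
  assumes "pathin (gwedge_top X) \<alpha>" "0 \<le> c" "c \<le> d" "d \<le> 1"
    and "\<And>t. t \<in> {c..d} \<Longrightarrow> \<alpha> t \<noteq> None" "\<And>t. t \<in> {c..d} \<Longrightarrow> off_mid (\<alpha> t)"
  shows "phase (\<alpha> c) = phase (\<alpha> d)"
proof -
  let ?\<gamma> = "sub_path \<alpha> c d"
  have sub: "c + t * (d - c) \<in> {c..d}" if "t \<in> {0..1}" for t
    using assms(3) that mult_left_le_one_le[of "d - c" t] by auto
  have \<gamma>: "pathin (gwedge_top X) ?\<gamma>" "\<And>t. t \<in> {0..1} \<Longrightarrow> ?\<gamma> t \<noteq> None"
    "\<And>t. t \<in> {0..1} \<Longrightarrow> off_mid (?\<gamma> t)"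
    using assms pathin_sub_path[OF assms(1), of c d] sub by (auto simp: sub_path_def)
  note coord = pathin_coordinates[OF \<gamma>(1,2)]
  have "path_component_of X (fst (the (\<alpha> c))) (fst (the (\<alpha> d)))"
    using coord(1) unfolding path_component_of_def by (intro exI[of _ "\<lambda>t. fst (the (?\<gamma> t))"]) simp
  then have eq: "g (fst (the (\<alpha> c))) = g (fst (the (\<alpha> d)))"
    by (rule label_component)
  let ?s = "\<lambda>t. snd (the (?\<gamma> t))"
  have cont: "continuous_on {0..1} ?s"
    using coord(2) by (simp add: pathin_top_of_set)
  have "?s t \<noteq> 1/2" if "t \<in> {0..1}" for t
    using \<gamma>(2,3)[OF that] by (force simp: off_mid_def)
  then have "?s 0 < 1/2 \<longleftrightarrow> ?s 1 < 1/2"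
    using IVT'[of ?s 0 "1/2" 1, OF _ _ _ cont] IVT2'[of ?s 1 "1/2" 0, OF _ _ _ cont]
    by (metis atLeastAtMost_iff linorder_not_less order_le_less zero_le_one)
  then show ?thesis
    using eq assms(5)[of c] assms(5)[of d] assms(3) by (auto simp: phase_def)
qed

text \<open>Inside one open set a lift is explicit, namely \<open>phase\<close> away from the base
  point and \<one> away from the midpoints. The condition from the other set is then
  \<open>phase_const\<close>.\<close>

lemma (in circle_labelling) lift_exists:
  assumes "pathin (gwedge_top X) \<alpha>" "0 \<le> a" "a \<le> b" "b \<le> 1"
  shows "\<exists>w. lift \<alpha> a b w"
  using assms
proof (induction rule: gwedge_path_induct)
  case (trans a b c)
  then obtain u v where u: "lift \<alpha> a b u" and v: "lift \<alpha> b c v"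
    by blast
  have ub: "u b \<in> carrier G" and vb: "v b \<in> carrier G"
    using u v trans unfolding lift_def by auto
  \<comment> \<open>Both lift conditions survive left multiplication by a constant, since
    \<open>phase\<close> acts on the right; \<open>k\<close> makes the two lifts agree at
    \<open>b\<close>.\<close>
  define k where "k = u b \<otimes> inv v b"
  define w where "w t = (if t \<le> b then u t else k \<otimes> v t)" for t
  have k: "k \<in> carrier G" "k \<otimes> v b = u b"
    using ub vb by (auto simp: k_def m_assoc)
  have w1: "w t = u t" if "t \<le> b" for t
    using that by (simp add: w_def)
  have w2: "w t = k \<otimes> v t" if "b \<le> t" for t
    using that k by (cases "t = b") (auto simp: w_def)
  have closed: "w t \<in> carrier G" if "t \<in> {a..c}" for t
    using that u v k w1[of t] w2[of t] by (cases "t \<le> b") (auto simp: lift_def)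
  have ph: "phase (\<alpha> t) \<in> carrier G" if "t \<in> {a..c}" for t
    using phase_path_closed[OF assms(1), of t] that trans by auto
  have one: "(\<forall>t\<in>{s..e}. off_mid (\<alpha> t)) \<longrightarrow> w s = w e"
    "(\<forall>t\<in>{s..e}. \<alpha> t \<noteq> None) \<longrightarrow> w s \<otimes> inv phase (\<alpha> s) = w e \<otimes> inv phase (\<alpha> e)"
    if "a \<le> s" "s \<le> e" "e \<le> b" for s e
    using u that w1 by (auto simp: lift_def)
  have two: "(\<forall>t\<in>{s..e}. off_mid (\<alpha> t)) \<longrightarrow> w s = w e"
    "(\<forall>t\<in>{s..e}. \<alpha> t \<noteq> None) \<longrightarrow> w s \<otimes> inv phase (\<alpha> s) = w e \<otimes> inv phase (\<alpha> e)"
    if "b \<le> s" "s \<le> e" "e \<le> c" for s e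
  proof -
    have "v s \<in> carrier G" "v e \<in> carrier G"
      using v that by (auto simp: lift_def)
    then show "(\<forall>t\<in>{s..e}. off_mid (\<alpha> t)) \<longrightarrow> w s = w e"
      "(\<forall>t\<in>{s..e}. \<alpha> t \<noteq> None) \<longrightarrow> w s \<otimes> inv phase (\<alpha> s) = w e \<otimes> inv phase (\<alpha> e)"
      using v that w2[of s] w2[of e] k ph[of s] ph[of e] trans by (auto simp: lift_def m_assoc)
  qed
  have "lift \<alpha> a c w"
    unfolding lift_def
  proof (intro conjI allI impI ballI)
    fix s e assume se: "a \<le> s" "s \<le> e" "e \<le> c"
    \<comment> \<open>Only an interval containing \<open>b\<close> is new; it is split
      there.\<close>
    consider "e \<le> b" | "b \<le> s" | "s \<le> b" "b \<le> e"
      using se by linarith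
    note cs = this
    show "w s = w e" if "\<forall>t\<in>{s..e}. off_mid (\<alpha> t)"
      using cs
    proof cases
      case 3
      then have "w s = w b" "w b = w e"
        using one(1)[of s b] two(1)[of b e] that se by auto
      then show ?thesis by simp
    qed (use one(1)[of s e] two(1)[of s e] that se in auto)
    show "w s \<otimes> inv phase (\<alpha> s) = w e \<otimes> inv phase (\<alpha> e)" if "\<forall>t\<in>{s..e}. \<alpha> t \<noteq> None"
      using cs
    proof cases
      case 3
      then have "w s \<otimes> inv phase (\<alpha> s) = w b \<otimes> inv phase (\<alpha> b)"
        "w b \<otimes> inv phase (\<alpha> b) = w e \<otimes> inv phase (\<alpha> e)"
        using one(2)[of s b] two(2)[of b e] that se by auto
      then show ?thesis by simp
    qed (use one(2)[of s e] two(2)[of s e] that se in auto)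
  qed (rule closed)
  then show ?case by blast
next
  case (off_base a b)
  have "lift \<alpha> a b (\<lambda>t. phase (\<alpha> t))"
    unfolding lift_def
  proof (intro conjI allI impI ballI)
    fix c d assume cd: "a \<le> c" "c \<le> d" "d \<le> b"
    show "phase (\<alpha> c) = phase (\<alpha> d)" if "\<forall>t\<in>{c..d}. off_mid (\<alpha> t)"
      using phase_const[OF assms(1), of c d] that cd off_base by auto
    show "phase (\<alpha> c) \<otimes> inv phase (\<alpha> c) = phase (\<alpha> d) \<otimes> inv phase (\<alpha> d)"
      using phase_path_closed[OF assms(1)] cd off_base by simp
  qed (use phase_path_closed[OF assms(1)] off_base in auto)
  then show ?case by blast
next
  case (off_mid a b)
  have "lift \<alpha> a b (\<lambda>t. \<one>)"
    unfolding lift_def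
  proof (intro conjI allI impI ballI)
    fix c d assume cd: "a \<le> c" "c \<le> d" "d \<le> b"
    show "\<one> \<otimes> inv phase (\<alpha> c) = \<one> \<otimes> inv phase (\<alpha> d)" if "\<forall>t\<in>{c..d}. \<alpha> t \<noteq> None"
      using phase_const[OF assms(1), of c d] that cd off_mid by auto
  qed auto
  then show ?case by blast
qed

lemma (in circle_labelling) lift_in: "lift \<alpha> a b w \<Longrightarrow> t \<in> {a..b} \<Longrightarrow> w t \<in> carrier G"
  by (simp add: lift_def)

lemma (in group) quotient_trans:
  assumes "x \<in> carrier G" "y \<in> carrier G" "z \<in> carrier G"
  shows "(inv x \<otimes> y) \<otimes> (inv y \<otimes> z) = inv x \<otimes> z"
  using assms by (simp add: m_assoc[symmetric]) (simp add: m_assoc)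

lemma (in circle_labelling) lift_off_mid:
  assumes "lift \<alpha> 0 1 w" "0 \<le> a" "a \<le> b" "b \<le> 1" "\<And>t. t \<in> {a..b} \<Longrightarrow> off_mid (\<alpha> t)"
  shows "inv (w a) \<otimes> w b = \<one>"
proof -
  have "w a = w b"
    using assms by (simp add: lift_def)
  then show ?thesis
    using lift_in[OF assms(1), of b] assms by simp
qed

lemma (in circle_labelling) lift_off_base:
  assumes "pathin (gwedge_top X) \<alpha>" "lift \<alpha> 0 1 w" "0 \<le> a" "a \<le> b" "b \<le> 1"
    and "\<And>t. t \<in> {a..b} \<Longrightarrow> \<alpha> t \<noteq> None"
  shows "inv (w a) \<otimes> w b = inv phase (\<alpha> a) \<otimes> phase (\<alpha> b)"
proof -
  have c: "w a \<in> carrier G" "w b \<in> carrier G" "phase (\<alpha> a) \<in> carrier G" "phase (\<alpha> b) \<in> carrier G"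
    using lift_in[OF assms(2)] phase_path_closed[OF assms(1)] assms by auto
  have "w a \<otimes> inv phase (\<alpha> a) = w b \<otimes> inv phase (\<alpha> b)"
    using assms by (simp add: lift_def)
  then have "w a \<otimes> inv phase (\<alpha> a) \<otimes> phase (\<alpha> b) = w b"
    using c by (simp add: m_assoc)
  then have "inv (w a) \<otimes> w b = inv (w a) \<otimes> (w a \<otimes> (inv phase (\<alpha> a) \<otimes> phase (\<alpha> b)))"
    using c by (simp add: m_assoc)
  then show ?thesis
    using c by (simp add: m_assoc[symmetric])
qed

text \<open>Lifts are unique only up to a constant on the left, which cancels in the increments.
  Inside either open set the increment is determined by \<alpha>.\<close>

lemma (in circle_labelling) lift_unique:
  assumes "pathin (gwedge_top X) \<alpha>" "0 \<le> a" "a \<le> b" "b \<le> 1" "lift \<alpha> 0 1 w" "lift \<alpha> 0 1 w'"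
  shows "inv (w a) \<otimes> w b = inv (w' a) \<otimes> w' b"
  using assms(1-4)
proof (induction rule: gwedge_path_induct)
  case (trans a b c)
  then have "w t \<in> carrier G" "w' t \<in> carrier G" if "t \<in> {a, b, c}" for t
    using lift_in[OF assms(5), of t] lift_in[OF assms(6), of t] that by auto
  then show ?case
    using trans(5,6) quotient_trans[of "w a" "w b" "w c"] quotient_trans[of "w' a" "w' b" "w' c"] by simp
next
  case (off_base a b)
  then show ?case
    using lift_off_base[OF assms(1) assms(5)] lift_off_base[OF assms(1) assms(6)] by metis
next
  case (off_mid a b)
  then show ?case
    using lift_off_mid[OF assms(5)] lift_off_mid[OF assms(6)] by metis
qed

text \<open>One lift over the whole interval serves all \<open>a\<close> and \<open>b\<close>, so
  that transports telescope; by \<open>lift_unique\<close> its choice does not affect the value for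
  a path.\<close>

definition (in circle_labelling) transport :: "(real \<Rightarrow> ('x \<times> real) option) \<Rightarrow> real \<Rightarrow> real \<Rightarrow> 'a" where
  "transport \<alpha> a b = (let w = SOME w. lift \<alpha> 0 1 w in inv (w a) \<otimes> w b)"

lemma (in circle_labelling) some_lift:
  "pathin (gwedge_top X) \<alpha> \<Longrightarrow> lift \<alpha> 0 1 (SOME w. lift \<alpha> 0 1 w)"
  using lift_exists[of \<alpha> 0 1] by (simp add: someI_ex)

lemma (in circle_labelling) transport_eq:
  assumes "pathin (gwedge_top X) \<alpha>" "lift \<alpha> 0 1 w" "0 \<le> a" "a \<le> b" "b \<le> 1"
  shows "transport \<alpha> a b = inv (w a) \<otimes> w b"
  unfolding transport_def Let_def
  by (rule lift_unique[OF assms(1,3-5) some_lift[OF assms(1)] assms(2)])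

lemma (in circle_labelling) transport_closed:
  assumes "pathin (gwedge_top X) \<alpha>" "0 \<le> a" "a \<le> b" "b \<le> 1"
  shows "transport \<alpha> a b \<in> carrier G"
  using lift_in[OF some_lift[OF assms(1)]] assms by (simp add: transport_def Let_def)

lemma (in circle_labelling) transport_trans:
  assumes "pathin (gwedge_top X) \<alpha>" "0 \<le> a" "a \<le> b" "b \<le> c" "c \<le> 1"
  shows "transport \<alpha> a b \<otimes> transport \<alpha> b c = transport \<alpha> a c"
  using lift_in[OF some_lift[OF assms(1)]] assms by (simp add: transport_def Let_def quotient_trans)

lemma (in circle_labelling) transport_off_mid:
  assumes "pathin (gwedge_top X) \<alpha>" "0 \<le> a" "a \<le> b" "b \<le> 1" "\<And>t. t \<in> {a..b} \<Longrightarrow> off_mid (\<alpha> t)"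
  shows "transport \<alpha> a b = \<one>"
  unfolding transport_def Let_def by (rule lift_off_mid[OF some_lift[OF assms(1)] assms(2-5)])

lemma (in circle_labelling) transport_off_base:
  assumes "pathin (gwedge_top X) \<alpha>" "0 \<le> a" "a \<le> b" "b \<le> 1" "\<And>t. t \<in> {a..b} \<Longrightarrow> \<alpha> t \<noteq> None"
  shows "transport \<alpha> a b = inv phase (\<alpha> a) \<otimes> phase (\<alpha> b)"
  unfolding transport_def Let_def
  by (rule lift_off_base[OF assms(1) some_lift[OF assms(1)] assms(2-5)])

lemma (in circle_labelling) transport_cong:
  assumes "pathin (gwedge_top X) \<alpha>" "\<And>t. t \<in> {0..1} \<Longrightarrow> \<alpha> t = \<beta> t" "0 \<le> a" "a \<le> b" "b \<le> 1"
  shows "transport \<alpha> a b = transport \<beta> a b"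
proof -
  obtain w where w: "lift \<alpha> 0 1 w"
    using lift_exists[OF assms(1), of 0 1] by auto
  then have "lift \<beta> 0 1 w"
    using assms(2) unfolding lift_def by auto
  then show ?thesis
    using transport_eq[OF assms(1) w] transport_eq[OF pathin_cong[OF assms(1,2)]] assms by simp
qed

text \<open>With slope 1/2 this reads lifts of both halves off a lift of a joined path.\<close>

lemma (in circle_labelling) lift_affine:
  assumes "lift \<alpha> 0 1 w" "0 \<le> k" "0 < m" "k + m \<le> 1"
  shows "lift (\<lambda>t. \<alpha> (k + m * t)) 0 1 (\<lambda>t. w (k + m * t))"
  unfolding lift_def
proof (intro conjI allI impI ballI)
  have itv: "0 \<le> k + m * t" "k + m * t \<le> 1" if "t \<in> {0..1}" for t
  proof -
    show "0 \<le> k + m * t"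
      using assms that by simp
    have "m * t \<le> m"
      using assms(3) that by (simp add: mult_left_le)
    then show "k + m * t \<le> 1"
      using assms(4) by simp
  qed
  show "w (k + m * t) \<in> carrier G" if "t \<in> {0..1}" for t
    using lift_in[OF assms(1)] itv[OF that] by simp
  fix c d :: real assume cd: "0 \<le> c" "c \<le> d" "d \<le> 1"
  have all: "\<forall>t\<in>{k + m * c..k + m * d}. Q (\<alpha> t)" if "\<forall>t\<in>{c..d}. Q (\<alpha> (k + m * t))" for Q
  proof
    fix t assume t: "t \<in> {k + m * c..k + m * d}"
    then have "(t - k) / m \<in> {c..d}" "k + m * ((t - k) / m) = t"
      using assms(3) by (auto simp: field_simps)
    then show "Q (\<alpha> t)"
      using that by metis
  qed
  have mcd: "k + m * c \<le> k + m * d"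
    using cd assms(3) by simp
  show "w (k + m * c) = w (k + m * d)" if "\<forall>t\<in>{c..d}. off_mid (\<alpha> (k + m * t))"
    using assms(1) all[OF that] itv cd mcd unfolding lift_def by simp
  show "w (k + m * c) \<otimes> inv phase (\<alpha> (k + m * c)) = w (k + m * d) \<otimes> inv phase (\<alpha> (k + m * d))"
    if "\<forall>t\<in>{c..d}. \<alpha> (k + m * t) \<noteq> None"
    using assms(1) all[OF that] itv cd mcd unfolding lift_def by simp
qed

lemma (in circle_labelling) transport_loop_join:
  assumes "pathin (gwedge_top X) p" "pathin (gwedge_top X) q" "p 1 = q 0"
  shows "transport (loop_join p q) 0 1 = transport p 0 1 \<otimes> transport q 0 1"
proof -
  note pq = pathin_loop_join[OF assms]
  obtain w where w: "lift (loop_join p q) 0 1 w"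
    using lift_exists[OF pq, of 0 1] by auto
  have p: "p t = loop_join p q (0 + 1/2 * t)" if "t \<in> {0..1}" for t
    using that by (simp add: loop_join_def)
  \<comment> \<open>At \<open>t = 0\<close> the join is evaluated on its first branch, as
    \<open>p 1\<close>.\<close>
  have q: "q t = loop_join p q (1/2 + 1/2 * t)" if "t \<in> {0..1}" for t
    using that assms(3) by (cases "t = 0") (simp_all add: loop_join_def)
  have "lift p 0 1 (\<lambda>t. w (0 + 1/2 * t))"
    using lift_affine[OF w, of 0 "1/2"] p unfolding lift_def by simp
  then have "transport p 0 1 = inv (w 0) \<otimes> w (1/2)"
    using transport_eq[OF assms(1)] by force
  moreover have "lift q 0 1 (\<lambda>t. w (1/2 + 1/2 * t))"
    using lift_affine[OF w, of "1/2" "1/2"] q unfolding lift_def by simp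
  then have "transport q 0 1 = inv (w (1/2)) \<otimes> w 1"
    using transport_eq[OF assms(2)] by force
  ultimately show ?thesis
    using transport_eq[OF pq w] lift_in[OF w] quotient_trans by simp
qed

lemma (in circle_labelling) transport_wedge_loop:
  assumes "x \<in> topspace X"
  shows "transport (wedge_loop x) 0 1 = g x"
proof -
  \<comment> \<open>This agrees with \<open>phase\<close> along the circle except at time 1, where
    \<open>phase\<close> is back at \<one> while the lift keeps the value
    \<open>g x\<close>.\<close>
  let ?w = "\<lambda>t::real. if t < 1/2 then \<one> else g x"
  have u: "wedge_loop x t = wedge_pt x t" if "t \<in> {0..1}" for t
    using that by (simp add: wedge_loop_def)
  have "lift (wedge_loop x) 0 1 ?w"
    unfolding lift_def
  proof (intro conjI allI impI ballI)
    fix c d :: real assume cd: "0 \<le> c" "c \<le> d" "d \<le> 1"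
    show "?w c = ?w d" if "\<forall>t\<in>{c..d}. off_mid (wedge_loop x t)"
    proof -
      have "1/2 \<notin> {c..d}"
        using that u[of "1/2"] by (auto simp: off_mid_def wedge_pt_def)
      then show ?thesis using cd by auto
    qed
    show "?w c \<otimes> inv phase (wedge_loop x c) = ?w d \<otimes> inv phase (wedge_loop x d)"
      if "\<forall>t\<in>{c..d}. wedge_loop x t \<noteq> None"
    proof -
      have "phase (wedge_loop x t) = ?w t" if "t \<in> {0..1}" "wedge_loop x t \<noteq> None" for t
        using that u[OF that(1)] by (auto simp: phase_def wedge_pt_def)
      then have "phase (wedge_loop x c) = ?w c" "phase (wedge_loop x d) = ?w d"
        using that cd by auto
      then show ?thesis
        using label_closed[OF assms] by simp
    qed
  qed (use label_closed[OF assms] in auto)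
  then show ?thesis
    using transport_eq[OF loopsD(1)[OF wedge_loop_in_loops[OF assms]]] label_closed[OF assms] by simp
qed

section \<open>Homotopy invariance of transport\<close>

lemma continuous_map_slice1:
  assumes "continuous_map (prod_topology unit_itv unit_itv) Y H" "t \<in> {0..1}"
  shows "pathin Y (\<lambda>s. H (s, t))"
proof -
  have "continuous_map unit_itv (prod_topology unit_itv unit_itv) (\<lambda>s. (s, t))"
    using assms(2) by (intro continuous_map_pairedI) auto
  from continuous_map_compose[OF this assms(1)] show ?thesis
    by (simp only: pathin_def comp_def)
qed

lemma continuous_map_slice2:
  assumes "continuous_map (prod_topology unit_itv unit_itv) Y H" "s \<in> {0..1}"
  shows "pathin Y (\<lambda>t. H (s, t))"
proof -
  have "continuous_map unit_itv (prod_topology unit_itv unit_itv) (\<lambda>t. (s, t))"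
    using assms(2) by (intro continuous_map_pairedI) auto
  from continuous_map_compose[OF this assms(1)] show ?thesis
    by (simp only: pathin_def comp_def)
qed

text \<open>Two commuting squares are pasted along the common edge \<open>m\<close>.\<close>

lemma (in group) rectangle_trans:
  assumes "p \<in> carrier G" "q \<in> carrier G" "r \<in> carrier G" "l \<in> carrier G" "m \<in> carrier G"
    "p' \<in> carrier G" "q' \<in> carrier G"
    and "p \<otimes> m = l \<otimes> p'" "q \<otimes> r = m \<otimes> q'"
  shows "(p \<otimes> q) \<otimes> r = l \<otimes> (p' \<otimes> q')"
  using assms by (metis m_assoc m_closed)

text \<open>Flatness of transport. On a rectangle mapped into one of the two open sets, transport
  depends only on end points, so both ways around agree; larger rectangles are pasted from such
  ones.\<close>

lemma (in circle_labelling) transport_square: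
  assumes H: "continuous_map (prod_topology unit_itv unit_itv) (gwedge_top X) H"
  shows "transport (\<lambda>s. H (s, 0)) 0 1 \<otimes> transport (\<lambda>t. H (1, t)) 0 1
       = transport (\<lambda>t. H (0, t)) 0 1 \<otimes> transport (\<lambda>s. H (s, 1)) 0 1"
proof -
  note hor = continuous_map_slice1[OF H] and ver = continuous_map_slice2[OF H]
  define P where "P a b c d \<longleftrightarrow>
      transport (\<lambda>s. H (s, c)) a b \<otimes> transport (\<lambda>t. H (b, t)) c d
    = transport (\<lambda>t. H (a, t)) c d \<otimes> transport (\<lambda>s. H (s, d)) a b" for a b c d
  have P_hor: "P a b' c d"
    if "0 \<le> a" "a \<le> b" "b \<le> b'" "b' \<le> 1" "0 \<le> c" "c \<le> d" "d \<le> 1" "P a b c d" "P b b' c d" for a b b' c d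
    unfolding P_def
    using that transport_trans[OF hor, of c a b b'] transport_trans[OF hor, of d a b b']
      rectangle_trans[of "transport (\<lambda>s. H (s, c)) a b" "transport (\<lambda>s. H (s, c)) b b'"
        "transport (\<lambda>t. H (b', t)) c d" "transport (\<lambda>t. H (a, t)) c d" "transport (\<lambda>t. H (b, t)) c d"
        "transport (\<lambda>s. H (s, d)) a b" "transport (\<lambda>s. H (s, d)) b b'"]
    by (simp add: P_def transport_closed[OF hor] transport_closed[OF ver])
  have P_ver: "P a b c d'"
    if "0 \<le> a" "a \<le> b" "b \<le> 1" "0 \<le> c" "c \<le> d" "d \<le> d'" "d' \<le> 1" "P a b c d" "P a b d d'" for a b c d d'
    unfolding P_def
    using that transport_trans[OF ver, of a c d d'] transport_trans[OF ver, of b c d d']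
      rectangle_trans[of "transport (\<lambda>t. H (a, t)) c d" "transport (\<lambda>t. H (a, t)) d d'"
        "transport (\<lambda>s. H (s, d')) a b" "transport (\<lambda>s. H (s, c)) a b" "transport (\<lambda>s. H (s, d)) a b"
        "transport (\<lambda>t. H (b, t)) c d" "transport (\<lambda>t. H (b, t)) d d'"]
    by (simp add: P_def transport_closed[OF hor] transport_closed[OF ver])
  have P_local: "\<exists>\<delta>>0. \<forall>a b c d. 0 \<le> a \<and> a \<le> s \<and> s \<le> b \<and> b \<le> 1 \<and> b - a < \<delta> \<and>
      0 \<le> c \<and> c \<le> t \<and> t \<le> d \<and> d \<le> 1 \<and> d - c < \<delta> \<longrightarrow> P a b c d"
    if st: "s \<in> {0..1}" "t \<in> {0..1}" for s t
  proof -
    have "H (s, t) \<in> topspace (gwedge_top X)"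
      using pathin_gwedge_in[OF hor[OF st(2)] st(1)] .
    then show ?thesis
    proof (cases rule: off_base_open_cases)
      case 1
      from square_stays[OF H openin_off_base st this] obtain \<delta> where \<delta>: "\<delta> > 0"
        "\<And>s' t'. \<lbrakk>s' \<in> {0..1}; t' \<in> {0..1}; \<bar>s' - s\<bar> < \<delta>; \<bar>t' - t\<bar> < \<delta>\<rbrakk> \<Longrightarrow> H (s', t') \<noteq> None"
        by blast
      have "P a b c d" if ab: "0 \<le> a" "a \<le> s" "s \<le> b" "b \<le> 1" "b - a < \<delta>"
        and cd: "0 \<le> c" "c \<le> t" "t \<le> d" "d \<le> 1" "d - c < \<delta>" for a b c d
      proof -
        have off: "H (s', t') \<noteq> None" if "s' \<in> {a..b}" "t' \<in> {c..d}" for s' t'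
          using that ab cd by (intro \<delta>(2)) auto
        have "phase (H (s', t')) \<in> carrier G" if "s' \<in> {a..b}" "t' \<in> {c..d}" for s' t'
          using phase_path_closed[OF hor[of t'], of s'] that ab cd by auto
        moreover have "transport (\<lambda>s. H (s, t')) a b = inv phase (H (a, t')) \<otimes> phase (H (b, t'))"
          if "t' \<in> {c..d}" for t'
          using that ab cd off by (intro transport_off_base hor) auto
        moreover have "transport (\<lambda>t. H (s', t)) c d = inv phase (H (s', c)) \<otimes> phase (H (s', d))"
          if "s' \<in> {a..b}" for s'
          using that ab cd off by (intro transport_off_base ver) auto
        ultimately show ?thesis
          unfolding P_def using ab cd by (simp add: quotient_trans)
      qed
      then show ?thesis
        using \<delta>(1) by blast
    next
      case 2
      from square_stays[OF H openin_off_mid st this] obtain \<delta> where \<delta>: "\<delta> > 0"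
        "\<And>s' t'. \<lbrakk>s' \<in> {0..1}; t' \<in> {0..1}; \<bar>s' - s\<bar> < \<delta>; \<bar>t' - t\<bar> < \<delta>\<rbrakk> \<Longrightarrow> off_mid (H (s', t'))"
        by blast
      have "P a b c d" if ab: "0 \<le> a" "a \<le> s" "s \<le> b" "b \<le> 1" "b - a < \<delta>"
        and cd: "0 \<le> c" "c \<le> t" "t \<le> d" "d \<le> 1" "d - c < \<delta>" for a b c d
      proof -
        have off: "off_mid (H (s', t'))" if "s' \<in> {a..b}" "t' \<in> {c..d}" for s' t'
          using that ab cd by (intro \<delta>(2)) auto
        have "transport (\<lambda>s. H (s, t')) a b = \<one>" if "t' \<in> {c..d}" for t'
          using that ab cd off by (intro transport_off_mid hor) auto
        moreover have "transport (\<lambda>t. H (s', t)) c d = \<one>" if "s' \<in> {a..b}" for s'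
          using that ab cd off by (intro transport_off_mid ver) auto
        ultimately show ?thesis
          unfolding P_def using ab cd by simp
      qed
      then show ?thesis
        using \<delta>(1) by blast
    qed
  qed
  \<comment> \<open>Two nested bisections: the outer one stacks strips of full width, the inner one
    assembles a strip from small rectangles.\<close>
  have "P 0 1 c d" if "0 \<le> c" "c \<le> d" "d \<le> 1" for c d
    using that
  proof (induction rule: itv_induct)
    case (trans c d d')
    then show ?case
      using P_ver[of 0 1 c d d'] by simp
  next
    case (local t)
    \<comment> \<open>One \<delta> has to serve the whole strip around height \<open>t\<close>.
      Pasting takes the minimum of two values, which does the work of the tube lemma.\<close>
    have "\<exists>\<delta>>0. \<forall>c d. 0 \<le> c \<and> c \<le> t \<and> t \<le> d \<and> d \<le> 1 \<and> d - c < \<delta> \<longrightarrow> P a b c d"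
      if "0 \<le> a" "a \<le> b" "b \<le> 1" for a b
      using that
    proof (induction rule: itv_induct)
      case (trans a b b')
      then obtain \<delta> \<delta>' where "\<delta> > 0" "\<delta>' > 0"
        "\<And>c d. 0 \<le> c \<and> c \<le> t \<and> t \<le> d \<and> d \<le> 1 \<and> d - c < \<delta> \<Longrightarrow> P a b c d"
        "\<And>c d. 0 \<le> c \<and> c \<le> t \<and> t \<le> d \<and> d \<le> 1 \<and> d - c < \<delta>' \<Longrightarrow> P b b' c d"
        by metis
      then show ?case
        using trans(1-4) P_hor[of a b b'] by (intro exI[of _ "min \<delta> \<delta>'"]) auto
    next
      case (local s)
      from P_local[OF local \<open>t \<in> {0..1}\<close>] show ?case
        by blast
    qed
    from this[of 0 1] show ?case
      by simp
  qed
  from this[of 0 1] show ?thesis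
    by (simp add: P_def)
qed

lemma (in circle_labelling) transport_path_hom:
  assumes "path_hom (gwedge_top X) p q" "p 0 = None" "p 1 = None"
  shows "transport p 0 1 = transport q 0 1"
proof -
  obtain H where H: "continuous_map (prod_topology unit_itv unit_itv) (gwedge_top X) H"
    "\<And>t. t \<in> {0..1} \<Longrightarrow> H (0, t) = p t" "\<And>t. t \<in> {0..1} \<Longrightarrow> H (1, t) = q t"
    "\<And>s. s \<in> {0..1} \<Longrightarrow> H (s, 0) = p 0" "\<And>s. s \<in> {0..1} \<Longrightarrow> H (s, 1) = p 1"
    by (rule path_homE[OF assms(1)]) blast
  note hor = continuous_map_slice1[OF H(1)] and ver = continuous_map_slice2[OF H(1)]
  have "transport (\<lambda>s. H (s, 0)) 0 1 = \<one>" "transport (\<lambda>s. H (s, 1)) 0 1 = \<one>"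
    using H(4,5) assms(2,3) by (auto intro!: transport_off_mid hor simp: off_mid_def)
  moreover have "transport (\<lambda>t. H (0, t)) 0 1 = transport p 0 1" "transport (\<lambda>t. H (1, t)) 0 1 = transport q 0 1"
    using H(2,3) by (auto intro!: transport_cong ver)
  moreover have "transport p 0 1 \<in> carrier G" "transport q 0 1 \<in> carrier G"
    using path_hom_pathin[OF assms(1)] by (auto intro: transport_closed)
  ultimately show ?thesis
    using transport_square[OF H(1)] by simp
qed

subsection \<open>Transport in the fundamental group\<close>

text \<open>From k \<gamma> ~ k', cancel \<open>k\<close> on the left and \<open>k'\<close> on the
  right.\<close>

lemma path_hom_slide:
  assumes "pathin Y k" "pathin Y \<gamma>" "k 1 = \<gamma> 0" "path_hom Y (loop_join k \<gamma>) k'"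
  shows "path_hom Y (loop_join \<gamma> (rev_path k')) (rev_path k)"
proof -
  have k': "pathin Y k'" "k' 0 = k 0" "k' 1 = \<gamma> 1"
    using path_hom_pathin(2)[OF assms(4)] path_hom_ends[OF assms(4)] by auto
  note rk = pathin_rev_path[OF assms(1)] and rk' = pathin_rev_path[OF k'(1)]
  have j: "pathin Y (loop_join \<gamma> (rev_path k'))"
    by (rule pathin_loop_join[OF assms(2) rk']) (simp add: k')
  have "path_hom Y (loop_join \<gamma> (rev_path k')) (loop_join (const_path (k 1)) (loop_join \<gamma> (rev_path k')))"
    by (rule path_hom_sym[OF path_hom_const_left[OF j]]) (simp add: assms(3))
  also have "path_hom Y \<dots> (loop_join (loop_join (rev_path k) k) (loop_join \<gamma> (rev_path k')))"
    by (rule path_hom_loop_join[OF path_hom_sym[OF path_hom_rev_left] path_hom_refl[OF j]])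
      (simp_all add: assms)
  also have "path_hom Y \<dots> (loop_join (rev_path k) (loop_join k (loop_join \<gamma> (rev_path k'))))"
    by (rule path_hom_assoc[OF rk assms(1) j]) (simp_all add: assms)
  also have "path_hom Y \<dots> (loop_join (rev_path k) (loop_join (loop_join k \<gamma>) (rev_path k')))"
    by (intro path_hom_loop_join path_hom_refl rk path_hom_sym[OF path_hom_assoc] assms(1-3) rk')
      (simp_all add: k')
  also have "path_hom Y \<dots> (loop_join (rev_path k) (loop_join k' (rev_path k')))"
    by (intro path_hom_loop_join path_hom_refl rk rk' assms(4)) (simp_all add: k')
  also have "path_hom Y \<dots> (loop_join (rev_path k) (const_path (k 0)))"
    by (intro path_hom_loop_join path_hom_refl rk path_hom_rev_right k') (simp_all add: k')
  also have "path_hom Y \<dots> (rev_path k)"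
    by (intro path_hom_const_right rk) simp
  finally show ?thesis .
qed

text \<open>Go out by \<open>p\<close> and return by \<open>k\<close>: moving the turning point
  along \<gamma> does not change the class. In use, \<open>p\<close> is an initial segment of a loop
  and \<open>k\<close> a spoke or a ray.\<close>

lemma path_hom_slide_join:
  assumes "pathin Y p" "pathin Y k" "pathin Y \<gamma>" "p 1 = \<gamma> 0" "k 1 = \<gamma> 0"
    and "path_hom Y (loop_join p \<gamma>) p'" "path_hom Y (loop_join k \<gamma>) k'"
  shows "path_hom Y (loop_join p (rev_path k)) (loop_join p' (rev_path k'))"
proof -
  have k': "pathin Y k'" "k' 1 = \<gamma> 1"
    using path_hom_pathin(2)[OF assms(7)] path_hom_ends[OF assms(7)] by auto
  note rk' = pathin_rev_path[OF k'(1)]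
  have "path_hom Y (loop_join p (rev_path k)) (loop_join p (loop_join \<gamma> (rev_path k')))"
    by (intro path_hom_loop_join path_hom_refl assms(1) path_hom_sym[OF path_hom_slide[OF assms(2,3,5,7)]])
      (simp add: assms)
  also have "path_hom Y \<dots> (loop_join (loop_join p \<gamma>) (rev_path k'))"
    by (rule path_hom_sym[OF path_hom_assoc[OF assms(1,3) rk' assms(4)]]) (simp add: k')
  also have "path_hom Y \<dots> (loop_join p' (rev_path k'))"
    by (intro path_hom_loop_join path_hom_refl rk' assms(6)) (simp add: k')
  finally show ?thesis .
qed

lemma path_hom_cancel:
  assumes "pathin Y p" "pathin Y q" "pathin Y r" "p 1 = q 1" "q 1 = r 0"
  shows "path_hom Y (loop_join (loop_join p (rev_path q)) (loop_join q r)) (loop_join p r)"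
proof -
  note rq = pathin_rev_path[OF assms(2)]
  have j: "pathin Y (loop_join q r)"
    by (rule pathin_loop_join[OF assms(2,3,5)])
  have "path_hom Y (loop_join (loop_join p (rev_path q)) (loop_join q r))
      (loop_join p (loop_join (rev_path q) (loop_join q r)))"
    by (rule path_hom_assoc[OF assms(1) rq j]) (simp_all add: assms)
  also have "path_hom Y \<dots> (loop_join p (loop_join (loop_join (rev_path q) q) r))"
    by (intro path_hom_loop_join path_hom_refl assms(1) path_hom_sym[OF path_hom_assoc] rq assms(2,3))
      (simp_all add: assms)
  also have "path_hom Y \<dots> (loop_join p (loop_join (const_path (r 0)) r))"
    by (intro path_hom_loop_join path_hom_refl assms(1,3) path_hom_rev_left assms(2)) (simp_all add: assms)
  also have "path_hom Y \<dots> (loop_join p r)"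
    by (intro path_hom_loop_join path_hom_refl assms(1) path_hom_const_left assms(3)) (simp_all add: assms)
  finally show ?thesis .
qed

lemma circle_labelling_pi1:
  "circle_labelling (fundamental_group (gwedge_top X) None) X
     (\<lambda>x. loop_class (gwedge_top X) None (wedge_loop x))"
proof -
  have "x \<in> topspace X \<and> y \<in> topspace X" if "path_component_of X x y" for x y
    using that path_component_in_topspace by metis
  then show ?thesis
    using path_hom_wedge_loop
    by (auto simp: circle_labelling_def circle_labelling_axioms_def group_fundamental_group
        wedge_loop_in_loops loop_class_eq_iff)
qed

interpretation pi1_labelling: circle_labelling "fundamental_group (gwedge_top X) None" X
  "\<lambda>x. loop_class (gwedge_top X) None (wedge_loop x)" for X
  by (rule circle_labelling_pi1)

lemma itv_subset: "0 \<le> c \<Longrightarrow> c \<le> d \<Longrightarrow> d \<le> 1 \<Longrightarrow> t \<in> {0..1} \<Longrightarrow> c + t * (d - c) \<in> {c..d}" for c d t :: real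
  using mult_left_le_one_le[of "d - c" t] by auto

text \<open>The tautological lift: follow \<alpha> up to time \<open>t\<close> and return by the
  spoke. Off the midpoints the spoke slides along \<alpha>, so the class is constant. Away from the
  base point, dividing by \<open>phase\<close> replaces the spoke by the ray, which slides
  there.\<close>

lemma spoke_lift:
  assumes \<alpha>: "\<alpha> \<in> loops (gwedge_top X) None"
  defines "w \<equiv> \<lambda>t. loop_class (gwedge_top X) None (loop_join (sub_path \<alpha> 0 t) (rev_path (spoke (\<alpha> t))))"
  shows "pi1_labelling.lift X \<alpha> 0 1 w"
proof -
  let ?W = "gwedge_top X"
  note p\<alpha> = loopsD(1)[OF \<alpha>] and \<alpha>0 = loopsD(2)[OF \<alpha>]
  note in_W = pathin_gwedge_in[OF p\<alpha>]
  note sub = pathin_sub_path[OF p\<alpha>]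
  let ?s = "\<lambda>t. loop_join (sub_path \<alpha> 0 t) (rev_path (spoke (\<alpha> t)))"
  let ?r = "\<lambda>t. loop_join (sub_path \<alpha> 0 t) (rev_path (ray (\<alpha> t)))"
  have s: "?s t \<in> loops ?W None" if "t \<in> {0..1}" for t
  proof -
    have "pathin ?W (?s t)"
      using that in_W[OF that] by (intro pathin_loop_join sub pathin_rev_path pathin_spoke) (auto simp: spoke_1[of _ X])
    then show ?thesis
      using \<alpha>0 by (simp add: loops_def) (simp add: loop_join_def)
  qed
  have r: "?r t \<in> loops ?W None" if "t \<in> {0..1}" for t
  proof -
    have "pathin ?W (?r t)"
      using that in_W[OF that] by (intro pathin_loop_join sub pathin_rev_path pathin_ray) (auto simp: ray_1[of _ X])
    then show ?thesis
      using \<alpha>0 by (simp add: loops_def) (simp add: loop_join_def)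
  qed
  have w_ray: "w t \<otimes>\<^bsub>fundamental_group ?W None\<^esub> inv\<^bsub>fundamental_group ?W None\<^esub> pi1_labelling.phase X (\<alpha> t)
      = loop_class ?W None (?r t)" if t: "t \<in> {0..1}" "\<alpha> t \<noteq> None" for t
  proof -
    obtain x \<sigma> where x\<sigma>: "\<alpha> t = Some (x, \<sigma>)"
      using t(2) by auto
    have x: "x \<in> topspace X" "Some (x, \<sigma>) \<in> topspace ?W"
      using in_W[OF t(1)] x\<sigma> by (simp_all add: Some_in_gwedge)
    show ?thesis
    proof (cases "\<sigma> < 1/2")
      case True
      then have "spoke (\<alpha> t) = ray (\<alpha> t)" "pi1_labelling.phase X (\<alpha> t) = \<one>\<^bsub>fundamental_group ?W None\<^esub>"
        using x\<sigma> by (auto simp: spoke_def ray_def fun_eq_iff pi1_labelling.phase_def)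
      then show ?thesis
        using r[OF t(1)] by (simp add: w_def)
    next
      case False
      let ?u = "wedge_loop x"
      note u = wedge_loop_in_loops[OF x(1)]
      have ph: "pi1_labelling.phase X (\<alpha> t) = loop_class ?W None ?u"
        using x\<sigma> False by (simp add: pi1_labelling.phase_def)
      have ray: "pathin ?W (ray (\<alpha> t))" "ray (\<alpha> t) 1 = \<alpha> t"
        using in_W[OF t(1)] by (auto intro: pathin_ray ray_1)
      have spoke: "pathin ?W (rev_path (spoke (\<alpha> t)))" "rev_path (spoke (\<alpha> t)) 0 = \<alpha> t"
        using in_W[OF t(1)] by (auto intro: pathin_rev_path pathin_spoke simp: spoke_1[of _ X])
      have st: "pathin ?W (sub_path \<alpha> 0 t)"
        using t(1) by (intro sub) auto
      \<comment> \<open>The circle is replaced by the ray followed by the reversed spoke; the ray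
        then cancels against the return leg of \<open>?r t\<close>.\<close>
      have "path_hom ?W (loop_join (?r t) ?u)
          (loop_join (?r t) (loop_join (ray (\<alpha> t)) (rev_path (spoke (\<alpha> t)))))"
        using path_hom_sym[OF path_hom_ray_spoke[OF x(2)]] False x\<sigma> loopsD[OF r[OF t(1)]] loopsD[OF u]
        by (intro path_hom_loop_join path_hom_refl) auto
      also have "path_hom ?W \<dots> (?s t)"
        using ray spoke st by (intro path_hom_cancel) auto
      finally have "loop_class ?W None (?r t) \<otimes>\<^bsub>fundamental_group ?W None\<^esub> loop_class ?W None ?u = w t"
        using r[OF t(1)] s[OF t(1)] u
        by (simp add: mult_fundamental_group w_def loop_class_eq_iff loops_loop_join)
      moreover have "loop_class ?W None (?r t) \<in> carrier (fundamental_group ?W None)"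
        "loop_class ?W None ?u \<in> carrier (fundamental_group ?W None)"
        using r[OF t(1)] u by auto
      ultimately show ?thesis
        unfolding ph by (metis pi1_labelling.m_assoc pi1_labelling.r_inv pi1_labelling.r_one pi1_labelling.inv_closed)
    qed
  qed
  show ?thesis
    unfolding pi1_labelling.lift_def
  proof (intro conjI allI impI ballI)
    show "w t \<in> carrier (fundamental_group ?W None)" if "t \<in> {0..1}" for t
      using s[OF that] by (auto simp: w_def)
    fix c d :: real assume cd: "0 \<le> c" "c \<le> d" "d \<le> 1"
    then have cd1: "c \<in> {0..1}" "d \<in> {0..1}" "0 \<in> {0..1::real}"
      by auto
    let ?\<gamma> = "sub_path \<alpha> c d"
    have \<gamma>: "pathin ?W ?\<gamma>"
      by (rule sub[OF cd1(1,2)])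
    have split: "path_hom ?W (loop_join (sub_path \<alpha> 0 c) ?\<gamma>) (sub_path \<alpha> 0 d)"
      by (rule path_hom_sub_path[OF p\<alpha> cd1(3,1,2)])
    show "w c = w d" if off: "\<forall>t\<in>{c..d}. off_mid (\<alpha> t)"
    proof -
      have "off_mid (?\<gamma> t)" if "t \<in> {0..1}" for t
        using off itv_subset[OF cd that] by (simp add: sub_path_def)
      from path_hom_spoke[OF \<gamma> this]
      have "path_hom ?W (loop_join (spoke (\<alpha> c)) ?\<gamma>) (spoke (\<alpha> d))"
        by simp
      then have "path_hom ?W (?s c) (?s d)"
        using in_W cd1 by (intro path_hom_slide_join[OF sub pathin_spoke \<gamma> _ _ split]) (auto simp: spoke_1[of _ X])
      then show ?thesis
        unfolding w_def by (simp add: loop_class_eq_iff[OF s[OF cd1(1)] s[OF cd1(2)]])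
    qed
    show "w c \<otimes>\<^bsub>fundamental_group ?W None\<^esub> inv\<^bsub>fundamental_group ?W None\<^esub> pi1_labelling.phase X (\<alpha> c) =
        w d \<otimes>\<^bsub>fundamental_group ?W None\<^esub> inv\<^bsub>fundamental_group ?W None\<^esub> pi1_labelling.phase X (\<alpha> d)"
      if off: "\<forall>t\<in>{c..d}. \<alpha> t \<noteq> None"
    proof -
      have "?\<gamma> t \<noteq> None" if "t \<in> {0..1}" for t
        using off itv_subset[OF cd that] unfolding sub_path_def by blast
      from path_hom_ray[OF \<gamma> this]
      have "path_hom ?W (loop_join (ray (\<alpha> c)) ?\<gamma>) (ray (\<alpha> d))"
        by simp
      then have "path_hom ?W (?r c) (?r d)"
        using in_W cd1 by (intro path_hom_slide_join[OF sub pathin_ray \<gamma> _ _ split]) (auto simp: ray_1[of _ X])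
      then have "loop_class ?W None (?r c) = loop_class ?W None (?r d)"
        by (simp add: loop_class_eq_iff[OF r[OF cd1(1)] r[OF cd1(2)]])
      then show ?thesis
        using w_ray[OF cd1(1)] w_ray[OF cd1(2)] off cd by auto
    qed
  qed
qed

text \<open>A homomorphism matching the labels matches the phases, and the conditions on a lift are
  equations between group elements.\<close>

lemma (in circle_labelling) lift_hom:
  assumes "circle_labelling H X g'" "h \<in> hom G H" "\<And>x. x \<in> topspace X \<Longrightarrow> h (g x) = g' x"
    and "pathin (gwedge_top X) \<alpha>" "lift \<alpha> 0 1 w"
  shows "circle_labelling.lift H g' \<alpha> 0 1 (\<lambda>t. h (w t))"
proof -
  interpret H: circle_labelling H X g' by (rule assms(1))
  interpret h: group_hom G H h
    using assms(2) by unfold_locales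
  have ph: "h (phase (\<alpha> t)) = H.phase (\<alpha> t)" if "t \<in> {0..1}" for t
    using pathin_gwedge_in[OF assms(4) that] assms(3)
    by (auto simp: phase_def H.phase_def topspace_gwedge)
  have eq: "h (w t \<otimes> inv phase (\<alpha> t)) = h (w t) \<otimes>\<^bsub>H\<^esub> inv\<^bsub>H\<^esub> H.phase (\<alpha> t)" if "t \<in> {0..1}" for t
    using that lift_in[OF assms(5)] phase_path_closed[OF assms(4)] ph by simp
  show ?thesis
    unfolding H.lift_def
  proof (intro conjI allI impI ballI)
    show "h (w t) \<in> carrier H" if "t \<in> {0..1}" for t
      using lift_in[OF assms(5) that] by simp
    fix c d :: real assume cd: "0 \<le> c" "c \<le> d" "d \<le> 1"
    show "h (w c) = h (w d)" if "\<forall>t\<in>{c..d}. off_mid (\<alpha> t)"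
      using assms(5) cd that unfolding lift_def by metis
    show "h (w c) \<otimes>\<^bsub>H\<^esub> inv\<^bsub>H\<^esub> H.phase (\<alpha> c) = h (w d) \<otimes>\<^bsub>H\<^esub> inv\<^bsub>H\<^esub> H.phase (\<alpha> d)"
      if "\<forall>t\<in>{c..d}. \<alpha> t \<noteq> None"
      using assms(5) cd that eq[of c] eq[of d] unfolding lift_def by auto
  qed
qed

text \<open>The image under \<open>h\<close> of a lift and the tautological lift both lift \<alpha>
  for the labels in the fundamental group, so their increments agree. For free labels this says that
  \<Phi> is a right inverse of \<open>h\<close>.\<close>

lemma (in circle_labelling) hom_transport:
  assumes h: "h \<in> hom G (fundamental_group (gwedge_top X) None)"
    and hg: "\<And>x. x \<in> topspace X \<Longrightarrow> h (g x) = loop_class (gwedge_top X) None (wedge_loop x)"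
    and \<alpha>: "\<alpha> \<in> loops (gwedge_top X) None"
  shows "h (transport \<alpha> 0 1) = loop_class (gwedge_top X) None \<alpha>"
proof -
  let ?W = "gwedge_top X" and ?P = "fundamental_group (gwedge_top X) None"
  interpret h: group_hom G ?P h
    using h by unfold_locales
  note p\<alpha> = loopsD(1)[OF \<alpha>]
  obtain w where w: "lift \<alpha> 0 1 w"
    using lift_exists[OF p\<alpha>, of 0 1] by auto
  define v where "v t = loop_class ?W None (loop_join (sub_path \<alpha> 0 t) (rev_path (spoke (\<alpha> t))))" for t
  have v: "pi1_labelling.lift X \<alpha> 0 1 v"
    using spoke_lift[OF \<alpha>] by (simp add: v_def[abs_def])
  have hw: "pi1_labelling.lift X \<alpha> 0 1 (\<lambda>t. h (w t))"
    by (rule lift_hom[OF circle_labelling_pi1 h hg p\<alpha> w])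
  have spoke: "rev_path (spoke (\<alpha> t)) = const_path None" if "t = 0 \<or> t = 1" for t
    using that loopsD[OF \<alpha>] by (auto simp: fun_eq_iff rev_path_def const_path_def spoke_def)
  note c = loops_const_path[OF None_in_gwedge[of X]]
  have "path_hom ?W (sub_path \<alpha> 0 1) \<alpha>"
    using p\<alpha> by (intro path_hom_eq pathin_sub_path) (auto simp: sub_path_def)
  moreover have "pathin ?W (sub_path \<alpha> 0 1)"
    using p\<alpha> by (intro pathin_sub_path) auto
  ultimately have "path_hom ?W (loop_join (sub_path \<alpha> 0 1) (const_path None)) \<alpha>"
    using path_hom_const_right[of ?W "sub_path \<alpha> 0 1" None] loopsD[OF \<alpha>] path_hom_trans by fastforce
  moreover from path_hom_pathin(1)[OF this]
  have "loop_join (sub_path \<alpha> 0 1) (const_path None) \<in> loops ?W None"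
    using loopsD[OF \<alpha>] by (simp add: loops_def) (simp add: loop_join_def)
  ultimately have v1: "v 1 = loop_class ?W None \<alpha>"
    using \<alpha> by (simp add: v_def spoke loop_class_eq_iff)
  have "loop_join (sub_path \<alpha> 0 0) (const_path None) = const_path None"
    using loopsD[OF \<alpha>] by (auto simp: fun_eq_iff loop_join_def const_path_def sub_path_def)
  then have v0: "v 0 = \<one>\<^bsub>?P\<^esub>"
    by (simp add: v_def spoke one_fundamental_group)
  have "h (transport \<alpha> 0 1) = inv\<^bsub>?P\<^esub> h (w 0) \<otimes>\<^bsub>?P\<^esub> h (w 1)"
    using transport_eq[OF p\<alpha> w] lift_in[OF w] by simp
  also have "\<dots> = inv\<^bsub>?P\<^esub> v 0 \<otimes>\<^bsub>?P\<^esub> v 1"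
    by (rule pi1_labelling.lift_unique[OF p\<alpha> _ _ _ hw v]) simp_all
  also have "\<dots> = loop_class ?W None \<alpha>"
    using \<alpha> pi1_labelling.is_group[of X] by (simp add: v0 v1 group.is_monoid)
  finally show ?thesis .
qed

subsection \<open>Continuity of transport\<close>

lemma topspace_loop_space [simp]: "topspace (loop_space_top Y y) = loops Y y"
proof -
  \<comment> \<open>The empty compact set imposes no condition, so every function belongs to the
    ambient space.\<close>
  have "UNIV \<in> {{g. g ` K \<subseteq> U} | K U. compactin unit_itv K \<and> openin Y U}"
    by (auto intro!: exI[of _ "{}"])
  then show ?thesis
    by (auto simp: loop_space_top_def)
qed

lemma openin_loop_space:
  assumes "compactin unit_itv K" "openin Y U"
  shows "openin (loop_space_top Y y) {\<beta> \<in> loops Y y. \<forall>t\<in>K. \<beta> t \<in> U}"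
proof -
  have "openin (topology_generated_by {{g. g ` K \<subseteq> U} | K U. compactin unit_itv K \<and> openin Y U})
      {g. g ` K \<subseteq> U}"
    by (rule topology_generated_by_Basis) (use assms in blast)
  then have "openin (loop_space_top Y y) ({g. g ` K \<subseteq> U} \<inter> loops Y y)"
    unfolding loop_space_top_def by (rule openin_subtopology_Int)
  moreover have "{\<beta> \<in> loops Y y. \<forall>t\<in>K. \<beta> t \<in> U} = {g. g ` K \<subseteq> U} \<inter> loops Y y"
    by auto
  ultimately show ?thesis
    by simp
qed

lemma eventually_loops:
  "eventually (\<lambda>\<beta>. \<beta> \<in> loops Y y) (atin (loop_space_top Y y) \<alpha>)"
  by (simp add: eventually_atin) (metis DiffD1 openin_topspace topspace_loop_space)

lemma eventually_loop_in:
  assumes "compactin unit_itv K" "openin Y U" "\<alpha> \<in> loops Y y" "\<And>t. t \<in> K \<Longrightarrow> \<alpha> t \<in> U"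
  shows "eventually (\<lambda>\<beta>. \<forall>t\<in>K. \<beta> t \<in> U) (atin (loop_space_top Y y) \<alpha>)"
  unfolding eventually_atin
  using openin_loop_space[OF assms(1,2), of y] assms(3,4)
  by (intro disjI2 exI[of _ "{\<beta> \<in> loops Y y. \<forall>t\<in>K. \<beta> t \<in> U}"]) auto

lemma compactin_itv: "0 \<le> a \<Longrightarrow> b \<le> 1 \<Longrightarrow> compactin unit_itv {a..b}"
  by (auto simp: compactin_subtopology)

text \<open>The value \<open>\<one>\<close> at the base point makes \<open>end_phase\<close> continuous at \<open>\<alpha>\<close> whenever \<open>\<alpha> t\<close> is off the
  midpoints; elsewhere its jumps cancel against those of the transport.\<close>
definition (in circle_labelling) end_phase ::
  "(real \<Rightarrow> ('x \<times> real) option) \<Rightarrow> real \<Rightarrow> (real \<Rightarrow> ('x \<times> real) option) \<Rightarrow> 'a" where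
  "end_phase \<alpha> t \<beta> = (if \<alpha> t = None then \<one> else phase (\<beta> t))"

lemma (in circle_labelling) end_phase_closed:
  "pathin (gwedge_top X) \<beta> \<Longrightarrow> t \<in> {0..1} \<Longrightarrow> end_phase \<alpha> t \<beta> \<in> carrier G"
  by (simp add: end_phase_def phase_path_closed)

text \<open>At the base point \<open>end_phase\<close> is constant by definition. Elsewhere \<beta>
  t stays on the same side of the midpoints as \<alpha> t: before them \<open>phase\<close> is
  \<one>, past them it is \<open>g\<close> of the \<open>X\<close>-coordinate, which varies
  continuously.\<close>

lemma (in circle_labelling) limitin_end_phase:
  assumes T: "topspace T = carrier G" "continuous_map X T g"
    and \<alpha>: "\<alpha> \<in> loops (gwedge_top X) None" and t: "t \<in> {0..1}" "off_mid (\<alpha> t)"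
  shows "limitin T (end_phase \<alpha> t) (end_phase \<alpha> t \<alpha>) (atin (loop_space_top (gwedge_top X) None) \<alpha>)"
proof (cases "\<alpha> t")
  case None
  then have "end_phase \<alpha> t = (\<lambda>_. \<one>)"
    by (simp add: end_phase_def fun_eq_iff)
  then show ?thesis
    by (simp add: T)
next
  case (Some z)
  then obtain x s where xs: "\<alpha> t = Some (x, s)"
    by (cases z) auto
  let ?W = "gwedge_top X" and ?F = "atin (loop_space_top (gwedge_top X) None) \<alpha>"
  have xW: "x \<in> topspace X" "0 < s" "s < 1" "s \<noteq> 1/2" "\<alpha> t \<in> topspace ?W"
    using pathin_gwedge_in[OF loopsD(1)[OF \<alpha>] t(1)] xs t(2) by (auto simp: Some_in_gwedge off_mid_def)
  \<comment> \<open>The compact set is the single point \<open>t\<close>: evaluation at a time is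
    continuous.\<close>
  have near: "eventually (\<lambda>\<beta>. \<beta> t \<in> U) ?F" if "openin ?W U" "\<alpha> t \<in> U" for U
    using eventually_loop_in[OF compactin_itv that(1) \<alpha>, of t t] that(2) t(1) by simp
  show ?thesis
  proof (cases "s < 1/2")
    case True
    have "openin ?W {p \<in> topspace ?W. case p of None \<Rightarrow> False | Some z \<Rightarrow> snd z \<in> {0<..<1/2}}"
      by (rule openin_gwedge_level) auto
    from near[OF this] have "eventually (\<lambda>\<beta>. end_phase \<alpha> t \<beta> = \<one>) ?F"
      by (rule eventually_mono)
        (use xs xW True in \<open>auto simp: end_phase_def phase_def split: option.splits\<close>)
    moreover have "end_phase \<alpha> t \<alpha> = \<one>"
      using xs True by (simp add: end_phase_def phase_def)
    ultimately show ?thesis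
      by (intro limitin_eventually) (auto simp: T)
  next
    case False
    let ?B = "{p \<in> topspace ?W. p \<noteq> None}"
    have "continuous_map (subtopology ?W ?B) T (\<lambda>p. g (fst (the p)))"
      using continuous_map_compose[OF continuous_map_compose[OF continuous_map_the continuous_map_fst] T(2)]
      by (simp add: comp_def)
    note gT = openin_continuous_map_preimage[OF this]
    \<comment> \<open>Only past the midpoint is \<open>phase\<close> given by \<open>g\<close>, so
      \<beta> t must be kept there as well.\<close>
    have level: "openin ?W {p \<in> topspace ?W. case p of None \<Rightarrow> False | Some z \<Rightarrow> snd z \<in> {1/2<..<1}}"
      by (rule openin_gwedge_level) auto
    have "eventually (\<lambda>\<beta>. end_phase \<alpha> t \<beta> \<in> V) ?F" if V: "openin T V" "g x \<in> V" for V
    proof -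
      let ?V = "{p \<in> topspace (subtopology ?W ?B). g (fst (the p)) \<in> V}"
      have "openin ?W ?V"
        using gT[OF V(1)] openin_off_base[of X] by (rule openin_trans_full)
      then have "eventually (\<lambda>\<beta>. \<beta> t \<in> ?V) ?F"
        by (rule near) (use xW xs V in auto)
      moreover have "eventually (\<lambda>\<beta>. \<beta> t \<in> {p \<in> topspace ?W. case p of None \<Rightarrow> False | Some z \<Rightarrow> snd z \<in> {1/2<..<1}}) ?F"
        by (rule near[OF level]) (use xW xs False in auto)
      ultimately show ?thesis
        by eventually_elim (use xs in \<open>auto simp: end_phase_def phase_def split: option.splits\<close>)
    qed
    moreover have "end_phase \<alpha> t \<alpha> = g x"
      using xs False by (simp add: end_phase_def phase_def)
    ultimately show ?thesis
      using label_closed[OF xW(1)] by (simp add: limitin_def T)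
  qed
qed

text \<open>The subdivision comes from \<alpha> alone, and by compactness of the pieces nearby loops
  stay in the same open sets. Corrected by \<open>end_phase\<close> at both ends, transport still
  telescopes; it is eventually \<one> on pieces away from the base point, and a quotient of two
  convergent end phases on pieces away from the midpoints.\<close>

lemma (in circle_labelling) continuous_map_transport:
  assumes T: "group_topology G T" "continuous_map X T g"
  shows "continuous_map (loop_space_top (gwedge_top X) None) T (\<lambda>\<beta>. transport \<beta> 0 1)"
  unfolding continuous_map_atin
proof
  let ?W = "gwedge_top X"
  fix \<alpha> assume "\<alpha> \<in> topspace (loop_space_top ?W None)"
  then have \<alpha>: "\<alpha> \<in> loops ?W None"
    by simp
  let ?F = "atin (loop_space_top ?W None) \<alpha>"
  note top = group_topology_topspace[OF T(1)]
  note p\<alpha> = loopsD(1)[OF \<alpha>]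
  have ev: "eventually (\<lambda>\<beta>. pathin ?W \<beta>) ?F"
    by (rule eventually_mono[OF eventually_loops]) (rule loopsD(1))
  define \<Phi> where "\<Phi> a b \<beta> = end_phase \<alpha> a \<beta> \<otimes> transport \<beta> a b \<otimes> inv end_phase \<alpha> b \<beta>" for a b \<beta>
  have "limitin T (\<Phi> a b) (\<Phi> a b \<alpha>) ?F" if "0 \<le> a" "a \<le> b" "b \<le> 1" for a b
    using p\<alpha> that
  proof (induction rule: gwedge_path_induct)
    case (trans a b c)
    have mult: "\<Phi> a b \<beta> \<otimes> \<Phi> b c \<beta> = \<Phi> a c \<beta>" if "pathin ?W \<beta>" for \<beta>
    proof -
      have "end_phase \<alpha> t \<beta> \<in> carrier G" if "t \<in> {a, b, c}" for t
        using that trans \<open>pathin ?W \<beta>\<close> by (intro end_phase_closed) auto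
      moreover have "transport \<beta> a b \<in> carrier G" "transport \<beta> b c \<in> carrier G"
        using trans that by (auto intro: transport_closed)
      moreover have "inv x \<otimes> (x \<otimes> y) = y" if "x \<in> carrier G" "y \<in> carrier G" for x y
        using that by (simp add: m_assoc[symmetric])
      ultimately show ?thesis
        unfolding \<Phi>_def transport_trans[OF that trans(1-4), symmetric]
        by (simp add: m_assoc)
    qed
    have "limitin T (\<lambda>\<beta>. \<Phi> a b \<beta> \<otimes> \<Phi> b c \<beta>) (\<Phi> a b \<alpha> \<otimes> \<Phi> b c \<alpha>) ?F"
      using trans by (intro limitin_group_mult[OF T(1)])
    then show ?case
      unfolding mult[OF p\<alpha>] by (rule limitin_transform_eventually[rotated])
        (rule eventually_mono[OF ev mult])
  next
    case (off_base a b)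
    have one: "\<Phi> a b \<beta> = \<one>" if "pathin ?W \<beta>" "\<And>t. t \<in> {a..b} \<Longrightarrow> \<beta> t \<noteq> None" for \<beta>
    proof -
      have "phase (\<beta> a) \<in> carrier G" "phase (\<beta> b) \<in> carrier G"
        using phase_path_closed[OF that(1)] off_base by auto
      moreover have "transport \<beta> a b = inv phase (\<beta> a) \<otimes> phase (\<beta> b)"
        using off_base that by (intro transport_off_base) auto
      moreover have "\<alpha> a \<noteq> None" "\<alpha> b \<noteq> None"
        using off_base(4)[of a] off_base(4)[of b] off_base(2) by auto
      ultimately show ?thesis
        by (auto simp: \<Phi>_def end_phase_def m_assoc)
    qed
    have "\<alpha> t \<in> {p \<in> topspace ?W. p \<noteq> None}" if "t \<in> {a..b}" for t
      using off_base pathin_gwedge_in[OF p\<alpha>, of t] that by auto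
    with off_base have "eventually (\<lambda>\<beta>. \<forall>t\<in>{a..b}. \<beta> t \<in> {p \<in> topspace ?W. p \<noteq> None}) ?F"
      by (intro eventually_loop_in compactin_itv openin_off_base \<alpha>)
    with ev have "eventually (\<lambda>\<beta>. \<Phi> a b \<beta> = \<one>) ?F"
      by eventually_elim (rule one; blast)
    moreover have "\<Phi> a b \<alpha> = \<one>"
      using off_base by (intro one[OF p\<alpha>])
    ultimately show ?case
      using top by (intro limitin_eventually) simp_all
  next
    case (off_mid a b)
    have eq: "\<Phi> a b \<beta> = end_phase \<alpha> a \<beta> \<otimes> inv end_phase \<alpha> b \<beta>"
      if "pathin ?W \<beta>" "\<And>t. t \<in> {a..b} \<Longrightarrow> off_mid (\<beta> t)" for \<beta>
      using off_mid that end_phase_closed[OF that(1), of a \<alpha>] transport_off_mid[OF that(1), of a b]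
      by (simp add: \<Phi>_def)
    have "\<alpha> t \<in> {p \<in> topspace ?W. off_mid p}" if "t \<in> {a..b}" for t
      using off_mid pathin_gwedge_in[OF p\<alpha>, of t] that by auto
    with off_mid have "eventually (\<lambda>\<beta>. \<forall>t\<in>{a..b}. \<beta> t \<in> {p \<in> topspace ?W. off_mid p}) ?F"
      by (intro eventually_loop_in compactin_itv openin_off_mid \<alpha>)
    with ev have "eventually (\<lambda>\<beta>. end_phase \<alpha> a \<beta> \<otimes> inv end_phase \<alpha> b \<beta> = \<Phi> a b \<beta>) ?F"
      by eventually_elim (rule eq[symmetric]; blast)
    note trans = limitin_transform_eventually[OF this]
    have "limitin T (\<lambda>\<beta>. end_phase \<alpha> a \<beta> \<otimes> inv end_phase \<alpha> b \<beta>)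
        (end_phase \<alpha> a \<alpha> \<otimes> inv end_phase \<alpha> b \<alpha>) ?F"
      using off_mid
      by (intro limitin_group_mult[OF T(1)] limitin_group_inv[OF T(1)] limitin_end_phase[OF top T(2) \<alpha>]) auto
    then have "limitin T (\<Phi> a b) (end_phase \<alpha> a \<alpha> \<otimes> inv end_phase \<alpha> b \<alpha>) ?F"
      by (rule trans)
    moreover have "\<Phi> a b \<alpha> = end_phase \<alpha> a \<alpha> \<otimes> inv end_phase \<alpha> b \<alpha>"
      using off_mid by (intro eq[OF p\<alpha>])
    ultimately show ?case
      by simp
  qed
  from this[of 0 1] have lim: "limitin T (\<Phi> 0 1) (\<Phi> 0 1 \<alpha>) ?F"
    by simp
  \<comment> \<open>At times 0 and 1 the loop \<alpha> is at the base point, so both corrections are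
    \<one>.\<close>
  have eq: "\<Phi> 0 1 \<beta> = transport \<beta> 0 1" if "pathin ?W \<beta>" for \<beta>
    using loopsD[OF \<alpha>] transport_closed[OF that, of 0 1] by (simp add: \<Phi>_def end_phase_def)
  show "limitin T (\<lambda>\<beta>. transport \<beta> 0 1) (transport \<alpha> 0 1) ?F"
    using lim unfolding eq[OF p\<alpha>]
    by (rule limitin_transform_eventually[rotated]) (rule eventually_mono[OF ev eq])
qed

text \<open>The tube lemma: projection along the compact \<open>K\<close> is closed, so the points
  whose circle leaves \<open>U\<close> at some time in \<open>K\<close> form a closed set.\<close>

lemma continuous_map_wedge_loop:
  "continuous_map X (loop_space_top (gwedge_top X) None) wedge_loop"
proof -
  let ?W = "gwedge_top X"
  let ?S = "{{g. g ` K \<subseteq> U} | K U. compactin unit_itv K \<and> openin ?W U}"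
  have "continuous_map X (topology_generated_by ?S) wedge_loop"
  proof (rule continuous_on_generated_topo)
    fix A assume "A \<in> ?S"
    then obtain K U where KU: "A = {g. g ` K \<subseteq> U}" "compactin unit_itv K" "openin ?W U"
      by auto
    then have K: "K \<subseteq> {0..1}"
      using compactin_subset_topspace[OF KU(2)] by simp
    let ?P = "prod_topology X (subtopology unit_itv K)"
    have "continuous_map ?P ?W (\<lambda>z. wedge_pt (fst z) (snd z))"
      by (intro continuous_map_wedge_pt_comp continuous_map_fst
          continuous_map_compose[OF continuous_map_snd
            continuous_map_from_subtopology[OF continuous_map_id], unfolded comp_def id_def])
    from openin_continuous_map_preimage[OF this KU(3)]
    have "closedin ?P (topspace ?P - {z \<in> topspace ?P. wedge_pt (fst z) (snd z) \<in> U})"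
      by blast
    moreover define C where "C = (SIGMA x:topspace X. {t \<in> K. wedge_pt x t \<notin> U})"
    have "topspace ?P - {z \<in> topspace ?P. wedge_pt (fst z) (snd z) \<in> U} = C"
      using K by (auto simp: C_def)
    ultimately have "closedin ?P C"
      by simp
    moreover have "closed_map ?P X fst"
      using KU(2) by (intro closed_map_fst) (simp add: compact_space_subtopology)
    ultimately have "closedin X (fst ` C)"
      by (simp add: closed_map_def)
    moreover have "wedge_loop x ` K \<subseteq> U \<longleftrightarrow> (\<forall>t\<in>K. wedge_pt x t \<in> U)" for x
      using K by (auto simp: wedge_loop_def image_subset_iff subset_iff)
    then have "wedge_loop -` A \<inter> topspace X = topspace X - fst ` C"
      by (auto simp: KU(1) C_def fst_image_Sigma)
    ultimately show "openin X (wedge_loop -` A \<inter> topspace X)"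
      by auto
  next
    have "UNIV \<in> ?S"
      by (auto intro!: exI[of _ "{}"])
    then show "wedge_loop ` topspace X \<subseteq> \<Union> ?S"
      by auto
  qed
  then show ?thesis
    unfolding loop_space_top_def
    by (intro continuous_map_into_subtopology) (auto intro: wedge_loop_in_loops)
qed

subsection \<open>The isomorphism\<close>

lemma topspace_pi0: "topspace (pi0_top X) = path_component_of_set X ` topspace X"
  by (simp add: pi0_top_def)

lemma continuous_map_component: "continuous_map X (pi0_top X) (path_component_of_set X)"
  unfolding pi0_top_def by (rule quotient_imp_continuous_map[OF quotient_map_quotient_top])

lemma component_some:
  assumes "x \<in> topspace X"
  shows "path_component_of X x (SOME y. y \<in> path_component_of_set X x)"
proof -
  have "(SOME y. y \<in> path_component_of_set X x) \<in> path_component_of_set X x"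
    by (rule someI[where P = "\<lambda>y. y \<in> path_component_of_set X x" and x = x])
      (simp add: path_component_of_refl assms)
  then show ?thesis by simp
qed

lemma component_eq: "path_component_of X x y \<Longrightarrow> path_component_of_set X x = path_component_of_set X y"
  using path_component_of_equiv[of X x y] by simp

lemma circle_labelling_free:
  "circle_labelling (free_grp (topspace (pi0_top X))) X (\<lambda>x. free_gen (path_component_of_set X x))"
  unfolding circle_labelling_def circle_labelling_axioms_def
proof (intro conjI allI impI group_free_grp)
  show "free_gen (path_component_of_set X x) \<in> carrier (free_grp (topspace (pi0_top X)))"
    if "x \<in> topspace X" for x
    using that by (intro free_gen_closed) (simp add: topspace_pi0)
  show "free_gen (path_component_of_set X x) = free_gen (path_component_of_set X y)"
    if "path_component_of X x y" for x y
    by (simp only: component_eq[OF that])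
qed

interpretation free_labelling: circle_labelling "free_grp (topspace (pi0_top X))" X
  "\<lambda>x. free_gen (path_component_of_set X x)" for X
  by (rule circle_labelling_free)

lemma topspace_pi1_qtop: "topspace (pi1_qtop Y y) = carrier (fundamental_group Y y)"
  by (simp add: pi1_qtop_def)

lemma is_hX_exists: "\<exists>h. is_hX X h"
proof -
  let ?W = "gwedge_top X" and ?F = "free_grp (topspace (pi0_top X))" and ?M = "markov_top (pi0_top X)"
  let ?G = "fundamental_group ?W None" and ?Q = "pi1_qtop ?W None"
  note G = pi1_labelling.is_group[of X] and F = free_labelling.is_group[of X]
  note topQ = topspace_pi1_qtop[of ?W None]
  have T: "group_topology ?G (tau_top ?G ?Q)"
    by (rule group_topology_tau[OF G topQ])
  have q: "quotient_map (loop_space_top ?W None) ?Q (loop_class ?W None)"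
    unfolding pi1_qtop_def by (rule quotient_map_quotient_top)

  \<comment> \<open>A representative of the component is chosen; the class of its circle is
    independent of it, because moving \<open>x\<close> along a path moves the circle by a
    homotopy.\<close>
  define u where "u C = loop_class ?W None (wedge_loop (SOME x. x \<in> C))" for C
  define h where "h = free_lift ?G u"
  have u: "u (path_component_of_set X x) = loop_class ?W None (wedge_loop x)" if "x \<in> topspace X" for x
    unfolding u_def by (rule pi1_labelling.label_component[OF component_some[OF that], symmetric])
  have u_in: "u \<in> topspace (pi0_top X) \<rightarrow> carrier ?G"
    using u pi1_labelling.label_closed by (auto simp: topspace_pi0)
  have h_hom: "h \<in> hom ?F ?G"
    unfolding h_def by (rule group.free_lift_hom[OF G u_in])
  have h_gen: "h (free_gen C) = u C" if "C \<in> topspace (pi0_top X)" for C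
    unfolding h_def using u_in that by (intro group.free_lift_gen[OF G]) auto
  have h_x: "h (free_gen (path_component_of_set X x)) = loop_class ?W None (wedge_loop x)"
    if "x \<in> topspace X" for x
    using that h_gen u by (simp add: topspace_pi0)
  have "continuous_map (pi0_top X) (tau_top ?G ?Q) u"
    unfolding pi0_top_def
  proof (rule continuous_compose_quotient_map[OF quotient_map_quotient_top])
    have "continuous_map X ?Q (loop_class ?W None \<circ> wedge_loop)"
      by (rule continuous_map_compose[OF continuous_map_wedge_loop quotient_imp_continuous_map[OF q]])
    from continuous_map_compose[OF this tau_coarser[OF G topQ]]
    show "continuous_map X (tau_top ?G ?Q) (u \<circ> path_component_of_set X)"
      by (rule continuous_map_eq) (simp add: u)
  qed
  then have "continuous_map (pi0_top X) (tau_top ?G ?Q) (h \<circ> free_gen)"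
    by (rule continuous_map_eq) (simp add: h_gen)
  then have h_cont: "continuous_map ?M (tau_top ?G ?Q) h"
    by (rule markov_universal[OF G T h_hom])

  \<comment> \<open>Independence of the representative is homotopy invariance of transport.\<close>
  define \<Phi> where "\<Phi> A = free_labelling.transport X (SOME p. p \<in> A) 0 1" for A
  have \<Phi>: "\<Phi> (loop_class ?W None p) = free_labelling.transport X p 0 1" if "p \<in> loops ?W None" for p
    unfolding \<Phi>_def
    using loop_class_some[OF that] loopsD[OF that]
    by (intro free_labelling.transport_path_hom[symmetric]) auto
  have \<Phi>_hom: "\<Phi> \<in> hom ?G ?F"
  proof (rule homI)
    fix A assume "A \<in> carrier ?G"
    then obtain p where p: "p \<in> loops ?W None" "A = loop_class ?W None p"
      by auto
    then show "\<Phi> A \<in> carrier ?F"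
      using free_labelling.transport_closed[OF loopsD(1)[OF p(1)], of 0 1] by (simp add: \<Phi>)
    fix B assume "B \<in> carrier ?G"
    then obtain q where q: "q \<in> loops ?W None" "B = loop_class ?W None q"
      by auto
    show "\<Phi> (A \<otimes>\<^bsub>?G\<^esub> B) = \<Phi> A \<otimes>\<^bsub>?F\<^esub> \<Phi> B"
      using p q free_labelling.transport_loop_join[OF loopsD(1)[OF p(1)] loopsD(1)[OF q(1)]]
      by (simp add: mult_fundamental_group \<Phi> loops_loop_join loopsD(2,3)[OF p(1)] loopsD(2,3)[OF q(1)])
  qed
  \<comment> \<open>The labelling is continuous on all of \<open>X\<close>, even if components are
    not open, because the generators carry the quotient topology from \<open>X\<close>.\<close>
  have g_cont: "continuous_map X ?M (\<lambda>x. free_gen (path_component_of_set X x))"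
    using continuous_map_compose[OF continuous_map_component continuous_map_free_gen]
    by (simp add: comp_def)
  \<comment> \<open>Continuity on loops descends to \<open>pi1_qtop\<close>; since \<Phi> is a
    homomorphism to a topological group, \<open>tau_universal\<close> then carries it over to the
    coarser topology.\<close>
  have "continuous_map ?Q ?M \<Phi>"
  proof (rule continuous_compose_quotient_map[OF q])
    show "continuous_map (loop_space_top ?W None) ?M (\<Phi> \<circ> loop_class ?W None)"
      by (rule continuous_map_eq[OF free_labelling.continuous_map_transport[OF group_topology_markov g_cont]])
        (simp add: \<Phi>)
  qed
  then have \<Phi>_cont: "continuous_map (tau_top ?G ?Q) ?M \<Phi>"
    by (rule tau_universal[OF G topQ F group_topology_markov \<Phi>_hom])

  have h\<Phi>: "h (\<Phi> A) = A" if "A \<in> carrier ?G" for A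
  proof -
    obtain p where p: "p \<in> loops ?W None" "A = loop_class ?W None p"
      using \<open>A \<in> carrier ?G\<close> by auto
    then show ?thesis
      using free_labelling.hom_transport[OF h_hom h_x p(1)] by (simp add: \<Phi>)
  qed
  have \<Phi>h: "\<Phi> (h w) = w" if "w \<in> carrier ?F" for w
  proof -
    have "(\<Phi> \<circ> h) w = (\<lambda>w. w) w"
    proof (rule group.hom_free_grp_unique[OF F hom_compose[OF h_hom \<Phi>_hom] _ _ that])
      show "(\<lambda>w. w) \<in> hom ?F ?F"
        by (simp add: hom_def)
      fix C assume "C \<in> topspace (pi0_top X)"
      then obtain x where "x \<in> topspace X" "C = path_component_of_set X x"
        by (auto simp: topspace_pi0)
      then show "(\<Phi> \<circ> h) (free_gen C) = free_gen C"
        by (simp add: h_x \<Phi> wedge_loop_in_loops free_labelling.transport_wedge_loop)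
    qed
    then show ?thesis by simp
  qed
  have "bij_betw h (carrier ?F) (carrier ?G)"
  proof (rule bij_betw_byWitness[of _ \<Phi>])
    show "h ` carrier ?F \<subseteq> carrier ?G" "\<Phi> ` carrier ?G \<subseteq> carrier ?F"
      by (intro image_subsetI hom_in_carrier[OF h_hom] hom_in_carrier[OF \<Phi>_hom]; assumption)+
  qed (use \<Phi>h h\<Phi> in blast)+
  then have "h \<in> iso ?F ?G"
    using h_hom by (simp add: iso_def)
  moreover have "homeomorphic_maps ?M (tau_top ?G ?Q) h \<Phi>"
    using h_cont \<Phi>_cont h\<Phi> \<Phi>h
    by (simp add: homeomorphic_maps_def topspace_markov topspace_tau[OF G topQ])
  then have "homeomorphic_map ?M (tau_top ?G ?Q) h"
    unfolding homeomorphic_map_maps by blast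
  ultimately have "is_hX X h"
    using h_x by (simp add: is_hX_def top_group_iso_def gwedge_base_def pi1_tau_top_def)
  then show ?thesis
    by blast
qed

section \<open>Naturality\<close>

lemma pi0_map_component:
  assumes "continuous_map X Y f" "x \<in> topspace X"
  shows "pi0_map X Y f (path_component_of_set X x) = path_component_of_set Y (f x)"
proof -
  obtain p where "pathin X p" "p 0 = x" "p 1 = (SOME y. y \<in> path_component_of_set X x)"
    using component_some[OF assms(2)] unfolding path_component_of_def by auto
  then have "path_component_of Y (f x) (f (SOME y. y \<in> path_component_of_set X x))"
    using pathin_compose[OF _ assms(1), of p] unfolding path_component_of_def
    by (intro exI[of _ "f \<circ> p"]) simp
  then show ?thesis
    unfolding pi0_map_def by (rule component_eq[symmetric])
qed

text \<open>Holds for arbitrary choices of \<open>hX\<close> and \<open>hY\<close>, because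
  \<open>is_hX\<close> prescribes the values on generators and both composites are homomorphisms out
  of a free group.\<close>

lemma is_hX_natural:
  assumes f: "continuous_map X Y f" and hX: "is_hX X hX" and hY: "is_hX Y hY"
    and w: "w \<in> carrier (free_grp (topspace (pi0_top X)))"
  shows "hY (free_map (pi0_map X Y f) w)
    = pi1_map (gwedge_top X) gwedge_base (gwedge_top Y) gwedge_base (gwedge_map f) (hX w)"
proof -
  let ?FX = "free_grp (topspace (pi0_top X))" and ?FY = "free_grp (topspace (pi0_top Y))"
  let ?GX = "fundamental_group (gwedge_top X) None" and ?GY = "fundamental_group (gwedge_top Y) None"
  let ?m = "pi1_map (gwedge_top X) None (gwedge_top Y) None (gwedge_map f)"
  note fW = continuous_map_gwedge_map[OF f]
  have fN: "gwedge_map f None = None"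
    by (simp add: gwedge_map_def)
  have fY: "f x \<in> topspace Y" if "x \<in> topspace X" for x
    using f that by (auto simp: continuous_map_def)
  have pi0: "pi0_map X Y f \<in> topspace (pi0_top X) \<rightarrow> topspace (pi0_top Y)"
    using pi0_map_component[OF f] fY by (auto simp: topspace_pi0)
  have homs: "hX \<in> hom ?FX ?GX" "hY \<in> hom ?FY ?GY"
    using hX hY by (auto simp: is_hX_def top_group_iso_def iso_def gwedge_base_def)
  have "(hY \<circ> free_map (pi0_map X Y f)) w = (?m \<circ> hX) w"
  proof (rule group.hom_free_grp_unique[OF pi1_labelling.is_group hom_compose[OF free_map_hom[OF pi0] homs(2)]
        hom_compose[OF homs(1) pi1_map_hom[OF fW fN]] _ w])
    fix C assume "C \<in> topspace (pi0_top X)"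
    then obtain x where x: "x \<in> topspace X" "C = path_component_of_set X x"
      by (auto simp: topspace_pi0)
    have "free_map (pi0_map X Y f) (free_gen C) = free_gen (path_component_of_set Y (f x))"
      using pi0_map_component[OF f x(1)] by (simp add: free_map_def free_gen_def reduce_word_def x(2))
    then have "hY (free_map (pi0_map X Y f) (free_gen C)) = loop_class (gwedge_top Y) None (wedge_loop (f x))"
      using hY fY[OF x(1)] by (simp add: is_hX_def gwedge_base_def)
    also have "wedge_loop (f x) = restrict (gwedge_map f \<circ> wedge_loop x) {0..1}"
      by (auto simp: fun_eq_iff wedge_loop_def wedge_pt_def gwedge_map_def)
    also have "loop_class (gwedge_top Y) None \<dots> = ?m (hX (free_gen C))"
      using hX x pi1_map_loop_class[OF fW fN wedge_loop_in_loops[OF x(1)]]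
      by (simp add: is_hX_def gwedge_base_def)
    finally show "(hY \<circ> free_map (pi0_map X Y f)) (free_gen C) = (?m \<circ> hX) (free_gen C)"
      by simp
  qed
  then show ?thesis
    by (simp add: gwedge_base_def)
qed

theorem theorem4p1:
  fixes X :: "'a topology" and Y :: "'b topology" and f :: "'a \<Rightarrow> 'b"
  assumes "continuous_map X Y f"
  shows "(\<exists>h. is_hX X h)
    \<and> (\<forall>hX hY. is_hX X hX \<and> is_hX Y hY \<longrightarrow>
         (\<forall>w \<in> carrier (free_grp (topspace (pi0_top X))).
            hY (free_map (pi0_map X Y f) w)
            = pi1_map (gwedge_top X) gwedge_base (gwedge_top Y) gwedge_base (gwedge_map f) (hX w)))"
  using is_hX_exists is_hX_natural[OF assms] by blast

end
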